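(* There is a polynomial-time, $O\!\left(\tfrac{\log\eta}{\log\log\eta}\right)$-competitive learning-augmented online algorithm for metric facility location.
   Context: Online metric facility location: clients and facilities are vertices of a graph $G=(V,E)$ with a metric distance $\mathsf{dist}$ on $V$; each facility $f$ has an opening cost. Clients of a set $C$ arrive one by one, and upon arrival each must be irrevocably connected to an opened facility (facilities are opened irrevocably); the cost is the total opening cost plus the sum of client–facility distances. A learning-augmented algorithm receives beforehand a predicted set $\hat{X}$ of clients; with $X$ the actually arriving clients, the prediction error is $\eta:=\min(|X|,|(X\setminus\hat{X})\cup(\hat{X}\setminus X)|)$. Competitive ratio $\rho$: the cost is always at most $\rho$ times the optimal offline cost for $X$. *)

theory Defs
  imports
    "HOL-Analysis.Abstract_Metric_Spaces"
    "HOL-Library.Landau_Symbols"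
    "HOL-Library.FuncSet"
    "HOL-Library.Log_Nat"
    "HOL-Computational_Algebra.Polynomial"
begin

section \<open>Polynomial time\<close>

text \<open>
  The machine model is a random access machine with indirect addressing under the
  logarithmic cost criterion, presented as a structured while-language. The memory consists of
  arrays of unbounded integers; a scalar variable is cell 0 of an array. A program mentions only
  finitely many array names. Every access and every operation is charged the bit lengths of the
  addresses and values involved, so polynomial time here is the usual (Turing machine) notion.
\<close>

definition int_size :: "int \<Rightarrow> nat" where
  "int_size k = Suc (floorlog 2 (nat \<bar>k\<bar>))"

definition list_size :: "int list \<Rightarrow> nat" where
  "list_size ks = (\<Sum>k\<leftarrow>ks. int_size k)"

type_synonym vname = string
type_synonym store = "vname \<Rightarrow> int \<Rightarrow> int"

datatype aexp =
    Const int
  | Cell vname aexp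
  | Plus aexp aexp
  | Minus aexp aexp
  | Mult aexp aexp
  | Quot aexp aexp

datatype bexp = Less aexp aexp | Neg bexp | Conj bexp bexp

datatype com =
    Skip
  | Assign vname aexp aexp  \<comment> \<open>array name, index, value\<close>
  | Seq com com
  | Cond bexp com com
  | While bexp com

fun aval :: "aexp \<Rightarrow> store \<Rightarrow> int" where
  "aval (Const k) s = k"
| "aval (Cell x a) s = s x (aval a s)"
| "aval (Plus a b) s = aval a s + aval b s"
| "aval (Minus a b) s = aval a s - aval b s"
| "aval (Mult a b) s = aval a s * aval b s"
| "aval (Quot a b) s = aval a s div aval b s"

fun bval :: "bexp \<Rightarrow> store \<Rightarrow> bool" where
  "bval (Less a b) s = (aval a s < aval b s)"
| "bval (Neg b) s = (\<not> bval b s)"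
| "bval (Conj b c) s = (bval b s \<and> bval c s)"

definition operand_cost :: "aexp \<Rightarrow> aexp \<Rightarrow> store \<Rightarrow> nat" where
  "operand_cost a b s = int_size (aval a s) + int_size (aval b s)"

fun acost :: "aexp \<Rightarrow> store \<Rightarrow> nat" where
  "acost (Const k) s = int_size k"
| "acost (Cell x a) s = acost a s + int_size (aval a s) + int_size (s x (aval a s))"
| "acost (Plus a b) s = acost a s + acost b s + operand_cost a b s"
| "acost (Minus a b) s = acost a s + acost b s + operand_cost a b s"
| "acost (Mult a b) s = acost a s + acost b s + operand_cost a b s"
| "acost (Quot a b) s = acost a s + acost b s + operand_cost a b s"

fun bcost :: "bexp \<Rightarrow> store \<Rightarrow> nat" where
  "bcost (Less a b) s = acost a s + acost b s + operand_cost a b s"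
| "bcost (Neg b) s = Suc (bcost b s)"
| "bcost (Conj b c) s = Suc (bcost b s + bcost c s)"

text \<open>\<open>exec c s t s'\<close>: program \<open>c\<close> started in \<open>s\<close> terminates in \<open>s'\<close> at cost \<open>t\<close>.\<close>

inductive exec :: "com \<Rightarrow> store \<Rightarrow> nat \<Rightarrow> store \<Rightarrow> bool" where
  Skip: "exec Skip s 1 s"
| Assign: "exec (Assign x a b) s (acost a s + acost b s + operand_cost a b s)
             (s(x := (s x)(aval a s := aval b s)))"
| Seq: "exec c s t s' \<Longrightarrow> exec d s' u s'' \<Longrightarrow> exec (Seq c d) s (t + u) s''"
| IfTrue: "bval b s \<Longrightarrow> exec c s t s' \<Longrightarrow> exec (Cond b c d) s (bcost b s + t) s'"
| IfFalse: "\<not> bval b s \<Longrightarrow> exec d s t s' \<Longrightarrow> exec (Cond b c d) s (bcost b s + t) s'"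
| WhileFalse: "\<not> bval b s \<Longrightarrow> exec (While b c) s (bcost b s) s"
| WhileTrue: "bval b s \<Longrightarrow> exec c s t s' \<Longrightarrow> exec (While b c) s' u s'' \<Longrightarrow>
             exec (While b c) s (bcost b s + t + u) s''"

inductive_cases exec_SkipE: "exec Skip s t s'"
inductive_cases exec_AssignE: "exec (Assign x a b) s t s'"
inductive_cases exec_SeqE: "exec (Seq c d) s t s'"
inductive_cases exec_IfE: "exec (Cond b c d) s t s'"
inductive_cases exec_WhileE: "exec (While b c) s t s'"

lemma exec_deterministic:
  assumes "exec c s t s'" and "exec c s u s''"
  shows "t = u \<and> s' = s''"
  using assms
proof (induction arbitrary: u s'' rule: exec.induct)
  case (Skip s)
  then show ?case by (rule exec_SkipE) simp
next
  case (Assign x a b s)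
  then show ?case by (rule exec_AssignE) simp
next
  case (Seq c s t s1 d t' s2)
  from Seq.prems obtain u1 v s' where "exec c s u1 s'" "exec d s' v s''" "u = u1 + v"
    by (rule exec_SeqE)
  with Seq.IH show ?case by blast
next
  case (IfTrue b s c t s1 d)
  from IfTrue.prems obtain u1 where "exec c s u1 s''" "u = bcost b s + u1"
    by (rule exec_IfE) (use IfTrue.hyps in blast)+
  with IfTrue.IH show ?case by blast
next
  case (IfFalse b s d t s1 c)
  from IfFalse.prems obtain u1 where "exec d s u1 s''" "u = bcost b s + u1"
    by (rule exec_IfE) (use IfFalse.hyps in blast)+
  with IfFalse.IH show ?case by blast
next
  case (WhileFalse b s c)
  from WhileFalse.prems show ?case
    by (rule exec_WhileE) (use WhileFalse.hyps in blast)+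
next
  case (WhileTrue b s c t s1 t' s2)
  from WhileTrue.prems obtain u1 v s'
    where "exec c s u1 s'" "exec (While b c) s' v s''" "u = bcost b s + u1 + v"
    by (rule exec_WhileE) (use WhileTrue.hyps in blast)+
  with WhileTrue.IH show ?case by blast
qed

definition input_store :: "int list \<Rightarrow> store" where
  "input_store ks x i =
     (if x = ''in'' \<and> 0 \<le> i \<and> i < int (length ks) then ks ! nat i
      else if x = ''inlen'' \<and> i = 0 then int (length ks)
      else 0)"

definition output_of :: "store \<Rightarrow> int list" where
  "output_of s = map (\<lambda>i. s ''out'' (int i)) [0..<nat (s ''outlen'' 0)]"

definition polytime_on ::
  "'a set \<Rightarrow> ('a \<Rightarrow> int list) \<Rightarrow> ('b \<Rightarrow> int list) \<Rightarrow> ('a \<Rightarrow> 'b) \<Rightarrow> bool" where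
  "polytime_on D encode_in encode_out f \<longleftrightarrow>
     (\<exists>c (p :: nat poly). \<forall>x\<in>D. \<exists>t s.
        exec c (input_store (encode_in x)) t s \<and>
        t \<le> poly p (list_size (encode_in x)) \<and>
        output_of s = encode_out (f x))"


section \<open>Metric facility location\<close>

text \<open>
  The vertices are numbered \<open>0, \<dots>, n - 1\<close>. Distances and opening costs are rational, so that
  instances have a finite encoding. The edges are part of the instance, but feasibility and cost
  depend only on the metric.
\<close>

datatype fl_instance = FL_Instance
  (num_vertices: nat)
  (edges: "nat set set")
  (distance: "nat \<Rightarrow> nat \<Rightarrow> rat")
  (facilities: "nat set")
  (opening_cost: "nat \<Rightarrow> rat")

definition vertices :: "fl_instance \<Rightarrow> nat set" where
  "vertices I = {..<num_vertices I}"

definition fl_wf :: "fl_instance \<Rightarrow> bool" where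
  "fl_wf I \<longleftrightarrow>
     (\<forall>e\<in>edges I. e \<subseteq> vertices I \<and> card e = 2) \<and>
     Metric_space (vertices I) (\<lambda>u v. real_of_rat (distance I u v)) \<and>
     facilities I \<subseteq> vertices I \<and> facilities I \<noteq> {} \<and>
     (\<forall>f\<in>facilities I. 0 \<le> opening_cost I f)"

text \<open>An offline solution for the client set \<open>X\<close> is a set of opened facilities together with an
  assignment of the clients to opened facilities.\<close>

definition solutions :: "fl_instance \<Rightarrow> nat set \<Rightarrow> (nat set \<times> (nat \<Rightarrow> nat)) set" where
  "solutions I X = (SIGMA S : Pow (facilities I). X \<rightarrow>\<^sub>E S)"

definition solution_cost :: "fl_instance \<Rightarrow> nat set \<Rightarrow> nat set \<times> (nat \<Rightarrow> nat) \<Rightarrow> rat" where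
  "solution_cost I X = (\<lambda>(S, \<phi>). (\<Sum>f\<in>S. opening_cost I f) + (\<Sum>x\<in>X. distance I x (\<phi> x)))"

definition opt :: "fl_instance \<Rightarrow> nat set \<Rightarrow> rat" where
  "opt I X = Min (solution_cost I X ` solutions I X)"

lemma solutions_finite_nonempty:
  assumes "fl_wf I" and "X \<subseteq> vertices I"
  shows "finite (solutions I X)" and "solutions I X \<noteq> {}"
proof -
  have fin: "finite X" "finite (facilities I)"
    using assms by (auto simp: fl_wf_def vertices_def intro: finite_subset)
  then show "finite (solutions I X)"
    unfolding solutions_def by (intro finite_SigmaI finite_PiE) (auto intro: finite_subset)
  obtain f where "f \<in> facilities I" using assms by (auto simp: fl_wf_def)
  then have "(facilities I, restrict (\<lambda>_. f) X) \<in> solutions I X"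
    by (auto simp: solutions_def)
  then show "solutions I X \<noteq> {}" by blast
qed


section \<open>Learning-augmented online algorithms\<close>

text \<open>
  The decision upon an arrival is a function of the instance, the predicted client set and the
  clients that have arrived so far, the current one last. It consists of the set of facilities
  opened now and the facility to which the current client is connected. Decisions taken at earlier
  arrivals are determined by shorter prefixes, hence irrevocable.
\<close>

type_synonym online_alg = "fl_instance \<Rightarrow> nat set \<Rightarrow> nat list \<Rightarrow> nat set \<times> nat"

definition legal_input :: "fl_instance \<Rightarrow> nat set \<Rightarrow> nat list \<Rightarrow> bool" where
  "legal_input I Xhat xs \<longleftrightarrow>
     fl_wf I \<and> Xhat \<subseteq> vertices I \<and> set xs \<subseteq> vertices I \<and> distinct xs"

definition opened :: "online_alg \<Rightarrow> fl_instance \<Rightarrow> nat set \<Rightarrow> nat list \<Rightarrow> nat set" where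
  "opened A I Xhat xs = (\<Union>i<length xs. fst (A I Xhat (take (Suc i) xs)))"

definition feasible :: "online_alg \<Rightarrow> bool" where
  "feasible A \<longleftrightarrow>
     (\<forall>I Xhat xs. legal_input I Xhat xs \<and> xs \<noteq> [] \<longrightarrow>
        fst (A I Xhat xs) \<subseteq> facilities I \<and>
        snd (A I Xhat xs) \<in> opened A I Xhat xs)"

definition online_cost :: "online_alg \<Rightarrow> fl_instance \<Rightarrow> nat set \<Rightarrow> nat list \<Rightarrow> rat" where
  "online_cost A I Xhat xs =
     (\<Sum>f\<in>opened A I Xhat xs. opening_cost I f) +
     (\<Sum>i<length xs. distance I (xs ! i) (snd (A I Xhat (take (Suc i) xs))))"

definition prediction_error :: "nat set \<Rightarrow> nat set \<Rightarrow> nat" where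
  "prediction_error X Xhat = min (card X) (card ((X - Xhat) \<union> (Xhat - X)))"

definition competitive :: "online_alg \<Rightarrow> (nat \<Rightarrow> real) \<Rightarrow> bool" where
  "competitive A \<rho> \<longleftrightarrow>
     (\<forall>I Xhat xs. legal_input I Xhat xs \<longrightarrow>
        real_of_rat (online_cost A I Xhat xs)
          \<le> \<rho> (prediction_error (set xs) Xhat) * real_of_rat (opt I (set xs)))"

definition encode_rat :: "rat \<Rightarrow> int list" where
  "encode_rat q = [fst (quotient_of q), snd (quotient_of q)]"

definition encode_input :: "fl_instance \<times> nat set \<times> nat list \<Rightarrow> int list" where
  "encode_input = (\<lambda>(I, Xhat, xs). let vs = [0..<num_vertices I] in
     [int (num_vertices I)]
     @ [of_bool ({u, v} \<in> edges I). u \<leftarrow> vs, v \<leftarrow> vs]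
     @ concat [encode_rat (distance I u v). u \<leftarrow> vs, v \<leftarrow> vs]
     @ [of_bool (u \<in> facilities I). u \<leftarrow> vs]
     @ concat [encode_rat (if u \<in> facilities I then opening_cost I u else 0). u \<leftarrow> vs]
     @ [of_bool (u \<in> Xhat). u \<leftarrow> vs]
     @ [int (length xs)] @ map int xs)"

definition encode_decision :: "nat set \<times> nat \<Rightarrow> int list" where
  "encode_decision = (\<lambda>(S, f). int f # map int (sorted_list_of_set S))"

definition polynomial_time :: "online_alg \<Rightarrow> bool" where
  "polynomial_time A \<longleftrightarrow>
     polytime_on {(I, Xhat, xs). legal_input I Xhat xs \<and> xs \<noteq> []}
       encode_input encode_decision (\<lambda>(I, Xhat, xs). A I Xhat xs)"

end

theory Submission
  imports Defs "HOL-Real_Asymp.Real_Asymp"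
begin

text \<open>
  The online algorithm keeps for every served client \<open>u\<close> the price \<open>p u\<close> it had on arrival, the
  cheapest way to connect it, including the opening of at most one facility. A facility \<open>w\<close> at
  distance \<open>D\<close> from the open ones is opened as soon as the unused prices of the clients within
  distance \<open>D / m\<close> of it sum up to its cost, and these prices are then used up. The factor \<open>m\<close>
  grows like the square root of the index of the first threshold above \<open>P / D\<close>, where \<open>P\<close> is the sum
  of all prices so far and the thresholds grow like \<open>sqrt (k!)\<close>. Fix a center \<open>c\<close> of an optimal solution.
  Whenever a client very close to \<open>c\<close> has its price used up, \<open>c\<close> gets an open facility that is
  closer by the factor by which consecutive thresholds differ. So this happens for at most
  \<open>O(log N / log log N)\<close> thresholds, each accounting for the cost of \<open>c\<close>, and all other clients pay
  \<open>O(log N / log log N)\<close> times their optimal distance; here \<open>N\<close> is the size of any set of clients to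
  which we want to apply the argument.

  The prediction enters through the Mettu-Plaxton algorithm on the predicted clients: each facility
  has a radius \<open>r\<close> for which the sum of \<open>r - d\<close> over the predicted clients at distance \<open>d < r\<close> is its
  cost, and centers are chosen greedily by increasing radius. At any time the prefix of this sequence
  of cost at most \<open>P\<close> is open. Once \<open>P\<close> exceeds a constant times the optimum, this prefix
  serves all but \<open>|Xhat - X|\<close> of the clients in \<open>X \<inter> Xhat\<close> at a cost comparable to the optimum.
  The remaining clients number at most \<open>\<eta>\<close>, and they form the set to which the online analysis is
  applied.

  For the running time, programs built from loops bounded by the input and from assignments that
  let values grow by linearly many bits are polynomial by construction.
\<close>

section \<open>Thresholds and multipliers\<close>

text \<open>Neither the optimum nor the error is known online, so the opening rule may use only the
  observable quotient of \<open>P\<close> by \<open>D\<close>, and the analysis has to compare the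
  threshold index seen at an opened facility \<open>w\<close> with the level of the center
  \<open>c\<close>. Two one-sided estimates suffice. The multiplier at \<open>w\<close> is at least
  that of the last threshold passed by \<open>c\<close>, so opening \<open>w\<close> moves
  \<open>c\<close> on; the multiplier at \<open>c\<close> is at most that of index
  \<open>2 * J\<close>, so clients that count as very close to \<open>c\<close> can really pay for
  it. Doubling an index changes a square root only by a constant factor. The square root itself is a
  balance. A client that is not very close loses about the multiplier times the ratio of consecutive
  thresholds, which is the square of that ratio, while every level loses a constant times the cost
  of \<open>c\<close>. Both losses are linear in the number \<open>J\<close> of levels if the ratio
  is of order sqrt J. All data are integers; a bound involving the average \<open>Q / N\<close> is
  stated after multiplication by \<open>N\<close>.\<close>

fun argmin_upto :: "(nat \<Rightarrow> bool) \<Rightarrow> (nat \<Rightarrow> int) \<Rightarrow> nat \<Rightarrow> int" where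
  "argmin_upto g e 0 = -1"
| "argmin_upto g e (Suc k) =
     (let b = argmin_upto g e k in if g k \<and> (b < 0 \<or> e k < e (nat b)) then int k else b)"

lemma argmin_upto_neg_iff: "argmin_upto g e k < 0 \<longleftrightarrow> (\<forall>i<k. \<not> g i)"
  by (induction k) (auto simp: Let_def less_Suc_eq)

lemma argmin_upto_spec:
  assumes "\<exists>i<k. g i"
  shows "0 \<le> argmin_upto g e k" "nat (argmin_upto g e k) < k" "g (nat (argmin_upto g e k))"
    "i < k \<Longrightarrow> g i \<Longrightarrow> e (nat (argmin_upto g e k)) \<le> e i"
proof -
  have "0 \<le> argmin_upto g e k \<longrightarrow> nat (argmin_upto g e k) < k \<and> g (nat (argmin_upto g e k)) \<and>
      (\<forall>i<k. g i \<longrightarrow> e (nat (argmin_upto g e k)) \<le> e i)"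
  proof (induction k)
    case (Suc k)
    then show ?case
      using argmin_upto_neg_iff[of g e k]
      by (auto simp: Let_def less_Suc_eq not_less dest: order_trans[of _ "e (nat (argmin_upto g e k))"] split: if_splits)
  qed simp
  moreover show "0 \<le> argmin_upto g e k" using assms argmin_upto_neg_iff[of g e k] by force
  ultimately show "nat (argmin_upto g e k) < k" "g (nat (argmin_upto g e k))"
    "i < k \<Longrightarrow> g i \<Longrightarrow> e (nat (argmin_upto g e k)) \<le> e i" by auto
qed

text \<open>An integer substitute for sqrt k, never below 2, that a program can tabulate by
  increments and one comparison per entry.\<close>

fun level_ratio :: "nat \<Rightarrow> nat" where
  "level_ratio 0 = 2"
| "level_ratio (Suc k) = (if level_ratio k * level_ratio k \<le> Suc k then Suc (level_ratio k) else level_ratio k)"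

fun level_scale :: "nat \<Rightarrow> nat" where
  "level_scale 0 = 1"
| "level_scale (Suc k) = level_scale k * level_ratio k"

lemma level_ratio_mono: "i \<le> j \<Longrightarrow> level_ratio i \<le> level_ratio j"
  by (rule lift_Suc_mono_le[of level_ratio]) auto

lemma level_ratio_ge_2: "2 \<le> level_ratio k"
  using level_ratio_mono[of 0 k] by simp

lemma level_ratio_le: "level_ratio k \<le> k + 2"
  by (induction k) auto

lemma level_ratio_square_ge: "k \<le> level_ratio k * level_ratio k"
  by (induction k) auto

lemma level_ratio_square_le: "level_ratio k * level_ratio k \<le> 4 * k + 4"
proof (induction k)
  case (Suc k)
  have "Suc (level_ratio k) * Suc (level_ratio k) \<le> 4 * (level_ratio k * level_ratio k)"
    using mult_mono[of "Suc (level_ratio k)" "2 * level_ratio k" "Suc (level_ratio k)" "2 * level_ratio k"] level_ratio_ge_2[of k] by simp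
  then show ?case using Suc by (auto simp: Suc_le_eq)
qed simp

lemma level_scale_ge: "Suc k \<le> level_scale k"
proof (induction k)
  case (Suc k)
  have "level_scale k * 2 \<le> level_scale k * level_ratio k" using level_ratio_ge_2 by (intro mult_le_mono) auto
  then show ?case using Suc unfolding level_scale.simps by linarith
qed simp

lemma level_scale_mono: "i \<le> j \<Longrightarrow> level_scale i \<le> level_scale j"
  by (rule lift_Suc_mono_le[of level_scale]) (use level_ratio_ge_2 in \<open>auto simp: Suc_le_eq intro: less_le_trans[of 0 2]\<close>)

lemma level_scale_pos: "0 < level_scale k"
  using level_scale_ge[of k] by simp

text \<open>Later ratios dominate earlier ones, so \<open>j\<close> further factors amount to at
  least \<open>level_scale j\<close>. This turns the square of a threshold into a doubled
  index.\<close>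

lemma level_scale_double: "level_scale j * level_scale j \<le> level_scale (j + j)"
proof -
  have "level_scale i * level_scale j \<le> level_scale (i + j)" for i
  proof (induction j)
    case (Suc j)
    have "level_scale i * level_scale j * level_ratio j \<le> level_scale (i + j) * level_ratio (i + j)"
      using Suc level_ratio_mono[of j "i + j"] by (simp add: mult_le_mono)
    then show ?case by (simp add: mult.assoc)
  qed simp
  then show ?thesis by blast
qed

text \<open>A search downwards from the cutoff for the largest threshold not above
  \<open>P / D\<close>. The default 5 is \<open>2 * level_ratio 0 + 1\<close>. The form
  \<open>2 * r + 1\<close> is what the triangle inequality needs to bring a facility within
  \<open>D / r\<close> of the center.\<close>

fun multiplier :: "int \<Rightarrow> int \<Rightarrow> nat \<Rightarrow> int" where
  "multiplier P D 0 = 5"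
| "multiplier P D (Suc k) = (if int (level_scale k) * D \<le> P then 2 * int (level_ratio k) + 1 else multiplier P D k)"

lemma multiplier_cases:
  "multiplier P D c = 5 \<or> (\<exists>k<c. int (level_scale k) * D \<le> P \<and> multiplier P D c = 2 * int (level_ratio k) + 1)"
  by (induction c) (auto simp: less_Suc_eq)

lemma multiplier_ge: "k < c \<Longrightarrow> int (level_scale k) * D \<le> P \<Longrightarrow> 2 * int (level_ratio k) + 1 \<le> multiplier P D c"
proof (induction c)
  case (Suc c)
  then show ?case using level_ratio_mono[of k c] by (auto simp: less_Suc_eq)
qed simp

lemma multiplier_ge_5: "5 \<le> multiplier P D c"
  using multiplier_cases[of P D c] level_ratio_ge_2 by force

lemma multiplier_mono:
  assumes "P \<le> P'" "D' \<le> D" shows "multiplier P D c \<le> multiplier P' D' c"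
proof -
  consider "multiplier P D c = 5"
    | k where "k < c" "int (level_scale k) * D \<le> P" "multiplier P D c = 2 * int (level_ratio k) + 1"
    using multiplier_cases by blast
  then show ?thesis
  proof cases
    case 1
    then show ?thesis using multiplier_ge_5 by simp
  next
    case 2
    have "int (level_scale k) * D' \<le> int (level_scale k) * D" using assms by (simp add: mult_left_mono)
    then show ?thesis using 2 assms multiplier_ge[of k c D' P'] by simp
  qed
qed

text \<open>Here \<open>P\<close> is below the square of \<open>level_scale J\<close> times
  \<open>D\<close>, hence below \<open>level_scale (2 * J) * D\<close>, and no larger index passes
  the test.\<close>

lemma multiplier_le:
  assumes "P \<le> int (level_scale J) * Q" "Q < int (level_scale J) * D" "0 \<le> Q"
  shows "multiplier P D c \<le> 2 * int (level_ratio (2 * J)) + 1"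
proof -
  have "k \<le> 2 * J" if "int (level_scale k) * D \<le> P" for k
  proof (rule ccontr)
    assume "\<not> k \<le> 2 * J"
    then have "level_scale J * level_scale J \<le> level_scale k" using level_scale_double[of J] level_scale_mono[of "J + J" k] by simp
    moreover have "0 \<le> D" using assms(2,3) by (metis less_le_not_le linear mult_nonneg_nonpos of_nat_0_le_iff order_trans)
    ultimately have "int (level_scale J * level_scale J) * D \<le> int (level_scale k) * D"
      by (intro mult_right_mono) linarith+
    then have "int (level_scale J) * (int (level_scale J) * D) \<le> int (level_scale k) * D" by (simp add: mult.assoc)
    moreover have "int (level_scale J) * Q < int (level_scale J) * (int (level_scale J) * D)"
      using assms(2) level_scale_pos[of J] by simp
    ultimately show False using that assms(1) by simp
  qed
  then show ?thesis using multiplier_cases[of P D c] level_ratio_mono[of _ "2 * J"] level_ratio_ge_2[of "2*J"] by force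
qed

text \<open>The constant 11 leaves room for the crude bound \<open>P \<le> (e + 10) * V\<close> on the sum of all prices.\<close>

definition depth :: "nat \<Rightarrow> nat" where
  "depth e = Suc (LEAST k. e + 11 \<le> level_scale k)"

lemma depth: "e + 11 \<le> level_scale (depth e - 1)" "0 < depth e" "depth e \<le> e + 11"
proof -
  have *: "e + 11 \<le> level_scale (e + 10)" using level_scale_ge[of "e + 10"] by simp
  show "e + 11 \<le> level_scale (depth e - 1)" unfolding depth_def using LeastI[of "\<lambda>k. e + 11 \<le> level_scale k", OF *] by simp
  show "0 < depth e" by (simp add: depth_def)
  show "depth e \<le> e + 11" unfolding depth_def using Least_le[of "\<lambda>k. e + 11 \<le> level_scale k", OF *] by simp
qed

text \<open>The last \<open>k\<close> of the \<open>2 * k\<close> factors are each at least sqrt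
  k.\<close>

lemma level_scale_lower: "sqrt (real k) ^ k \<le> real (level_scale (2 * k))"
proof -
  have b: "sqrt (real k) \<le> real (level_ratio i)" if "k \<le> i" for i
  proof -
    have "real k \<le> (real (level_ratio i))\<^sup>2"
      using level_ratio_square_ge[of i] that by (simp add: power2_eq_square flip: of_nat_mult)
    then show ?thesis by (simp add: real_le_lsqrt)
  qed
  have "sqrt (real k) ^ i \<le> real (level_scale (k + i))" for i
  proof (induction i)
    case (Suc i)
    have "sqrt (real k) ^ i * sqrt (real k) \<le> real (level_scale (k + i)) * real (level_ratio (k + i))"
      using Suc b by (intro mult_mono) auto
    then show ?case by (simp add: mult.commute)
  next
    case 0
    show ?case using level_scale_ge[of k] by simp
  qed
  from this[of k] show ?thesis by (simp add: mult_2)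
qed

text \<open>With \<open>y = e + 11\<close> and \<open>x = 4 * ln y / ln (ln y)\<close>, the quantity
  \<open>x * ln x / 2\<close> is asymptotically \<open>2 * ln y\<close>, so rounding
  \<open>x\<close> up gives a \<open>k\<close> for which \<open>level_scale_lower\<close> reaches
  \<open>e + 11\<close>.\<close>

lemma depth_asymp: "(\<lambda>e. real (depth e)) \<in> O(\<lambda>e. ln (real e) / ln (ln (real e)))"
proof -
  define k where "k = (\<lambda>e::nat. nat \<lceil>4 * ln (real e + 11) / ln (ln (real e + 11))\<rceil>)"
  have ev: "eventually (\<lambda>e::nat. ln (real e + 11) \<le> (4 * ln (real e + 11) / ln (ln (real e + 11))) *
      ln (4 * ln (real e + 11) / ln (ln (real e + 11))) / 2) at_top"
    by real_asymp
  have ev2: "eventually (\<lambda>e::nat. 4 * ln (real e + 11) / ln (ln (real e + 11)) \<ge> 1) at_top"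
    by real_asymp
  \<comment> \<open>The depth will be at most \<open>2 * x + 3\<close>; any constant above 8 would
    eventually do on the right.\<close>
  have ev3: "eventually (\<lambda>e::nat. 8 * ln (real e + 11) / ln (ln (real e + 11)) + 3 \<le>
     11 * (ln (real e) / ln (ln (real e)))) at_top"
    by real_asymp
  have "eventually (\<lambda>e. real (depth e) \<le> 11 * (ln (real e) / ln (ln (real e)))) at_top"
    using ev ev2 ev3
  proof eventually_elim
    case (elim e)
    let ?x = "4 * ln (real e + 11) / ln (ln (real e + 11))"
    have kx: "?x \<le> real (k e)" "real (k e) \<le> ?x + 1" using elim(2) unfolding k_def by linarith+
    have kpos: "1 \<le> real (k e)" using kx elim by linarith
    have "ln (real e + 11) \<le> ?x * ln ?x / 2" using elim by simp
    also have "?x * ln ?x \<le> real (k e) * ln (real (k e))"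
      using kx elim kpos by (intro mult_mono) auto
    finally have "ln (real e + 11) \<le> real (k e) * ln (sqrt (real (k e)))"
      using kpos by (simp add: ln_sqrt)
    also have "\<dots> = ln (sqrt (real (k e)) ^ k e)"
      using kpos by (simp add: ln_realpow)
    finally have "real e + 11 \<le> sqrt (real (k e)) ^ k e"
      using kpos by (subst (asm) ln_le_cancel_iff) auto
    also have "\<dots> \<le> real (level_scale (2 * k e))" by (rule level_scale_lower)
    finally have "e + 11 \<le> level_scale (2 * k e)" by linarith
    then have "depth e \<le> Suc (2 * k e)" unfolding depth_def by (simp add: Least_le)
    then have "real (depth e) \<le> 2 * real (k e) + 1" by linarith
    also have "\<dots> \<le> 2 * ?x + 3" using kx by linarith
    finally show ?case using elim(3) by simp
  qed
  then have "eventually (\<lambda>e. norm (real (depth e)) \<le> 11 * norm (ln (real e) / ln (ln (real e)))) at_top"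
    proof eventually_elim
    case (elim e)
    then show ?case unfolding real_norm_def using abs_ge_self[of "ln (real e) / ln (ln (real e))"] by linarith
  qed
  then show ?thesis by (rule bigoI)
qed

section \<open>The algorithm and its predicted centers\<close>

text \<open>Free of assumptions, so that \<open>fl_data.decision\<close> is a total function and can
  define an \<open>online_alg\<close> on ill-formed instances as well.\<close>

locale fl_data =
  fixes n :: nat and fac :: "nat set" and d :: "nat \<Rightarrow> nat \<Rightarrow> int" and f :: "nat \<Rightarrow> int"
    and Xh :: "nat set"
begin

text \<open>The radius that would balance \<open>f w\<close> if the predicted clients no farther
  from \<open>w\<close> than \<open>u\<close> were exactly those in the ball. The least candidate is
  the Mettu-Plaxton radius. Under the divisibility assumptions of \<open>fl\<close> the division is
  exact.\<close>

definition quotient :: "nat \<Rightarrow> nat \<Rightarrow> int" where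
  "quotient w u = (f w + (\<Sum>v | v < n \<and> v \<in> Xh \<and> d v w \<le> d u w. d v w)) div
     int (card {v. v < n \<and> v \<in> Xh \<and> d v w \<le> d u w})"

definition radius :: "nat \<Rightarrow> int" where
  "radius w = (let b = argmin_upto (\<lambda>u. u \<in> Xh) (quotient w) n in
     if b < 0 then 0 else quotient w (nat b))"

text \<open>The first component collects the facilities already considered, the second the chosen
  centers.\<close>

fun greedy :: "nat \<Rightarrow> nat set \<times> nat set" where
  "greedy 0 = ({}, {})"
| "greedy (Suc t) = (let (dn, ch) = greedy t; b = argmin_upto (\<lambda>w. w \<in> fac \<and> w \<notin> dn) radius n in
     if b < 0 then (dn, ch)
     else (insert (nat b) dn,
       if \<exists>s<n. s \<in> ch \<and> d s (nat b) \<le> 2 * radius (nat b) then ch else insert (nat b) ch))"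

definition centers :: "nat set" where
  "centers = snd (greedy n)"

text \<open>Centers of equal radius are counted together, so whether a center is affordable depends
  on its radius alone.\<close>

definition cumulative :: "nat \<Rightarrow> int" where
  "cumulative w = (\<Sum>s | s < n \<and> s \<in> centers \<and> radius s \<le> radius w. f s)"

text \<open>For empty \<open>F\<close> the index is \<open>nat (-1) = 0\<close> and the value is
  arbitrary; hence the recurring hypothesis \<open>F \<noteq> {}\<close>.\<close>

definition set_dist :: "nat set \<Rightarrow> nat \<Rightarrow> int" where
  "set_dist F w = d (nat (argmin_upto (\<lambda>x. x \<in> F) (\<lambda>x. d x w) n)) w"

text \<open>The cutoff \<open>n + 12\<close> covers every depth that occurs: the error is at most
  \<open>n\<close>, and \<open>depth e \<le> e + 11\<close>.\<close>

definition near :: "int \<Rightarrow> nat set \<Rightarrow> nat \<Rightarrow> nat set" where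
  "near P F w = {v. v < n \<and> multiplier P (set_dist F w) (n + 12) * d v w \<le> set_dist F w}"

definition visit :: "int \<Rightarrow> nat \<Rightarrow> nat set \<times> (nat \<Rightarrow> int) \<Rightarrow> nat set \<times> (nat \<Rightarrow> int)" where
  "visit P w = (\<lambda>(F, pot).
     if w \<in> fac \<and> w \<notin> F \<and>
       ((w \<in> centers \<and> cumulative w \<le> P) \<or> f w \<le> (\<Sum>v\<in>near P F w. pot v))
     then (insert w F, \<lambda>v. if v \<in> near P F w then 0 else pot v) else (F, pot))"

fun scan :: "int \<Rightarrow> nat \<Rightarrow> nat set \<times> (nat \<Rightarrow> int) \<Rightarrow> nat set \<times> (nat \<Rightarrow> int)" where
  "scan P 0 s = s"
| "scan P (Suc w) s = visit P w (scan P w s)"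

definition price :: "nat set \<Rightarrow> nat \<Rightarrow> nat \<Rightarrow> int" where
  "price F u w = (if w \<in> F then 0 else f w) + d w u"

definition best :: "nat set \<Rightarrow> nat \<Rightarrow> nat" where
  "best F u = nat (argmin_upto (\<lambda>w. w \<in> fac) (price F u) n)"

text \<open>The full price becomes potential even if part of it has just paid for opening
  \<open>w\<close>; this double use is the factor 2 in \<open>good\<close>.\<close>

definition step :: "nat set \<times> (nat \<Rightarrow> int) \<times> int \<Rightarrow> nat \<Rightarrow> nat set \<times> (nat \<Rightarrow> int) \<times> int" where
  "step = (\<lambda>(F, pot, P) u.
     let w = best F u; p = price F u w; (F', pot') = scan (P + p) n (insert w F, pot(u := p))
     in (F', pot', P + p))"

definition final :: "nat list \<Rightarrow> nat set \<times> (nat \<Rightarrow> int) \<times> int" where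
  "final xs = foldl step ({}, \<lambda>_. 0, 0) xs"

text \<open>The run is recomputed from the prefix. The decision lists all facilities open so far,
  whereas the connection is chosen with respect to the set that was open before the arrival.\<close>

definition decision :: "nat list \<Rightarrow> nat set \<times> nat" where
  "decision xs = (fst (final xs), best (fst (final (butlast xs))) (last xs))"

end

text \<open>Nonnegativity and symmetry are required for all arguments because the scaled instances
  have them everywhere. The divisibility assumptions express the factor \<open>n!\<close> of the
  scaling.\<close>

locale fl = fl_data +
  assumes fac: "fac \<subseteq> {..<n}" "fac \<noteq> {}"
    and Xh: "Xh \<subseteq> {..<n}"
    and d_nonneg: "0 \<le> d u v"
    and d_sym: "d u v = d v u"
    and d_zero: "u < n \<Longrightarrow> v < n \<Longrightarrow> d u v = 0 \<longleftrightarrow> u = v"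
    and d_tri: "u < n \<Longrightarrow> v < n \<Longrightarrow> w < n \<Longrightarrow> d u w \<le> d u v + d v w"
    and f_nonneg: "w \<in> fac \<Longrightarrow> 0 \<le> f w"
    and d_dvd: "0 < k \<Longrightarrow> k \<le> n \<Longrightarrow> u < n \<Longrightarrow> v < n \<Longrightarrow> int k dvd d u v"
    and f_dvd: "0 < k \<Longrightarrow> k \<le> n \<Longrightarrow> w \<in> fac \<Longrightarrow> int k dvd f w"
begin

lemma fac_less: "w \<in> fac \<Longrightarrow> w < n"
  using fac by auto

lemma Xh_less: "v \<in> Xh \<Longrightarrow> v < n"
  using Xh by auto

lemma finites [simp]: "finite fac" "finite Xh"
  using fac Xh by (auto intro: finite_subset)

section \<open>Radii and greedy centers of the prediction\<close>

lemma quotient_mult: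
  assumes "w \<in> fac" "u \<in> Xh"
  defines "T \<equiv> {v. v < n \<and> v \<in> Xh \<and> d v w \<le> d u w}"
  shows "quotient w u * int (card T) = f w + (\<Sum>v\<in>T. d v w)" "u \<in> T" "T \<subseteq> Xh"
proof -
  show T: "u \<in> T" "T \<subseteq> Xh" using assms Xh_less by auto
  have "finite T" using T by (auto intro: finite_subset)
  then have c: "0 < card T" using T by (auto simp: card_gt_0_iff)
  have "card T \<le> card {..<n}" using T Xh by (intro card_mono) auto
  then have "card T \<le> n" by simp
  then have "int (card T) dvd f w + (\<Sum>v\<in>T. d v w)"
    using c assms T Xh fac by (intro dvd_add dvd_sum f_dvd d_dvd) (auto dest: fac_less)
  then show "quotient w u * int (card T) = f w + (\<Sum>v\<in>T. d v w)"
    unfolding quotient_def T_def[symmetric] by simp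
qed

text \<open>For a radius \<open>r\<close>, no set of predicted clients has a larger sum of
  \<open>r - d\<close> than the ball of \<open>r\<close>. The set belonging to the minimal candidate
  shows that the ball sum is at least \<open>f w\<close>; minimality, applied to the set that equals
  the ball, shows that it is at most \<open>f w\<close>.\<close>

lemma radius_sum:
  assumes w: "w \<in> fac" and ne: "Xh \<noteq> {}"
  shows "(\<Sum>v\<in>Xh. max 0 (radius w - d v w)) = f w" and "0 \<le> radius w"
proof -
  define b where "b = argmin_upto (\<lambda>u. u \<in> Xh) (quotient w) n"
  have ex: "\<exists>u<n. u \<in> Xh" using ne Xh_less by (meson ex_in_conv)
  note spec = argmin_upto_spec[OF ex, where e = "quotient w", folded b_def]
  have r: "radius w = quotient w (nat b)" using spec(1) by (simp add: radius_def b_def)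
  have mini: "radius w \<le> quotient w u" if "u \<in> Xh" for u
    using spec(4)[of u] that Xh_less r by auto
  define T where "T = (\<lambda>u. {v. v < n \<and> v \<in> Xh \<and> d v w \<le> d u w})"
  have fin: "finite (T u)" for u by (simp add: T_def)
  have eq: "radius w * int (card (T (nat b))) = f w + (\<Sum>v\<in>T (nat b). d v w)"
    using quotient_mult(1)[OF w spec(3)] r by (simp add: T_def)
  have "0 \<le> f w + (\<Sum>v\<in>T (nat b). d v w)" using f_nonneg[OF w] d_nonneg by (simp add: sum_nonneg)
  moreover have "0 < int (card (T (nat b)))"
    using quotient_mult(2)[OF w spec(3)] fin by (auto simp: T_def card_gt_0_iff)
  ultimately show nn: "0 \<le> radius w" unfolding eq[symmetric] by (simp add: zero_le_mult_iff)
  have "f w = (\<Sum>v\<in>T (nat b). radius w - d v w)" using eq by (simp add: sum_subtractf algebra_simps)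
  also have "\<dots> \<le> (\<Sum>v\<in>T (nat b). max 0 (radius w - d v w))" by (intro sum_mono) simp
  also have "\<dots> \<le> (\<Sum>v\<in>Xh. max 0 (radius w - d v w))"
    by (intro sum_mono2) (auto simp: T_def)
  finally have le: "f w \<le> (\<Sum>v\<in>Xh. max 0 (radius w - d v w))" .
  define U where "U = {v\<in>Xh. d v w \<le> radius w}"
  have "(\<Sum>v\<in>Xh. max 0 (radius w - d v w)) = (\<Sum>v\<in>U. max 0 (radius w - d v w))"
    by (rule sum.mono_neutral_right) (auto simp: U_def)
  also have "\<dots> = (\<Sum>v\<in>U. radius w - d v w)" by (rule sum.cong) (auto simp: U_def)
  also have "\<dots> \<le> f w"
  proof (cases "U = {}")
    case True
    then show ?thesis using f_nonneg[OF w] by simp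
  next
    case False
    have "finite U" by (simp add: U_def)
    then have "Max ((\<lambda>v. d v w) ` U) \<in> (\<lambda>v. d v w) ` U" using False by (intro Max_in) auto
    \<comment> \<open>The farthest client in the ball: the set defining its candidate is the whole
      ball.\<close>
    then obtain u where u: "u \<in> U" "d u w = Max ((\<lambda>v. d v w) ` U)" by auto
    then have "d v w \<le> d u w" if "v \<in> U" for v using that \<open>finite U\<close> by simp
    then have "T u = U" using u Xh_less by (auto simp: T_def U_def)
    then have "quotient w u * int (card U) = f w + (\<Sum>v\<in>U. d v w)"
      using quotient_mult(1)[OF w, of u] u by (simp add: T_def U_def)
    moreover have "radius w * int (card U) \<le> quotient w u * int (card U)"
      using mini[of u] u by (intro mult_right_mono) (auto simp: U_def)
    ultimately show ?thesis by (simp add: sum_subtractf algebra_simps)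
  qed
  finally show "(\<Sum>v\<in>Xh. max 0 (radius w - d v w)) = f w" using le by simp
qed

lemma radius_nonneg: "w \<in> fac \<Longrightarrow> 0 \<le> radius w"
proof (cases "Xh = {}")
  case True
  then have "argmin_upto (\<lambda>u. u \<in> Xh) (quotient w) n < 0" using argmin_upto_neg_iff by blast
  then show ?thesis by (simp add: radius_def)
qed (use radius_sum(2) in blast)

text \<open>Radii increase along the sequence. A rejected facility therefore has a conflicting
  center of no larger radius, and an accepted one has the largest radius so far, which yields the
  separation with either of the two radii.\<close>

lemma greedy_invariant:
  assumes "greedy t = (dn, ch)"
  shows "dn \<subseteq> fac" "ch \<subseteq> dn" "card dn \<ge> min t (card fac)"
    "x \<in> dn \<Longrightarrow> y \<in> fac \<Longrightarrow> y \<notin> dn \<Longrightarrow> radius x \<le> radius y"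
    "g \<in> dn \<Longrightarrow> \<exists>s\<in>ch. radius s \<le> radius g \<and> d g s \<le> 2 * radius g"
    "s \<in> ch \<Longrightarrow> s' \<in> ch \<Longrightarrow> s \<noteq> s' \<Longrightarrow> 2 * radius s < d s s'"
proof -
  have "dn \<subseteq> fac \<and> ch \<subseteq> dn \<and> card dn \<ge> min t (card fac) \<and>
    (\<forall>x\<in>dn. \<forall>y\<in>fac. y \<notin> dn \<longrightarrow> radius x \<le> radius y) \<and>
    (\<forall>g\<in>dn. \<exists>s\<in>ch. radius s \<le> radius g \<and> d g s \<le> 2 * radius g) \<and>
    (\<forall>s\<in>ch. \<forall>s'\<in>ch. s \<noteq> s' \<longrightarrow> 2 * radius s < d s s')" (is "?I t dn ch")
    using assms
  proof (induction t arbitrary: dn ch)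
    case (Suc t)
    obtain dn0 ch0 where g0: "greedy t = (dn0, ch0)" by (cases "greedy t")
    note IH = Suc.IH[OF g0]
    define b where "b = argmin_upto (\<lambda>w. w \<in> fac \<and> w \<notin> dn0) radius n"
    show ?case
    proof (cases "b < 0")
      case True
      then have "fac \<subseteq> dn0" using argmin_upto_neg_iff[of "\<lambda>w. w \<in> fac \<and> w \<notin> dn0" radius n] fac_less
        by (auto simp: b_def)
      then have "dn0 = fac" using IH by blast
      moreover have "dn = dn0" "ch = ch0" using Suc.prems g0 True by (auto simp: b_def)
      ultimately show ?thesis using IH by simp
    next
      case False
      then have ex: "\<exists>i<n. i \<in> fac \<and> i \<notin> dn0" using argmin_upto_neg_iff[of "\<lambda>w. w \<in> fac \<and> w \<notin> dn0" radius n] unfolding b_def by blast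
      define w where "w = nat b"
      note spec = argmin_upto_spec[OF ex, where e = radius, folded b_def, folded w_def]
      have mini: "radius w \<le> radius y" if "y \<in> fac" "y \<notin> dn0" for y using spec(4)[of y] that fac_less by simp
      have fin: "finite dn0" using IH by (meson finite_subset finites)
      have "(dn, ch) = (insert w dn0, if \<exists>s<n. s \<in> ch0 \<and> d s w \<le> 2 * radius w then ch0 else insert w ch0)"
        using Suc.prems g0 False unfolding w_def b_def greedy.simps Let_def by simp
      then have dn: "dn = insert w dn0" and ch: "ch = (if \<exists>s<n. s \<in> ch0 \<and> d s w \<le> 2 * radius w then ch0 else insert w ch0)"
        by simp_all
      have w: "w \<in> fac" "w \<notin> dn0" using spec by auto
      have less: "s \<in> ch0 \<Longrightarrow> s < n \<and> s \<in> dn0 \<and> radius s \<le> radius w" for s using IH w fac_less by blast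
      have c: "card dn \<ge> min (Suc t) (card fac)" using IH dn fin w by auto
      have G0: "\<exists>s\<in>ch. radius s \<le> radius w \<and> d w s \<le> 2 * radius w"
      proof (cases "\<exists>s<n. s \<in> ch0 \<and> d s w \<le> 2 * radius w")
        case True
        then obtain s where s: "s \<in> ch0" "d s w \<le> 2 * radius w" by blast
        then show ?thesis using ch less[of s] d_sym[of s w] by (intro bexI[of _ s]) auto
      next
        case False
        then show ?thesis using ch d_zero[of w w] radius_nonneg[OF w(1)] w fac_less by (intro bexI[of _ w]) auto
      qed
      have sub: "ch0 \<subseteq> ch" using ch by auto
      have G1: "\<forall>g\<in>dn. \<exists>s\<in>ch. radius s \<le> radius g \<and> d g s \<le> 2 * radius g"
      proof
        fix g assume "g \<in> dn"
        then consider "g = w" | "g \<in> dn0" using dn by blast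
        then show "\<exists>s\<in>ch. radius s \<le> radius g \<and> d g s \<le> 2 * radius g"
        proof cases
          case 1
          then show ?thesis using G0 by simp
        next
          case 2
          then obtain s where "s \<in> ch0" "radius s \<le> radius g" "d g s \<le> 2 * radius g"
            using IH by blast
          then show ?thesis using sub by blast
        qed
      qed
      have G2: "\<forall>s\<in>ch. \<forall>s'\<in>ch. s \<noteq> s' \<longrightarrow> 2 * radius s < d s s'"
      proof (cases "\<exists>s<n. s \<in> ch0 \<and> d s w \<le> 2 * radius w")
        case True
        then show ?thesis using ch IH by simp
      next
        case False
        have far: "2 * radius w < d s w" "2 * radius s < d s w" if "s \<in> ch0" for s
        proof -
          show "2 * radius w < d s w" using less[OF that] that False by (meson not_le)
          then show "2 * radius s < d s w" using less[OF that] by linarith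
        qed
        have ch': "ch = insert w ch0" using ch False by auto
        show ?thesis
        proof (intro ballI impI)
          fix s s' assume a: "s \<in> ch" "s' \<in> ch" "s \<noteq> s'"
          then consider "s = w" "s' \<in> ch0" | "s \<in> ch0" "s' = w" | "s \<in> ch0" "s' \<in> ch0"
            using ch' by blast
          then show "2 * radius s < d s s'"
          proof cases
            case 1
            then show ?thesis using far[of s'] d_sym[of w s'] by simp
          next
            case 2
            then show ?thesis using far[of s] by simp
          next
            case 3
            then show ?thesis using IH a by blast
          qed
        qed
      qed
      have "\<forall>x\<in>dn. \<forall>y\<in>fac. y \<notin> dn \<longrightarrow> radius x \<le> radius y"
        using dn IH mini by auto
      moreover have "ch \<subseteq> dn" using ch dn IH by auto
      moreover have "dn \<subseteq> fac" using dn w IH by auto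
      ultimately show ?thesis using c G1 G2 by blast
    qed
  qed simp
  then show "dn \<subseteq> fac" "ch \<subseteq> dn" "card dn \<ge> min t (card fac)"
    "x \<in> dn \<Longrightarrow> y \<in> fac \<Longrightarrow> y \<notin> dn \<Longrightarrow> radius x \<le> radius y"
    "g \<in> dn \<Longrightarrow> \<exists>s\<in>ch. radius s \<le> radius g \<and> d g s \<le> 2 * radius g"
    "s \<in> ch \<Longrightarrow> s' \<in> ch \<Longrightarrow> s \<noteq> s' \<Longrightarrow> 2 * radius s < d s s'"
    by blast+
qed

text \<open>Every round handles a new facility as long as one is left, so after \<open>n\<close>
  rounds all of them are handled.\<close>

lemma centers_sub: "centers \<subseteq> fac"
  and centers_near: "g \<in> fac \<Longrightarrow> \<exists>s\<in>centers. radius s \<le> radius g \<and> d g s \<le> 2 * radius g"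
  and centers_far: "s \<in> centers \<Longrightarrow> s' \<in> centers \<Longrightarrow> s \<noteq> s' \<Longrightarrow> 2 * radius s < d s s'"
proof -
  obtain dn ch where g: "greedy n = (dn, ch)" by (cases "greedy n")
  note I = greedy_invariant[OF g]
  have ch: "centers = ch" by (simp add: centers_def g)
  have "card fac \<le> card {..<n}" using fac by (intro card_mono) auto
  then have "card fac \<le> card dn" using I(3) by simp
  then have "dn = fac" using I(1) by (simp add: card_seteq)
  then show "centers \<subseteq> fac" "g \<in> fac \<Longrightarrow> \<exists>s\<in>centers. radius s \<le> radius g \<and> d g s \<le> 2 * radius g"
    "s \<in> centers \<Longrightarrow> s' \<in> centers \<Longrightarrow> s \<noteq> s' \<Longrightarrow> 2 * radius s < d s s'"
    using I ch by auto
qed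

definition affordable :: "int \<Rightarrow> nat set" where
  "affordable P = {s \<in> centers. cumulative s \<le> P}"

text \<open>The value \<open>cumulative\<close> of the affordable center of largest radius counts
  all affordable centers.\<close>

lemma affordable_cost: "0 \<le> P \<Longrightarrow> (\<Sum>s\<in>affordable P. f s) \<le> P"
proof (cases "affordable P = {}")
  case False
  assume "0 \<le> P"
  have fin: "finite (affordable P)" using centers_sub by (auto simp: affordable_def intro: finite_subset[OF _ finites(1)])
  then have "Max (radius ` affordable P) \<in> radius ` affordable P" using False by (intro Max_in) auto
  then obtain s where s: "s \<in> affordable P" "radius s = Max (radius ` affordable P)" by auto
  then have "radius t \<le> radius s" if "t \<in> affordable P" for t using that fin by simp
  then have "(\<Sum>s\<in>affordable P. f s) \<le> cumulative s"
    unfolding cumulative_def using centers_sub fac_less f_nonneg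
    by (intro sum_mono2) (auto simp: affordable_def)
  then show ?thesis using s by (simp add: affordable_def)
qed simp

lemma affordable_mono: "P \<le> P' \<Longrightarrow> affordable P \<subseteq> affordable P'"
  by (auto simp: affordable_def)

text \<open>Let \<open>lam\<close> be the least radius of an unaffordable center. The balls of the centers of radius at
  most \<open>lam\<close> are disjoint, and their costs sum up to more than \<open>P\<close>. The clients in \<open>X\<close> contribute at
  most \<open>3 * V\<close> to this sum and each other one at most \<open>lam\<close>, so \<open>V < lam * card (Xh - X)\<close>. Hence
  fewer than \<open>card (Xh - X)\<close> clients of \<open>X\<close> can account for \<open>lam\<close> or more of the cost \<open>V\<close>; these
  are the exceptions \<open>Out\<close>.\<close>

lemma prediction_covers:
  fixes \<phi> :: "nat \<Rightarrow> nat"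
  assumes X: "finite X" and S: "S \<subseteq> fac" and \<phi>: "\<And>x. x \<in> X \<Longrightarrow> \<phi> x \<in> S" and XV: "X \<subseteq> {..<n}"
    and V: "(\<Sum>s\<in>S. f s) + (\<Sum>x\<in>X. d x (\<phi> x)) \<le> V" and P: "4 * V \<le> P"
  shows "\<exists>Out cost. Out \<subseteq> X \<inter> Xh \<and> card Out \<le> card (Xh - X) \<and>
    (\<forall>v\<in>(X \<inter> Xh) - Out. \<exists>s\<in>affordable P. d s v \<le> cost v) \<and>
    (\<forall>v. 0 \<le> cost v) \<and> (\<Sum>v\<in>X \<inter> Xh. cost v) \<le> 3 * V"
proof (cases "X \<inter> Xh = {}")
  case True
  have "0 \<le> (\<Sum>s\<in>S. f s) + (\<Sum>x\<in>X. d x (\<phi> x))"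
    using S f_nonneg d_nonneg by (intro add_nonneg_nonneg sum_nonneg) auto
  then show ?thesis using True V by (intro exI[of _ "{}"] exI[of _ "\<lambda>_. 0"]) auto
next
  case False
  then have ne: "Xh \<noteq> {}" by blast
  have finS: "finite S" using S finites by (metis finite_subset)
  define Y where "Y = X \<inter> Xh"
  \<comment> \<open>Since \<open>max r d = d + max 0 (r - d)\<close>, these values split into
    connection costs and ball contributions, and by \<open>radius_sum\<close> the contributions
    within one cluster of the reference solution add up to at most its opening cost.\<close>
  define al where "al = (\<lambda>v. if v \<in> Y then max (radius (\<phi> v)) (d v (\<phi> v)) else 0)"
  have finY: "finite Y" by (simp add: Y_def)
  have al0: "0 \<le> al v" for v using d_nonneg[of v "\<phi> v"] by (auto simp: al_def)
  have al_sum: "(\<Sum>v\<in>Y. al v) \<le> V"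
  proof -
    have "(\<Sum>v\<in>Y. al v) = (\<Sum>v\<in>Y. d v (\<phi> v)) + (\<Sum>v\<in>Y. max 0 (radius (\<phi> v) - d v (\<phi> v)))"
      unfolding sum.distrib[symmetric] by (rule sum.cong) (auto simp: al_def)
    also have "(\<Sum>v\<in>Y. max 0 (radius (\<phi> v) - d v (\<phi> v))) =
        (\<Sum>s\<in>S. \<Sum>v\<in>{v\<in>Y. \<phi> v = s}. max 0 (radius (\<phi> v) - d v (\<phi> v)))"
      using finY finS \<phi> by (subst sum.group) (auto simp: Y_def)
    also have "\<dots> \<le> (\<Sum>s\<in>S. f s)"
    proof (rule sum_mono)
      fix s assume "s \<in> S"
      then have "s \<in> fac" using S by blast
      have "(\<Sum>v\<in>{v\<in>Y. \<phi> v = s}. max 0 (radius (\<phi> v) - d v (\<phi> v))) =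
          (\<Sum>v\<in>{v\<in>Y. \<phi> v = s}. max 0 (radius s - d v s))" by (rule sum.cong) auto
      also have "\<dots> \<le> (\<Sum>v\<in>Xh. max 0 (radius s - d v s))"
        by (intro sum_mono2) (auto simp: Y_def)
      finally show "(\<Sum>v\<in>{v\<in>Y. \<phi> v = s}. max 0 (radius (\<phi> v) - d v (\<phi> v))) \<le> f s"
        using radius_sum(1)[OF \<open>s \<in> fac\<close> ne] by simp
    qed
    also have "(\<Sum>v\<in>Y. d v (\<phi> v)) \<le> (\<Sum>v\<in>X. d v (\<phi> v))"
      using X d_nonneg by (intro sum_mono2) (auto simp: Y_def)
    finally show ?thesis using V by simp
  qed
  have cover: "\<exists>s\<in>centers. radius s \<le> al v \<and> d s v \<le> 3 * al v \<and> radius s \<le> radius (\<phi> v)" if "v \<in> Y" for v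
  proof -
    have g: "\<phi> v \<in> fac" "v < n" using that \<phi> S XV by (auto simp: Y_def)
    obtain s where s: "s \<in> centers" "radius s \<le> radius (\<phi> v)" "d (\<phi> v) s \<le> 2 * radius (\<phi> v)"
      using centers_near[OF g(1)] by blast
    have "d s v \<le> d s (\<phi> v) + d (\<phi> v) v"
      using s centers_sub g fac_less by (intro d_tri) auto
    then show ?thesis using s that d_sym[of s "\<phi> v"] d_sym[of v "\<phi> v"]
      by (intro bexI[of _ s]) (auto simp: al_def)
  qed
  \<comment> \<open>A center whose ball contains \<open>v\<close> either is the center covering
    \<open>v\<close> or is separated from it by more than twice its own radius.\<close>
  have ball: "radius s \<le> 3 * al v" if "v \<in> Y" "s \<in> centers" "d v s < radius s" for v s
  proof -
    have g: "\<phi> v \<in> fac" "v < n" using that \<phi> S XV by (auto simp: Y_def)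
    note vY = that(1)
    obtain t where t: "t \<in> centers" "radius t \<le> radius (\<phi> v)" "d t v \<le> 3 * al v" "radius t \<le> al v"
      using cover[OF vY] by blast
    show ?thesis
    proof (cases "s = t")
      case True
      then show ?thesis using t al0[of v] by simp
    next
      case False
      have "2 * radius s < d s t" using centers_far[OF that(2) t(1) False] .
      also have "d s t \<le> d s v + d v t"
        using that t centers_sub g fac_less by (intro d_tri) auto
      finally show ?thesis using that t d_sym[of s v] d_sym[of v t] by simp
    qed
  qed
  show ?thesis
  proof (cases "centers \<subseteq> affordable P")
    case True
    have "(\<Sum>v\<in>Y. 3 * al v) \<le> 3 * V" using al_sum by (simp flip: sum_distrib_left)
    then show ?thesis using cover True al0
      by (intro exI[of _ "{}"] exI[of _ "\<lambda>v. 3 * al v"]) (fastforce simp: Y_def)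
  next
    case False
    define B where "B = centers - affordable P"
    have finc: "finite centers" using centers_sub finites by (metis finite_subset)
    then have "Min (radius ` B) \<in> radius ` B" using False by (intro Min_in) (auto simp: B_def)
    then obtain s0 where s0: "s0 \<in> B" "radius s0 = Min (radius ` B)" by auto
    define lam where "lam = radius s0"
    have lam: "s \<in> affordable P" if "s \<in> centers" "radius s < lam" for s
    proof (rule ccontr)
      assume "s \<notin> affordable P"
      then have "lam \<le> radius s" using that finc by (simp add: B_def lam_def s0(2))
      then show False using that by simp
    qed
    define Z where "Z = {s. s < n \<and> s \<in> centers \<and> radius s \<le> lam}"
    have "P < cumulative s0" using s0 by (auto simp: B_def affordable_def)
    also have "cumulative s0 = (\<Sum>s\<in>Z. f s)" by (simp add: cumulative_def Z_def lam_def)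
    also have "\<dots> = (\<Sum>s\<in>Z. \<Sum>v\<in>Xh. max 0 (radius s - d v s))"
      using radius_sum(1) ne centers_sub by (intro sum.cong) (auto simp: Z_def)
    also have "\<dots> = (\<Sum>v\<in>Xh. \<Sum>s\<in>Z. max 0 (radius s - d v s))" by (rule sum.swap)
    also have "\<dots> \<le> (\<Sum>v\<in>Xh. if v \<in> X then 3 * al v else lam)"
    proof (rule sum_mono)
      fix v assume v: "v \<in> Xh"
      have lam0: "0 \<le> lam" unfolding lam_def using s0 centers_sub by (intro radius_nonneg) (auto simp: B_def)
      show "(\<Sum>s\<in>Z. max 0 (radius s - d v s)) \<le> (if v \<in> X then 3 * al v else lam)"
      proof (cases "\<exists>s\<in>Z. d v s < radius s")
        case True
        then obtain s where s: "s \<in> Z" "d v s < radius s" by blast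
        \<comment> \<open>Two balls around centers that both contain \<open>v\<close> would
          contradict the separation by twice either radius.\<close>
        have uniq: "t = s" if "t \<in> Z" "d v t < radius t" for t
        proof (rule ccontr)
          assume "t \<noteq> s"
          then have "2 * radius s < d s t" "2 * radius t < d t s" using that s centers_far by (auto simp: Z_def)
          moreover have "d s t \<le> d s v + d v t"
            using that s v Xh_less by (intro d_tri) (auto simp: Z_def)
          ultimately show False using that s d_sym[of s v] d_sym[of s t] by simp
        qed
        have "(\<Sum>t\<in>Z. max 0 (radius t - d v t)) = (\<Sum>t\<in>{s}. max 0 (radius t - d v t))"
        proof (rule sum.mono_neutral_right)
          show "finite Z" by (simp add: Z_def)
          show "{s} \<subseteq> Z" using s by simp
          show "\<forall>t\<in>Z - {s}. max 0 (radius t - d v t) = 0"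
          proof
            fix t assume "t \<in> Z - {s}"
            then have "\<not> d v t < radius t" using uniq by blast
            then show "max 0 (radius t - d v t) = 0" by simp
          qed
        qed
        then have "(\<Sum>t\<in>Z. max 0 (radius t - d v t)) \<le> radius s" using s d_nonneg[of v s] by simp
        moreover have "radius s \<le> lam" using s by (simp add: Z_def)
        moreover have "radius s \<le> 3 * al v" if "v \<in> X" using that v s ball by (auto simp: Y_def Z_def)
        ultimately show ?thesis by auto
      next
        case False
        then have "(\<Sum>s\<in>Z. max 0 (radius s - d v s)) = 0" by (intro sum.neutral) force
        then show ?thesis using lam0 al0[of v] by simp
      qed
    qed
    also have "\<dots> = (\<Sum>v\<in>Y. 3 * al v) + (\<Sum>v\<in>Xh - X. lam)"
      by (subst sum.If_cases) (auto simp: Y_def Int_def Diff_eq conj_commute intro: arg_cong2[where f = "(+)"])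
    also have "\<dots> \<le> 3 * V + int (card (Xh - X)) * lam" using al_sum by (simp flip: sum_distrib_left)
    finally have big: "V < int (card (Xh - X)) * lam" using P by simp
    define Out where "Out = {v\<in>Y. lam \<le> al v}"
    have "int (card Out) * lam = (\<Sum>v\<in>Out. lam)" by simp
    also have "\<dots> \<le> (\<Sum>v\<in>Out. al v)" by (intro sum_mono) (auto simp: Out_def)
    also have "\<dots> \<le> (\<Sum>v\<in>Y. al v)" using finY al0 by (intro sum_mono2) (auto simp: Out_def)
    finally have "int (card Out) * lam < int (card (Xh - X)) * lam" using al_sum big by simp
    moreover have "0 \<le> lam" unfolding lam_def using s0 centers_sub by (intro radius_nonneg) (auto simp: B_def)
    ultimately have "card Out \<le> card (Xh - X)" by (simp add: mult_less_cancel_right)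
    moreover have "\<exists>s\<in>affordable P. d s v \<le> 3 * al v" if "v \<in> Y - Out" for v
    proof -
      have "v \<in> Y" "al v < lam" using that by (auto simp: Out_def)
      then show ?thesis using cover[of v] lam by force
    qed
    moreover have "(\<Sum>v\<in>Y. 3 * al v) \<le> 3 * V" using al_sum by (simp flip: sum_distrib_left)
    ultimately show ?thesis using al0
      by (intro exI[of _ Out] exI[of _ "\<lambda>v. 3 * al v"]) (auto simp: Y_def Out_def)
  qed
qed

end

section \<open>Competitive analysis\<close>

context fl
begin

lemma set_dist_attained:
  assumes "F \<subseteq> fac" "F \<noteq> {}"
  shows "\<exists>x\<in>F. set_dist F w = d x w"
proof -
  have "\<exists>i<n. i \<in> F" using assms fac_less by blast
  from argmin_upto_spec(3)[OF this, where e = "\<lambda>x. d x w"] show ?thesis by (auto simp: set_dist_def)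
qed

lemma set_dist_le:
  assumes "F \<subseteq> fac" "x \<in> F"
  shows "set_dist F w \<le> d x w"
proof -
  have "x < n" using assms fac_less by blast
  then have ex: "\<exists>i<n. i \<in> F" using assms by blast
  show ?thesis
    using argmin_upto_spec(4)[OF ex \<open>x < n\<close> \<open>x \<in> F\<close>, where e = "\<lambda>x. d x w"] by (simp add: set_dist_def)
qed

lemma set_dist_nonneg: "0 \<le> set_dist F w"
  by (simp add: set_dist_def d_nonneg)

lemma set_dist_antimono: "F \<subseteq> F' \<Longrightarrow> F' \<subseteq> fac \<Longrightarrow> F \<noteq> {} \<Longrightarrow> set_dist F' w \<le> set_dist F w"
  using set_dist_attained[of F w] set_dist_le[of F' _ w] by (metis order_trans subset_iff)

lemma set_dist_mem: "F \<subseteq> fac \<Longrightarrow> w \<in> F \<Longrightarrow> set_dist F w = 0"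
  using set_dist_le[of F w w] set_dist_nonneg[of F w] d_zero[of w w] fac_less by fastforce

lemma near_finite [simp]: "finite (near P F w)"
  by (simp add: near_def)

text \<open>More open facilities mean a smaller distance to \<open>w\<close>; that and a larger
  \<open>P\<close> raise the multiplier, so both sides of the test get stricter.\<close>

lemma near_antimono:
  assumes "P \<le> P'" "F \<subseteq> F'" "F' \<subseteq> fac" "F \<noteq> {}"
  shows "near P' F' w \<subseteq> near P F w"
proof
  fix v assume v: "v \<in> near P' F' w"
  note D = set_dist_antimono[OF assms(2-4), of w]
  have "multiplier P (set_dist F w) (n + 12) * d v w \<le> multiplier P' (set_dist F' w) (n + 12) * d v w"
    using multiplier_mono[OF assms(1) D] d_nonneg by (intro mult_right_mono) auto
  then show "v \<in> near P F w" using v D by (auto simp: near_def)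
qed

lemma best_fac: "best F u \<in> fac"
  and best_le: "w \<in> fac \<Longrightarrow> price F u (best F u) \<le> price F u w"
proof -
  have ex: "\<exists>i<n. i \<in> fac" using fac fac_less by (metis ex_in_conv)
  show "best F u \<in> fac" using argmin_upto_spec(3)[OF ex, where e = "price F u"] by (simp add: best_def)
  assume "w \<in> fac"
  then show "price F u (best F u) \<le> price F u w"
    using argmin_upto_spec(4)[OF ex _ \<open>w \<in> fac\<close>, where e = "price F u"] fac_less by (simp add: best_def)
qed

lemma price_nonneg: "w \<in> fac \<Longrightarrow> 0 \<le> price F u w"
  using f_nonneg d_nonneg by (simp add: price_def)

lemma visit_cases:
  obtains "visit P w (F, pot) = (F, pot)"
      "w \<in> fac \<Longrightarrow> w \<notin> F \<Longrightarrow> w \<notin> affordable P \<and> (\<Sum>v\<in>near P F w. pot v) < f w"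
  | "visit P w (F, pot) = (insert w F, \<lambda>v. if v \<in> near P F w then 0 else pot v)"
      "w \<in> fac" "w \<notin> F" "w \<in> affordable P \<or> f w \<le> (\<Sum>v\<in>near P F w. pot v)"
  by (cases "w \<in> fac \<and> w \<notin> F \<and> (w \<in> affordable P \<or> f w \<le> (\<Sum>v\<in>near P F w. pot v))")
    (auto simp: visit_def affordable_def)

text \<open>One pass is enough: later openings only shrink the neighborhoods and the potentials of
  facilities already rejected. An opened facility that is not affordable is paid by the potential
  deleted with it.\<close>

lemma scan_invariant:
  assumes "F \<subseteq> fac" "F \<noteq> {}" "\<And>v. 0 \<le> pot v" "scan P k (F, pot) = (F', pot')"
  shows "F \<subseteq> F'" "F' \<subseteq> fac" "pot' v = pot v \<or> pot' v = 0" "0 \<le> pot' v"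
    "w < k \<Longrightarrow> w \<in> fac \<Longrightarrow> w \<notin> F' \<Longrightarrow> w \<notin> affordable P \<and> (\<Sum>v\<in>near P F' w. pot' v) < f w"
    "(\<Sum>w\<in>F' - affordable P. f w) + (\<Sum>v<n. pot' v) \<le> (\<Sum>w\<in>F - affordable P. f w) + (\<Sum>v<n. pot v)"
proof -
  have "F \<subseteq> F' \<and> F' \<subseteq> fac \<and> (\<forall>v. (pot' v = pot v \<or> pot' v = 0) \<and> 0 \<le> pot' v) \<and>
    (\<forall>w<k. w \<in> fac \<longrightarrow> w \<notin> F' \<longrightarrow> w \<notin> affordable P \<and> (\<Sum>v\<in>near P F' w. pot' v) < f w) \<and>
    (\<Sum>w\<in>F' - affordable P. f w) + (\<Sum>v<n. pot' v) \<le> (\<Sum>w\<in>F - affordable P. f w) + (\<Sum>v<n. pot v)"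
    using assms(4)
  proof (induction k arbitrary: F' pot')
    case 0
    then show ?case using assms by auto
  next
    case (Suc k)
    obtain F1 pot1 where s1: "scan P k (F, pot) = (F1, pot1)" by (cases "scan P k (F, pot)")
    note IH = Suc.IH[OF s1]
    have ne: "F1 \<noteq> {}" "finite F1" using IH assms by (auto intro: finite_subset[OF _ finites(1)])
    have visit: "visit P k (F1, pot1) = (F', pot')" using Suc.prems s1 by simp
    show ?case
    proof (cases rule: visit_cases[of P k F1 pot1])
      case 1
      then have "F' = F1" "pot' = pot1" using visit by auto
      then show ?thesis using IH 1(2) by (auto simp: less_Suc_eq)
    next
      case 2
      then have F': "F' = insert k F1" and pot': "pot' = (\<lambda>v. if v \<in> near P F1 k then 0 else pot1 v)"
        using visit by auto
      have le: "pot' v \<le> pot1 v" "0 \<le> pot' v" for v using IH by (auto simp: pot')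
      have sub: "F1 \<subseteq> F'" "F' \<subseteq> fac" using IH 2 F' by auto
      have "(\<Sum>v\<in>near P F' w. pot' v) < f w" if "w < k" "w \<in> fac" "w \<notin> F'" for w
      proof -
        have "(\<Sum>v\<in>near P F' w. pot' v) \<le> (\<Sum>v\<in>near P F' w. pot1 v)" using le by (intro sum_mono)
        also have "\<dots> \<le> (\<Sum>v\<in>near P F1 w. pot1 v)"
          using near_antimono[OF order_refl sub ne(1)] IH by (intro sum_mono2) auto
        also have "\<dots> < f w" using IH that sub by blast
        finally show ?thesis .
      qed
      moreover have "(\<Sum>w\<in>F' - affordable P. f w) + (\<Sum>v<n. pot' v)
          \<le> (\<Sum>w\<in>F1 - affordable P. f w) + (\<Sum>v<n. pot1 v)"
      proof -
        have split: "(\<Sum>v<n. g v) = (\<Sum>v\<in>near P F1 k. g v) + (\<Sum>v\<in>{..<n} - near P F1 k. g v)" for g :: "nat \<Rightarrow> int"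
          by (subst add.commute, rule sum.subset_diff) (auto simp: near_def)
        have "(\<Sum>v<n. pot' v) = (\<Sum>v\<in>{..<n} - near P F1 k. pot1 v)"
          unfolding split[of pot'] by (simp add: pot')
        then have pots: "(\<Sum>v<n. pot1 v) = (\<Sum>v<n. pot' v) + (\<Sum>v\<in>near P F1 k. pot1 v)"
          using split[of pot1] by simp
        have "(\<Sum>w\<in>F' - affordable P. f w) \<le> (\<Sum>w\<in>F1 - affordable P. f w) + (\<Sum>v\<in>near P F1 k. pot1 v)"
        proof (cases "k \<in> affordable P")
          case True
          then have "F' - affordable P = F1 - affordable P" using F' by auto
          then show ?thesis using IH by (simp add: sum_nonneg)
        next
          case False
          then have "F' - affordable P = insert k (F1 - affordable P)" using F' by auto
          then show ?thesis using 2 False ne by simp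
        qed
        then show ?thesis using pots by simp
      qed
      moreover have "F \<subseteq> F'" using IH sub by blast
      moreover have "\<forall>v. (pot' v = pot v \<or> pot' v = 0) \<and> 0 \<le> pot' v" using IH by (auto simp: pot')
      ultimately show ?thesis using IH sub F' by (auto simp: less_Suc_eq)
    qed
  qed
  then show "F \<subseteq> F'" "F' \<subseteq> fac" "pot' v = pot v \<or> pot' v = 0" "0 \<le> pot' v"
    "w < k \<Longrightarrow> w \<in> fac \<Longrightarrow> w \<notin> F' \<Longrightarrow> w \<notin> affordable P \<and> (\<Sum>v\<in>near P F' w. pot' v) < f w"
    "(\<Sum>w\<in>F' - affordable P. f w) + (\<Sum>v<n. pot' v) \<le> (\<Sum>w\<in>F - affordable P. f w) + (\<Sum>v<n. pot v)"
    by blast+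
qed

text \<open>In the last clause every price counts twice: once for the facility opened directly on
  arrival and once as potential, to be spent by the scan. The clause on affordable and rejected
  facilities is conditional because nothing is open before the first arrival.\<close>

definition good :: "nat set \<Rightarrow> (nat \<Rightarrow> int) \<Rightarrow> int \<Rightarrow> bool" where
  "good F pot P \<longleftrightarrow> F \<subseteq> fac \<and> (\<forall>v. 0 \<le> pot v) \<and> 0 \<le> P \<and>
     (\<forall>v c. pot v \<noteq> 0 \<longrightarrow> c \<in> fac \<longrightarrow> (\<exists>x\<in>F. d x v \<le> f c + d c v)) \<and>
     (F \<noteq> {} \<longrightarrow> affordable P \<subseteq> F \<and> (\<forall>c\<in>fac - F. (\<Sum>v\<in>near P F c. pot v) < f c)) \<and>
     (\<Sum>w\<in>F - affordable P. f w) + (\<Sum>v<n. pot v) \<le> 2 * P"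

lemma good_initial: "good {} (\<lambda>_. 0) 0"
  by (simp add: good_def)

lemma step_good:
  assumes g: "good F pot P" and u: "u < n" and st: "step (F, pot, P) u = (F', pot', P')"
  shows "good F' pot' P'" "F \<subseteq> F'" "F' \<noteq> {}" "P' = P + price F u (best F u)" "best F u \<in> F'"
    "scan P' n (insert (best F u) F, pot(u := price F u (best F u))) = (F', pot')"
    "c \<in> fac \<Longrightarrow> \<exists>x\<in>insert (best F u) F. d x u \<le> f c + d c u"
proof -
  define w where "w = best F u"
  define p where "p = price F u w"
  show P': "P' = P + price F u (best F u)"
    and scan: "scan P' n (insert (best F u) F, pot(u := price F u (best F u))) = (F', pot')"
    using st by (auto simp: step_def Let_def split: prod.splits)
  have w: "w \<in> fac" using best_fac by (simp add: w_def)
  have p0: "0 \<le> p" using price_nonneg[OF w] by (simp add: p_def)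
  have sub: "insert w F \<subseteq> fac" "insert w F \<noteq> {}" using w g by (auto simp: good_def)
  have nonneg: "0 \<le> (pot(u := p)) v" for v using g p0 by (simp add: good_def)
  note S = scan_invariant[OF sub nonneg scan[folded w_def, folded p_def]]
  show "F \<subseteq> F'" "F' \<noteq> {}" "best F u \<in> F'" using S(1) by (auto simp: w_def)
  show near_u: "\<exists>x\<in>insert (best F u) F. d x u \<le> f c + d c u" if c: "c \<in> fac" for c
  proof -
    have "d w u \<le> p" using f_nonneg w by (simp add: p_def price_def)
    also have "p \<le> price F u c" using best_le[OF c] by (simp add: p_def w_def)
    also have "\<dots> \<le> f c + d c u" using f_nonneg c by (simp add: price_def)
    finally show ?thesis by (auto simp: w_def)
  qed
  have fin: "finite F" "finite F'" using sub S by (auto intro: finite_subset[OF _ finites(1)])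
  have PP: "P \<le> P'" using P' p0 by (simp add: p_def w_def)
  have "(\<Sum>w\<in>insert w F - affordable P'. f w) \<le> (\<Sum>w\<in>F - affordable P. f w) + p"
  proof -
    have fp: "f w \<le> p" if "w \<notin> F" using that d_nonneg by (simp add: p_def price_def)
    have "(\<Sum>w\<in>insert w F - affordable P'. f w) \<le> (\<Sum>w\<in>insert w F - affordable P. f w)"
      using affordable_mono[OF PP] sub f_nonneg fin by (intro sum_mono2) auto
    also have "\<dots> \<le> (\<Sum>w\<in>F - affordable P. f w) + p"
    proof (cases "w \<in> F \<or> w \<in> affordable P")
      case True
      then have "insert w F - affordable P = F - affordable P" by auto
      then show ?thesis using p0 by simp
    next
      case False
      then have "insert w F - affordable P = insert w (F - affordable P)" by auto
      then show ?thesis using fp False fin by simp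
    qed
    finally show ?thesis .
  qed
  moreover have "(\<Sum>v<n. (pot(u := p)) v) \<le> (\<Sum>v<n. pot v) + p"
  proof -
    have "(\<Sum>v<n. (pot(u := p)) v) \<le> (\<Sum>v<n. pot v + (if v = u then p else 0))"
      using g by (intro sum_mono) (auto simp: good_def)
    also have "\<dots> = (\<Sum>v<n. pot v) + p" using u by (simp add: sum.distrib)
    finally show ?thesis .
  qed
  ultimately have "(\<Sum>w\<in>F' - affordable P'. f w) + (\<Sum>v<n. pot' v) \<le> 2 * P'"
    using S(6) g P' by (simp add: good_def p_def w_def)
  moreover have "\<exists>x\<in>F'. d x v \<le> f c + d c v" if "pot' v \<noteq> 0" "c \<in> fac" for v c
  proof (cases "v = u")
    case True
    then show ?thesis using near_u[OF that(2)] S(1) by (auto simp: w_def)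
  next
    case False
    then have "pot v \<noteq> 0" using that S(3)[of v] by auto
    then have "\<exists>x\<in>F. d x v \<le> f c + d c v" using g that(2) unfolding good_def by blast
    then show ?thesis using S(1) by blast
  qed
  moreover have "affordable P' \<subseteq> F'" using S(5) fac_less centers_sub by (auto simp: affordable_def)
  ultimately show "good F' pot' P'"
    unfolding good_def using S(2,4,5) fac_less PP g by (auto simp: good_def)
qed

end

text \<open>The cluster of a center \<open>c\<close> of the reference solution, seen at the scales \<open>Q / level_scale j\<close>.\<close>

locale cluster = fl +
  fixes c :: nat and Q :: int and J :: nat
  assumes c: "c \<in> fac" and Q: "0 < Q" and J: "0 < J" "J \<le> n + 12"
begin

text \<open>A count, so that the value is \<open>J\<close> when all thresholds are passed. As the
  thresholds increase, the counted indices form an initial segment and the level is the first index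
  that fails.\<close>

definition level :: "nat set \<Rightarrow> nat" where
  "level F = card {j. j < J \<and> int (level_scale j) * set_dist F c \<le> Q}"

text \<open>An upper bound for the multiplier at \<open>c\<close> as long as its level is below
  \<open>J\<close> and \<open>P \<le> level_scale J * Q\<close>.\<close>

definition mx :: int where
  "mx = 2 * int (level_ratio (2 * J)) + 1"

definition live :: "nat set \<Rightarrow> nat set \<Rightarrow> nat set" where
  "live F C = {v \<in> C. level F < J \<and> mx * int (level_scale (level F)) * d v c \<le> Q}"

text \<open>Of the \<open>2 * f c\<close> per level, one copy replaces the live potential that may
  be lost when the level rises, and the other pays the arriving client up to its distance to
  \<open>c\<close>.\<close>

definition potential :: "nat set \<Rightarrow> (nat \<Rightarrow> int) \<Rightarrow> nat set \<Rightarrow> int" where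
  "potential F pot C = 2 * f c * int (level F) + (\<Sum>v\<in>live F C. pot v)"

lemma level_le: "level F \<le> J"
  using card_mono[of "{..<J}" "{j. j < J \<and> int (level_scale j) * set_dist F c \<le> Q}"] by (auto simp: level_def)

lemma level_iff:
  assumes "j < J"
  shows "j < level F \<longleftrightarrow> int (level_scale j) * set_dist F c \<le> Q"
proof -
  define A where "A = {j. j < J \<and> int (level_scale j) * set_dist F c \<le> Q}"
  have down: "i \<in> A" if "j \<in> A" "i \<le> j" for i j
  proof -
    have "int (level_scale i) * set_dist F c \<le> int (level_scale j) * set_dist F c"
      using level_scale_mono[OF that(2)] set_dist_nonneg by (intro mult_right_mono) auto
    then show ?thesis using that by (auto simp: A_def)
  qed
  have fin: "finite A" by (simp add: A_def)
  have "j < card A \<longleftrightarrow> j \<in> A"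
  proof
    assume "j \<in> A"
    then have "{..j} \<subseteq> A" using down by auto
    then have "card {..j} \<le> card A" using fin by (intro card_mono)
    then show "j < card A" by simp
  next
    assume *: "j < card A"
    show "j \<in> A"
    proof (rule ccontr)
      assume "j \<notin> A"
      then have "A \<subseteq> {..<j}" using down by (meson lessThan_iff not_le subsetI)
      then have "card A \<le> j" using card_mono[of "{..<j}" A] by simp
      then show False using * by simp
    qed
  qed
  then show ?thesis using assms by (auto simp: A_def level_def)
qed

lemma level_mono:
  assumes "F \<subseteq> F'" "F' \<subseteq> fac" "F \<noteq> {}"
  shows "level F \<le> level F'"
proof -
  have "int (level_scale j) * set_dist F' c \<le> int (level_scale j) * set_dist F c" for j
    using set_dist_antimono[OF assms] by (simp add: mult_left_mono)
  then show ?thesis unfolding level_def by (intro card_mono) (auto intro: order_trans)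
qed

lemma mx_ge_5: "5 \<le> mx"
  using level_ratio_ge_2[of "2 * J"] by (simp add: mx_def)

text \<open>A facility that consumes the potential of a live client lies so close to \<open>c\<close> that opening it
  makes \<open>c\<close> advance to the next level.\<close>

lemma level_increases:
  assumes F: "F \<subseteq> fac" "F \<noteq> {}" and w: "w \<in> fac" and v: "v \<in> near P F w"
    and close: "\<exists>x\<in>F. d x v \<le> f c + d c v" "f c + 2 * d c v \<le> Q" and P: "2 * Q \<le> P"
    and lev: "level F < J" and live: "mx * int (level_scale (level F)) * d v c \<le> Q"
  shows "level F < level (insert w F)"
proof -
  define j where "j = level F"
  define D where "D = set_dist F c"
  define Dw where "Dw = set_dist F w"
  define m where "m = multiplier P Dw (n + 12)"
  have vn: "v < n" and mv: "m * d v w \<le> Dw" using v by (auto simp: near_def m_def Dw_def)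
  have cn: "c < n" and wn: "w < n" using c w fac_less by auto
  have D0: "0 \<le> D" by (simp add: D_def set_dist_nonneg)
  have jJ: "j < J" using lev by (simp add: j_def)
  have Dj: "Q < int (level_scale j) * D" using level_iff[OF lev, of F] by (simp add: D_def j_def)
  \<comment> \<open>As \<open>level_scale 0 = 1\<close>, this excludes level 0, so there is a last
    threshold \<open>i\<close> that has been passed.\<close>
  have DQ: "D \<le> Q"
  proof -
    obtain x where x: "x \<in> F" "d x v \<le> f c + d c v" using close by blast
    have "D \<le> d x c" using set_dist_le[OF F(1) x(1)] by (simp add: D_def)
    also have "d x c \<le> d x v + d v c" using x F fac_less vn cn by (intro d_tri) auto
    finally show ?thesis using x(2) close(2) d_sym[of v c] by simp
  qed
  have "j \<noteq> 0" using Dj DQ by (auto intro: Nat.gr0I)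
  then obtain i where i: "j = Suc i" by (cases j) auto
  have iD: "int (level_scale i) * D \<le> Q" using level_iff[of i F] jJ i by (simp add: D_def j_def)
  have mxv: "mx * d v c < D"
  proof -
    have "int (level_scale j) * (mx * d v c) < int (level_scale j) * D" using live Dj by (simp add: j_def ac_simps)
    then show ?thesis using level_scale_pos[of j] by simp
  qed
  have v5: "5 * d v c \<le> D" using mxv mult_right_mono[OF mx_ge_5 d_nonneg[of v c]] by simp
  have Dw_le: "Dw \<le> D + d v c + d v w"
  proof -
    obtain x where x: "x \<in> F" "D = d x c" using set_dist_attained[OF F] by (auto simp: D_def)
    have "Dw \<le> d x w" using set_dist_le[OF F(1) x(1)] by (simp add: Dw_def)
    also have "d x w \<le> d x c + d c w" using x F fac_less cn wn by (intro d_tri) auto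
    also have "d c w \<le> d c v + d v w" using cn wn vn by (intro d_tri)
    finally show ?thesis using x d_sym[of c v] by simp
  qed
  have "5 * d v w \<le> Dw"
    using mv mult_right_mono[OF multiplier_ge_5 d_nonneg[of v w], of P Dw "n + 12"] by (simp add: m_def)
  \<comment> \<open>The two detours are at most a fifth of \<open>D\<close> and of
    \<open>Dw\<close>, respectively, so even \<open>2 * Dw \<le> 3 * D\<close>.\<close>
  then have "Dw \<le> 2 * D" using Dw_le v5 D0 d_nonneg[of v c] by linarith
  then have "int (level_scale i) * Dw \<le> int (level_scale i) * (2 * D)" by (intro mult_left_mono) auto
  \<comment> \<open>The assumption \<open>2 * Q \<le> P\<close> absorbs the factor 2, so the
    multiplier at \<open>w\<close> has index at least \<open>i\<close>.\<close>
  then have "int (level_scale i) * Dw \<le> P" using iD P by (simp add: ac_simps)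
  then have m_ge: "2 * int (level_ratio i) + 1 \<le> m"
    unfolding m_def using jJ i J by (intro multiplier_ge) auto
  have mx_ge: "2 * int (level_ratio i) + 1 \<le> mx" using level_ratio_mono[of i "2 * J"] jJ i by (simp add: mx_def)
  have a: "(2 * int (level_ratio i) + 1) * d v w \<le> D + d v c + d v w"
    using mult_right_mono[OF m_ge d_nonneg[of v w]] mv Dw_le by linarith
  have b: "(2 * int (level_ratio i) + 1) * d v c \<le> D"
    using mult_right_mono[OF mx_ge d_nonneg[of v c]] mxv by linarith
  have "d w c \<le> d w v + d v c" using cn wn vn by (intro d_tri)
  then have "int (level_ratio i) * d w c \<le> int (level_ratio i) * (d v w + d v c)"
    using d_sym[of w v] by (intro mult_left_mono) auto
  \<comment> \<open>In the sum of \<open>a\<close> and \<open>b\<close> the single terms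
    \<open>d v c\<close> and \<open>d v w\<close> cancel, and
    \<open>2 * r * (d v w + d v c) \<le> 2 * D\<close> remains, where \<open>r\<close> is the ratio
    at \<open>i\<close>.\<close>
  also have "\<dots> \<le> D" using a b by (simp add: algebra_simps)
  finally have "int (level_scale i) * (int (level_ratio i) * d w c) \<le> int (level_scale i) * D" by (intro mult_left_mono) auto
  then have jw: "int (level_scale j) * d w c \<le> Q" using iD i by (simp add: ac_simps)
  have "set_dist (insert w F) c \<le> d w c" using F w by (intro set_dist_le) auto
  then have "int (level_scale j) * set_dist (insert w F) c \<le> int (level_scale j) * d w c" by (intro mult_left_mono) auto
  then have "j < level (insert w F)" using level_iff[OF jJ] jw by simp
  then show ?thesis by (simp add: j_def)
qed

text \<open>Clearing the potential of \<open>v\<close> at any moment of the scan would raise the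
  level at that moment, and levels never fall; equal levels at both ends exclude it.\<close>

lemma scan_keeps:
  assumes F: "F \<subseteq> fac" "F \<noteq> {}" and pot: "\<And>v. 0 \<le> pot v"
    and close: "\<exists>x\<in>F. d x v \<le> f c + d c v" "f c + 2 * d c v \<le> Q" and P: "2 * Q \<le> P"
    and lev: "level F < J" and live: "mx * int (level_scale (level F)) * d v c \<le> Q"
    and scan: "scan P k (F, pot) = (F', pot')" and same: "level F' = level F"
  shows "pot' v = pot v"
  using scan same
proof (induction k arbitrary: F' pot')
  case (Suc k)
  obtain F1 pot1 where s1: "scan P k (F, pot) = (F1, pot1)" by (cases "scan P k (F, pot)")
  note S1 = scan_invariant[OF F pot s1]
  note S' = scan_invariant[OF F pot Suc.prems(1)]
  have visit: "visit P k (F1, pot1) = (F', pot')" using Suc.prems s1 by simp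
  have sub: "F1 \<subseteq> F'" using visit by (cases rule: visit_cases[of P k F1 pot1]) auto
  have ne: "F1 \<noteq> {}" using S1 F by auto
  have lev1: "level F1 = level F"
    using level_mono[OF S1(1,2) F(2)] level_mono[OF sub S'(2) ne] Suc.prems by simp
  have IH: "pot1 v = pot v" using Suc.IH[OF s1 lev1] .
  show ?case
  proof (cases rule: visit_cases[of P k F1 pot1])
    case 1
    then show ?thesis using visit IH by simp
  next
    case 2
    have "v \<notin> near P F1 k"
    proof
      assume "v \<in> near P F1 k"
      then have "level F1 < level (insert k F1)"
        using close P lev live lev1 S1(1,2) ne 2(2) by (intro level_increases) auto
      then show False using 2 visit lev1 Suc.prems by auto
    qed
    then show ?thesis using 2 visit IH by auto
  qed
qed simp

text \<open>Below level \<open>J\<close> the center \<open>c\<close> is not open, so by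
  \<open>good\<close> the potential near it is less than \<open>f c\<close>; and live clients are
  near because \<open>mx\<close> dominates the multiplier at \<open>c\<close>. At level
  \<open>J\<close> nothing is live.\<close>

lemma live_potential_le:
  assumes g: "good F pot P" and ne: "F \<noteq> {}" and P: "P \<le> int (level_scale J) * Q" and C: "C \<subseteq> {..<n}"
  shows "(\<Sum>v\<in>live F C. pot v) \<le> f c"
proof (cases "level F < J")
  case False
  then show ?thesis using f_nonneg[OF c] by (simp add: live_def)
next
  case True
  define D where "D = set_dist F c"
  have F: "F \<subseteq> fac" and pot: "0 \<le> pot v" for v using g by (auto simp: good_def)
  have Dj: "Q < int (level_scale (level F)) * D" using level_iff[OF True, of F] by (simp add: D_def)
  have "D \<noteq> 0" using Dj Q by auto
  then have "c \<notin> F" using set_dist_mem[OF F, of c] by (auto simp: D_def)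
  then have small: "(\<Sum>v\<in>near P F c. pot v) < f c" using g c ne by (auto simp: good_def)
  have "int (level_scale (level F)) * D \<le> int (level_scale J) * D"
    using level_scale_mono[OF level_le] set_dist_nonneg by (intro mult_right_mono) (auto simp: D_def)
  then have m: "multiplier P D (n + 12) \<le> mx"
    unfolding mx_def using P Dj Q by (intro multiplier_le) auto
  have "live F C \<subseteq> near P F c"
  proof
    fix v assume v: "v \<in> live F C"
    then have "mx * int (level_scale (level F)) * d v c \<le> Q" "v < n" using C by (auto simp: live_def)
    then have "int (level_scale (level F)) * (mx * d v c) < int (level_scale (level F)) * D" using Dj by (simp add: ac_simps)
    then have "mx * d v c < D" using level_scale_pos[of "level F"] by simp
    then have "multiplier P D (n + 12) * d v c \<le> D"
      using mult_right_mono[OF m d_nonneg[of v c]] by simp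
    then show "v \<in> near P F c" using \<open>v < n\<close> by (simp add: near_def D_def)
  qed
  then have "(\<Sum>v\<in>live F C. pot v) \<le> (\<Sum>v\<in>near P F c. pot v)" using pot by (intro sum_mono2) auto
  then show ?thesis using small by simp
qed

lemma step_facts:
  assumes g: "good F pot P" and ne: "F \<noteq> {}" and u: "u < n"
    and st: "step (F, pot, P) u = (F', pot', P')"
    and P: "2 * Q \<le> P" "P' \<le> int (level_scale J) * Q" and C: "C \<subseteq> {..<n}"
    and close: "\<And>v. v \<in> C \<Longrightarrow> f c + 2 * d c v \<le> Q"
    and arrived: "\<And>v. v \<in> C \<Longrightarrow> v = u \<or> (\<exists>x\<in>F. d x v \<le> f c + d c v)"
  shows "level F \<le> level F'" "P \<le> P'"
    "(\<Sum>v\<in>live F C. pot v) \<le> f c"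
    "level F' = level F \<Longrightarrow> v \<in> live F C \<Longrightarrow> pot' v = (pot(u := price F u (best F u))) v"
proof -
  note S = step_good[OF g u st]
  have F: "F \<subseteq> fac" "F' \<subseteq> fac" and pot: "0 \<le> pot v" for v
    using g S(1) by (auto simp: good_def)
  show "level F \<le> level F'" using level_mono[OF S(2) F(2) ne] .
  show PP: "P \<le> P'" using S(4) price_nonneg[OF best_fac] by simp
  show "(\<Sum>v\<in>live F C. pot v) \<le> f c" using live_potential_le[OF g ne _ C] PP P by simp
  let ?F = "insert (best F u) F"
  assume same: "level F' = level F" and v: "v \<in> live F C"
  have sub: "?F \<subseteq> fac" "?F \<noteq> {}" using F best_fac by auto
  have sub': "?F \<subseteq> F'" using S by auto
  have lev: "level ?F = level F"
    using level_mono[OF subset_insertI sub(1) ne] level_mono[OF sub' F(2) sub(2)] same by simp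
  have nn: "0 \<le> (pot(u := price F u (best F u))) v" for v using pot price_nonneg[OF best_fac] by simp
  have vC: "v \<in> C" "level F < J" "mx * int (level_scale (level F)) * d v c \<le> Q" using v by (auto simp: live_def)
  have cl: "\<exists>x\<in>?F. d x v \<le> f c + d c v" using arrived[OF vC(1)] S(7)[OF c] by auto
  show "pot' v = (pot(u := price F u (best F u))) v"
    using scan_keeps[OF sub nn cl close[OF vC(1)] _ _ _ S(6)] P PP lev vC same by simp
qed

text \<open>If the level stays, the live potentials are untouched; if it rises, the gain of at least
  \<open>2 * f c\<close> outweighs the live potential of at most \<open>f c\<close> that may be
  lost.\<close>

lemma potential_mono:
  assumes g: "good F pot P" and ne: "F \<noteq> {}" and u: "u < n"
    and st: "step (F, pot, P) u = (F', pot', P')"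
    and P: "2 * Q \<le> P" "P' \<le> int (level_scale J) * Q" and C: "C \<subseteq> {..<n}" "u \<notin> C"
    and close: "\<And>v. v \<in> C \<Longrightarrow> f c + 2 * d c v \<le> Q"
    and arrived: "\<And>v. v \<in> C \<Longrightarrow> \<exists>x\<in>F. d x v \<le> f c + d c v"
  shows "potential F pot C \<le> potential F' pot' C"
proof -
  note S = step_facts[OF g ne u st P C(1) close, simplified arrived, simplified]
  have pot': "0 \<le> pot' v" for v using step_good(1)[OF g u st] by (simp add: good_def)
  show ?thesis
  proof (cases "level F' = level F")
    case True
    then have "(\<Sum>v\<in>live F C. pot v) = (\<Sum>v\<in>live F' C. pot' v)"
      using S(4) C by (intro sum.cong) (auto simp: live_def)
    then show ?thesis using True by (simp add: potential_def)
  next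
    case False
    then have "int (level F) + 1 \<le> int (level F')" using S(1) by simp
    then have "2 * f c * (int (level F) + 1) \<le> 2 * f c * int (level F')"
      using f_nonneg[OF c] by (intro mult_left_mono) auto
    moreover have "0 \<le> (\<Sum>v\<in>live F' C. pot' v)" using pot' by (intro sum_nonneg) auto
    ultimately show ?thesis using S(3) f_nonneg[OF c] by (simp add: potential_def algebra_simps)
  qed
qed

text \<open>The price of a client of the cluster is charged in one of four ways: to the term
  \<open>Q\<close> if \<open>c\<close> has reached level \<open>J\<close>; to the distance of the
  client if it is not very close to \<open>c\<close>; to its own potential if it is live and the
  level stays; to the second \<open>f c\<close> of a new level otherwise.\<close>

lemma potential_step:
  fixes N :: int
  assumes g: "good F pot P" and ne: "F \<noteq> {}" and u: "u < n"
    and st: "step (F, pot, P) u = (F', pot', P')"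
    and P: "2 * Q \<le> P" "P' \<le> int (level_scale J) * Q" and C: "C \<subseteq> {..<n}" "u \<notin> C"
    and close: "\<And>v. v \<in> insert u C \<Longrightarrow> f c + 2 * d c v \<le> Q"
    and arrived: "\<And>v. v \<in> C \<Longrightarrow> \<exists>x\<in>F. d x v \<le> f c + d c v"
    and N: "0 \<le> N" "N \<le> int (level_scale (J - 1))"
  shows "N * (potential F pot C + (P' - P)) \<le>
    N * (potential F' pot' (insert u C) + (mx * int (level_ratio J) + 2) * d u c) + Q"
proof -
  define p where "p = price F u (best F u)"
  define j where "j = level F"
  define D where "D = set_dist F c"
  note S = step_good[OF g u st]
  have F: "F \<subseteq> fac" "F' \<subseteq> fac" and pot': "0 \<le> pot' v" for v
    using g S(1) by (auto simp: good_def)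
  have finC: "finite C" using C by (auto intro: finite_subset)
  have pP: "P' - P = p" using S(4) by (simp add: p_def)
  have cn: "c < n" using c fac_less by auto
  have bbJ: "0 \<le> mx * int (level_ratio J)" using mx_ge_5 by simp
  have du: "0 \<le> d u c" by (rule d_nonneg)
  have dmult: "d u c \<le> (mx * int (level_ratio J) + 2) * d u c"
    using mult_right_mono[of 1 "mx * int (level_ratio J) + 2" "d u c"] du bbJ by simp
  have p_c: "p \<le> f c + d u c"
    using best_le[OF c, of F u] f_nonneg[OF c] d_sym[of u c] by (auto simp: p_def price_def split: if_splits)
  have p_D: "p \<le> D + d u c"
  proof -
    obtain x where x: "x \<in> F" "D = d x c" using set_dist_attained[OF F(1) ne] by (auto simp: D_def)
    then have xf: "x \<in> fac" using F by auto
    have "p \<le> d x u" using best_le[OF xf, of F u] x by (simp add: p_def price_def)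
    also have "\<dots> \<le> d x c + d c u" using xf fac_less cn u by (intro d_tri) auto
    finally show ?thesis using x d_sym[of c u] by simp
  qed
  have mono: "potential F pot C \<le> potential F' pot' (insert u C)"
  proof -
    have "potential F pot C \<le> potential F' pot' C"
      using potential_mono[OF g ne u st P C] close arrived by blast
    also have "\<dots> \<le> potential F' pot' (insert u C)"
      unfolding potential_def using pot' finC by (intro add_left_mono sum_mono2) (auto simp: live_def)
    finally show ?thesis .
  qed
  show ?thesis
  proof (cases "j < J")
    case False
    then have "j = J" using level_le[of F] by (simp add: j_def)
    \<comment> \<open>The last threshold has index \<open>J - 1\<close>. Having passed it,
      \<open>c\<close> has an open facility so close that \<open>N * D \<le> Q\<close>.\<close>
    then have "int (level_scale (J - 1)) * D \<le> Q" using level_iff[of "J - 1" F] J by (simp add: j_def D_def)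
    moreover have "N * D \<le> int (level_scale (J - 1)) * D"
      using N set_dist_nonneg by (intro mult_right_mono) (auto simp: D_def)
    ultimately have "N * D \<le> Q" by simp
    then have "N * p \<le> Q + N * d u c"
      using mult_left_mono[OF p_D N(1)] by (simp add: algebra_simps)
    moreover have "N * potential F pot C \<le> N * potential F' pot' (insert u C)"
      using mono N by (intro mult_left_mono)
    moreover have "N * d u c \<le> N * ((mx * int (level_ratio J) + 2) * d u c)"
      using N dmult by (intro mult_left_mono)
    ultimately show ?thesis unfolding pP by (simp add: algebra_simps)
  next
    case True
    have "potential F pot C + p \<le> potential F' pot' (insert u C) + (mx * int (level_ratio J) + 2) * d u c"
    proof (cases "mx * int (level_scale j) * d u c \<le> Q")
      case False
      have "p \<le> (mx * int (level_ratio J) + 2) * d u c"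
      proof (cases j)
        \<comment> \<open>At level 0 no threshold bounds \<open>D\<close>, but
          \<open>f c \<le> Q\<close> is less than \<open>mx * d u c\<close>, so the price of using
          \<open>c\<close> itself is small enough.\<close>
        case 0
        have "f c \<le> Q" using close[of u] d_nonneg[of c u] f_nonneg[OF c] by simp
        then have "p \<le> (mx + 1) * d u c" using p_c False 0 by (simp add: algebra_simps)
        also have "\<dots> \<le> (mx * int (level_ratio J) + 2) * d u c"
        proof (rule mult_right_mono[OF _ du])
          have "mx * 1 \<le> mx * int (level_ratio J)" using level_ratio_ge_2[of J] mx_ge_5 by (intro mult_left_mono) auto
          then show "mx + 1 \<le> mx * int (level_ratio J) + 2" by simp
        qed
        finally show ?thesis .
      next
        case (Suc i)
        \<comment> \<open>The bound on \<open>D\<close> comes from threshold \<open>i\<close>, the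
          failed closeness test from threshold \<open>Suc i\<close>. The gap of one ratio is the
          second factor of \<open>mx * level_ratio J\<close>.\<close>
        have "int (level_scale i) * D \<le> Q" using level_iff[of i F] True Suc by (simp add: j_def D_def)
        also have "Q < int (level_scale i) * (mx * int (level_ratio i) * d u c)" using False Suc by (simp add: ac_simps)
        finally have "D < mx * int (level_ratio i) * d u c" using level_scale_pos[of i] by simp
        moreover have "mx * int (level_ratio i) * d u c \<le> mx * int (level_ratio J) * d u c"
          using level_ratio_mono[of i J] True Suc mx_ge_5 du by (intro mult_right_mono mult_left_mono) auto
        ultimately show ?thesis using p_D du by (simp add: algebra_simps)
      qed
      then show ?thesis using mono by simp
    next
      case small: True
      show ?thesis
      proof (cases "level F' = level F")
        case same: True
        have live: "live F (insert u C) = insert u (live F C)" "u \<notin> live F C" "finite (live F C)"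
          using small True C finC by (auto simp: live_def j_def)
        have C': "insert u C \<subseteq> {..<n}" using C u by auto
        have arr: "v = u \<or> (\<exists>x\<in>F. d x v \<le> f c + d c v)" if "v \<in> insert u C" for v
          using that arrived by blast
        note K = step_facts(4)[OF g ne u st P C' close arr same]
        have K': "pot' v = (pot(u := p)) v" if "v \<in> insert u (live F C)" for v
          using K[of v] that live by (simp add: p_def)
        have "(\<Sum>v\<in>live F' (insert u C). pot' v) = (\<Sum>v\<in>insert u (live F C). (pot(u := p)) v)"
          using K' live same by (intro sum.cong) (auto simp: live_def)
        also have "\<dots> = p + (\<Sum>v\<in>live F C. (pot(u := p)) v)" using live by simp
        also have "(\<Sum>v\<in>live F C. (pot(u := p)) v) = (\<Sum>v\<in>live F C. pot v)"
          using live by (intro sum.cong) auto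
        finally show ?thesis using same bbJ du by (simp add: potential_def)
      next
        case False
        note T = step_facts[OF g ne u st P C(1), simplified arrived, simplified]
        have lev: "level F \<le> level F'" "(\<Sum>v\<in>live F C. pot v) \<le> f c" using T(1,3) close by auto
        then have "int (level F) + 1 \<le> int (level F')" using False by simp
        then have "2 * f c * (int (level F) + 1) \<le> 2 * f c * int (level F')"
          using f_nonneg[OF c] by (intro mult_left_mono) auto
        moreover have "0 \<le> (\<Sum>v\<in>live F' (insert u C). pot' v)" using pot' by (intro sum_nonneg) auto
        ultimately show ?thesis using dmult lev(2) p_c by (simp add: potential_def algebra_simps)
      qed
    qed
    then have "N * (potential F pot C + p) \<le> N * (potential F' pot' (insert u C) + (mx * int (level_ratio J) + 2) * d u c)"
      using N by (intro mult_left_mono)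
    then show ?thesis using pP Q by simp
  qed
qed

end

section \<open>From one cluster to the whole run\<close>

context fl
begin

definition opens :: "nat list \<Rightarrow> nat \<Rightarrow> nat set" where
  "opens xs i = fst (final (take i xs))"

definition pots :: "nat list \<Rightarrow> nat \<Rightarrow> nat \<Rightarrow> int" where
  "pots xs i = fst (snd (final (take i xs)))"

definition paid :: "nat list \<Rightarrow> nat \<Rightarrow> int" where
  "paid xs i = snd (snd (final (take i xs)))"

definition pay :: "nat list \<Rightarrow> nat \<Rightarrow> int" where
  "pay xs i = price (opens xs i) (xs ! i) (best (opens xs i) (xs ! i))"

lemma final_take: "final (take i xs) = (opens xs i, pots xs i, paid xs i)"
  by (simp add: opens_def pots_def paid_def)

context
  fixes xs :: "nat list"
  assumes xs: "set xs \<subseteq> {..<n}"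
begin

lemma nth_less: "i < length xs \<Longrightarrow> xs ! i < n"
  using xs nth_mem by blast

lemma final_step:
  assumes "i < length xs"
  shows "step (opens xs i, pots xs i, paid xs i) (xs ! i) = (opens xs (Suc i), pots xs (Suc i), paid xs (Suc i))"
  using assms unfolding final_take[symmetric] by (simp add: final_def take_Suc_conv_app_nth)

lemma good_final: "i \<le> length xs \<Longrightarrow> good (opens xs i) (pots xs i) (paid xs i)"
proof (induction i)
  case 0
  then show ?case by (simp add: opens_def pots_def paid_def final_def good_initial)
next
  case (Suc i)
  then show ?case using step_good(1)[OF _ _ final_step] nth_less by simp
qed

lemma paid_Suc: "i < length xs \<Longrightarrow> paid xs (Suc i) = paid xs i + pay xs i"
  using step_good(4)[OF good_final nth_less final_step] by (simp add: pay_def)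

lemma pay_nonneg: "0 \<le> pay xs i"
  using price_nonneg best_fac by (simp add: pay_def)

lemma paid_eq: "t \<le> i \<Longrightarrow> i \<le> length xs \<Longrightarrow> paid xs i = paid xs t + (\<Sum>k\<in>{t..<i}. pay xs k)"
proof (induction i)
  case (Suc i)
  show ?case
  proof (cases "t = Suc i")
    case False
    then have "t \<le> i" using Suc by simp
    then show ?thesis using Suc paid_Suc by (simp add: atLeastLessThanSuc)
  qed simp
qed simp

lemma opens_mono: "i \<le> j \<Longrightarrow> j \<le> length xs \<Longrightarrow> opens xs i \<subseteq> opens xs j"
proof (induction j)
  case (Suc j)
  show ?case
  proof (cases "i = Suc j")
    case False
    then have "opens xs i \<subseteq> opens xs j" using Suc by simp
    also have "opens xs j \<subseteq> opens xs (Suc j)"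
      using step_good(2)[OF good_final nth_less final_step, of j] Suc by simp
    finally show ?thesis .
  qed simp
qed simp

lemma opens_nonempty: "0 < i \<Longrightarrow> i \<le> length xs \<Longrightarrow> opens xs i \<noteq> {}"
  using step_good(3)[OF good_final nth_less final_step, of "i - 1"] by simp

lemma opens_fac: "i \<le> length xs \<Longrightarrow> opens xs i \<subseteq> fac"
  using good_final by (simp add: good_def)

text \<open>The affordable centers cost at most the sum of all prices, and by \<open>good\<close>
  the other open facilities cost at most twice that sum.\<close>

lemma opens_cost: "i \<le> length xs \<Longrightarrow> (\<Sum>w\<in>opens xs i. f w) \<le> 3 * paid xs i"
proof -
  assume i: "i \<le> length xs"
  let ?A = "affordable (paid xs i)"
  have g: "good (opens xs i) (pots xs i) (paid xs i)" using good_final[OF i] .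
  have fin: "finite (opens xs i)" using opens_fac[OF i] by (auto intro: finite_subset[OF _ finites(1)])
  have "(\<Sum>w\<in>opens xs i. f w) = (\<Sum>w\<in>opens xs i - ?A. f w) + (\<Sum>w\<in>opens xs i \<inter> ?A. f w)"
    using fin by (subst add.commute) (rule sum.Int_Diff)
  also have "(\<Sum>w\<in>opens xs i \<inter> ?A. f w) \<le> (\<Sum>w\<in>?A. f w)"
    using centers_sub f_nonneg
    by (intro sum_mono2) (auto simp: affordable_def intro: finite_subset[OF _ finites(1)])
  also have "\<dots> \<le> paid xs i" using g by (intro affordable_cost) (simp add: good_def)
  finally have "(\<Sum>w\<in>opens xs i. f w) \<le> (\<Sum>w\<in>opens xs i - ?A. f w) + paid xs i" by simp
  moreover have "0 \<le> (\<Sum>v<n. pots xs i v)" using g by (intro sum_nonneg) (simp add: good_def)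
  ultimately show ?thesis using g by (simp add: good_def)
qed

lemma pay_le:
  assumes "x \<in> opens xs i" "i < length xs"
  shows "pay xs i \<le> d x (xs ! i)"
  using best_le[of x "opens xs i" "xs ! i"] assms opens_fac[of i] by (auto simp: pay_def price_def)

lemma pay_le': "c \<in> fac \<Longrightarrow> pay xs i \<le> f c + d (xs ! i) c"
  using best_le[of c "opens xs i" "xs ! i"] f_nonneg[of c] d_sym[of c "xs ! i"]
  by (auto simp: pay_def price_def split: if_splits)

text \<open>Telescopes \<open>potential_step\<close> over the arrivals in \<open>C\<close> and
  \<open>potential_mono\<close> over all others. The final potential is at most
  \<open>2 * f c\<close> per level plus one \<open>f c\<close> for what is still live.\<close>

lemma cluster_cost:
  fixes N Q :: int
  assumes dist: "distinct xs" and C: "C \<subseteq> {t..<length xs}" and t: "0 < t" "t \<le> length xs"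
    and c: "c \<in> fac" and Q: "0 < Q" and J: "0 < J" "J \<le> n + 12"
    and close: "\<And>k. k \<in> C \<Longrightarrow> f c + 2 * d (xs ! k) c \<le> Q"
    and P: "2 * Q \<le> paid xs t" "paid xs (length xs) \<le> int (level_scale J) * Q"
    and N: "0 \<le> N" "N \<le> int (level_scale (J - 1))"
  shows "N * (\<Sum>k\<in>C. pay xs k) \<le> N * ((2 * int J + 1) * f c +
    ((2 * int (level_ratio (2 * J)) + 1) * int (level_ratio J) + 2) * (\<Sum>k\<in>C. d (xs ! k) c)) + int (card C) * Q"
proof -
  interpret cluster n fac d f Xh c Q J using c Q J by unfold_locales
  define be where "be = mx * int (level_ratio J) + 2"
  define A where "A = (\<lambda>i. C \<inter> {..<i})"
  define K where "K = (\<lambda>i. (!) xs ` A i)"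
  define ph where "ph = (\<lambda>i. potential (opens xs i) (pots xs i) (K i))"
  have fin: "finite (A i)" for i using C by (auto simp: A_def intro: finite_subset)
  have mono_paid: "paid xs i \<le> paid xs j" if "i \<le> j" "j \<le> length xs" for i j
    using paid_eq[OF that] pay_nonneg by (simp add: sum_nonneg)
  have main: "N * (\<Sum>k\<in>A i. pay xs k) \<le> N * (ph i + be * (\<Sum>k\<in>A i. d (xs ! k) c)) + int (card (A i)) * Q"
    if "t \<le> i" "i \<le> length xs" for i
    using that
  proof (induction i rule: dec_induct)
    case base
    have "A t = {}" using C by (auto simp: A_def)
    then show ?case using N f_nonneg[OF c] by (simp add: ph_def potential_def K_def live_def)
  next
    case (step i)
    have il: "i < length xs" using step by simp
    note IH = step.IH[OF less_imp_le[OF il]]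
    note g = good_final[OF less_imp_le[OF il]]
    note u = nth_less[OF il]
    note st = final_step[OF il]
    have ne: "opens xs i \<noteq> {}" using opens_nonempty t step by simp
    have P1: "2 * Q \<le> paid xs i" using P mono_paid[of t i] step il by simp
    have P2: "paid xs (Suc i) \<le> int (level_scale J) * Q" using P mono_paid[of "Suc i" "length xs"] il by simp
    have Ki: "K i \<subseteq> {..<n}" using il nth_less by (auto simp: K_def A_def)
    \<comment> \<open>A repeated client would overwrite its own potential; distinctness of the
      arrivals excludes this.\<close>
    have uK: "xs ! i \<notin> K i" using nth_eq_iff_index_eq[OF dist] il by (auto simp: K_def A_def)
    have closeK: "f c + 2 * d c v \<le> Q" if "v \<in> K j" for v j
      using that close d_sym[of _ c] by (auto simp: K_def A_def)
    have arr: "\<exists>x\<in>opens xs i. d x v \<le> f c + d c v" if v: "v \<in> K i" for v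
    proof -
      obtain k where k: "k < i" "v = xs ! k" using v by (auto simp: K_def A_def)
      then have kl: "k < length xs" using il by simp
      note S = step_good(2,5,7)[OF good_final[OF less_imp_le[OF kl]] nth_less[OF kl] final_step[OF kl]]
      have "insert (best (opens xs k) (xs ! k)) (opens xs k) \<subseteq> opens xs (Suc k)" using S by auto
      also have "\<dots> \<subseteq> opens xs i" using opens_mono k il by simp
      finally show ?thesis using S(3)[OF c] k(2) by blast
    qed
    show ?case
    proof (cases "i \<in> C")
      case True
      then have AS: "A (Suc i) = insert i (A i)" "i \<notin> A i" by (auto simp: A_def less_Suc_eq)
      then have KS: "K (Suc i) = insert (xs ! i) (K i)" by (simp add: K_def)
      have cl: "f c + 2 * d c v \<le> Q" if "v \<in> insert (xs ! i) (K i)" for v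
        using closeK[of v "Suc i"] that KS by simp
      have "N * (ph i + pay xs i) \<le> N * (ph (Suc i) + be * d (xs ! i) c) + Q"
        using potential_step[OF g ne u st P1 P2 Ki uK cl arr N] KS paid_Suc[OF il]
        by (simp add: ph_def be_def)
      then show ?thesis using IH AS fin[of i] by (simp add: algebra_simps)
    next
      case False
      then have AS: "A (Suc i) = A i" by (auto simp: A_def less_Suc_eq)
      have "ph i \<le> ph (Suc i)"
        using potential_mono[OF g ne u st P1 P2 Ki uK closeK arr] AS by (simp add: ph_def K_def)
      then have "N * ph i \<le> N * ph (Suc i)" using N by (intro mult_left_mono)
      then show ?thesis using IH AS by (simp add: algebra_simps)
    qed
  qed
  have AL: "A (length xs) = C" using C by (auto simp: A_def)
  have "ph (length xs) \<le> (2 * int J + 1) * f c"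
  proof -
    have "K (length xs) \<subseteq> {..<n}" using nth_less by (auto simp: K_def A_def)
    then have "(\<Sum>v\<in>live (opens xs (length xs)) (K (length xs)). pots xs (length xs) v) \<le> f c"
      using live_potential_le[OF good_final[OF order_refl] _ P(2)] opens_nonempty[OF less_le_trans[OF t] order_refl] by simp
    moreover have "2 * f c * int (level (opens xs (length xs))) \<le> 2 * f c * int J"
      using level_le f_nonneg[OF c] by (intro mult_left_mono) auto
    ultimately show ?thesis by (simp add: ph_def potential_def algebra_simps)
  qed
  then have "N * ph (length xs) \<le> N * ((2 * int J + 1) * f c)" using N by (intro mult_left_mono)
  then show ?thesis using main[OF t(2) order_refl] unfolding AL be_def mx_def
    by (simp add: algebra_simps)
qed

text \<open>No price exceeds \<open>V\<close>, so the early phase is cheap. Once enough is paid, the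
  affordable centers serve all but at most \<open>e\<close> of the later clients at total price
  \<open>3 * V\<close>, and the exceptions are grouped by their reference facility and charged by
  \<open>cluster_cost\<close>.\<close>

lemma paid_le:
  fixes V :: int
  assumes dist: "distinct xs" and S: "S \<subseteq> fac" and phi: "\<And>x. x \<in> set xs \<Longrightarrow> \<phi> x \<in> S"
    and V: "(\<Sum>s\<in>S. f s) + (\<Sum>x\<in>set xs. d x (\<phi> x)) = V"
  defines "e \<equiv> prediction_error (set xs) Xh"
  shows "paid xs (length xs) \<le> (26 * int (depth e) + 28) * V"
proof -
  define L where "L = length xs"
  define J where "J = depth e"
  have finS: "finite S" using S by (auto intro: finite_subset[OF _ finites(1)])
  have V0: "0 \<le> V" unfolding V[symmetric] using S f_nonneg d_nonneg by (intro add_nonneg_nonneg sum_nonneg) auto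
  have fd_le: "f (\<phi> x) + d x (\<phi> x) \<le> V" if "x \<in> set xs" for x
  proof -
    have "f (\<phi> x) \<le> (\<Sum>s\<in>S. f s)" using that phi finS S f_nonneg by (intro member_le_sum) auto
    moreover have "d x (\<phi> x) \<le> (\<Sum>x\<in>set xs. d x (\<phi> x))" using that d_nonneg by (intro member_le_sum) auto
    ultimately show ?thesis using V by simp
  qed
  have pay_V: "pay xs k \<le> V" if "k < L" for k
  proof -
    have x: "xs ! k \<in> set xs" using that by (simp add: L_def)
    then have "\<phi> (xs ! k) \<in> fac" using phi S by auto
    then show ?thesis using pay_le'[of "\<phi> (xs ! k)" k] fd_le[OF x] by simp
  qed
  have paid0: "paid xs 0 = 0" by (simp add: paid_def final_def)
  have target: "7 * V \<le> (26 * int J + 28) * V" using V0 by (intro mult_right_mono) auto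
  show ?thesis
  \<comment> \<open>Treated separately because \<open>cluster_cost\<close> needs
    \<open>0 < Q\<close>.\<close>
  proof (cases "V = 0")
    case True
    then have "(\<Sum>k\<in>{0..<L}. pay xs k) \<le> 0" using pay_V by (intro sum_nonpos) auto
    then show ?thesis using paid_eq[of 0 L] paid0 True by (simp add: L_def)
  next
    case False
    then have Vpos: "0 < V" using V0 by simp
    show ?thesis
    proof (cases "6 * V \<le> paid xs L")
      case False
      then have "paid xs L \<le> 7 * V" using Vpos by linarith
      then show ?thesis using target unfolding L_def J_def by (rule order_trans)
    next
      case True
      \<comment> \<open>Late enough for \<open>prediction_covers\<close>, which needs
        \<open>4 * V\<close>, and for \<open>cluster_cost\<close>, which needs
        \<open>2 * Q = 6 * V\<close>; the price that crosses the line adds at most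
        \<open>V\<close>.\<close>
      define t where "t = (LEAST i. 6 * V \<le> paid xs i)"
      have tV: "6 * V \<le> paid xs t" unfolding t_def using True by (rule LeastI)
      have tL: "t \<le> L" unfolding t_def using True by (rule Least_le)
      have t0: "0 < t" using tV paid0 Vpos by (cases t) auto
      have "paid xs (t - 1) < 6 * V" using not_less_Least[of "t - 1" "\<lambda>i. 6 * V \<le> paid xs i"] t0
        unfolding t_def[symmetric] by simp
      then have t7: "paid xs t \<le> 7 * V"
      proof -
        have "t - 1 < L" using t0 tL by simp
        then have "paid xs (Suc (t - 1)) \<le> paid xs (t - 1) + V"
          using paid_Suc[of "t - 1"] pay_V[of "t - 1"] by (simp add: L_def)
        then show ?thesis using \<open>paid xs (t - 1) < 6 * V\<close> t0 by simp
      qed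
      have "4 * V \<le> paid xs t" using tV Vpos by simp
      from prediction_covers[OF finite_set S phi xs eq_refl[OF V] this]
      obtain Out cost where Out: "Out \<subseteq> set xs \<inter> Xh" "card Out \<le> card (Xh - set xs)"
        and cover: "\<And>v. v \<in> set xs \<inter> Xh - Out \<Longrightarrow> \<exists>s\<in>affordable (paid xs t). d s v \<le> cost v"
        and cost: "\<And>v. 0 \<le> cost v" "(\<Sum>v\<in>set xs \<inter> Xh. cost v) \<le> 3 * V" by blast
      define Cov where "Cov = {k\<in>{t..<L}. xs ! k \<in> Xh - Out}"
      define R where "R = {k\<in>{t..<L}. xs ! k \<notin> Xh - Out}"
      have inj: "inj_on ((!) xs) {..<L}" using dist by (simp add: inj_on_nth L_def)
      have aff: "affordable (paid xs t) \<subseteq> opens xs t"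
        using good_final[of t] opens_nonempty[OF t0] tL by (simp add: good_def L_def)
      have cov_pay: "(\<Sum>k\<in>Cov. pay xs k) \<le> 3 * V"
      proof -
        have "pay xs k \<le> cost (xs ! k)" if "k \<in> Cov" for k
        proof -
          have k: "k < length xs" "t \<le> k" "xs ! k \<in> set xs \<inter> Xh - Out" using that by (auto simp: Cov_def L_def)
          obtain s where s: "s \<in> affordable (paid xs t)" "d s (xs ! k) \<le> cost (xs ! k)" using cover[OF k(3)] by blast
          have "s \<in> opens xs k" using s aff opens_mono[OF k(2)] k(1) by auto
          then show ?thesis using pay_le[of s k] k s by simp
        qed
        then have "(\<Sum>k\<in>Cov. pay xs k) \<le> (\<Sum>k\<in>Cov. cost (xs ! k))" by (intro sum_mono)
        also have "\<dots> = (\<Sum>v\<in>(!) xs ` Cov. cost v)"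
          using inj by (subst sum.reindex) (auto simp: Cov_def intro: inj_on_subset)
        also have "\<dots> \<le> (\<Sum>v\<in>set xs \<inter> Xh. cost v)"
          using cost by (intro sum_mono2) (auto simp: Cov_def L_def)
        finally show ?thesis using cost by simp
      qed
      \<comment> \<open>Both terms of the minimum in the error: \<open>R\<close> indexes distinct
        clients, and each of them is unpredicted or belongs to \<open>Out\<close>, which is no
        larger than \<open>Xh - set xs\<close>.\<close>
      have cardR: "card R \<le> e"
      proof -
        have c: "card R = card ((!) xs ` R)"
          using inj by (subst card_image) (auto simp: R_def intro: inj_on_subset)
        have "(!) xs ` R \<subseteq> set xs" by (auto simp: R_def L_def)
        then have "card R \<le> card (set xs)" unfolding c by (intro card_mono) auto
        moreover have "card R \<le> card ((set xs - Xh) \<union> (Xh - set xs))"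
        proof -
          have "(!) xs ` R \<subseteq> (set xs - Xh) \<union> Out" by (auto simp: R_def L_def)
          then have "card R \<le> card ((set xs - Xh) \<union> Out)"
            unfolding c using Out by (intro card_mono) (auto intro: finite_subset)
          also have "\<dots> \<le> card (set xs - Xh) + card Out" by (rule card_Un_le)
          also have "\<dots> \<le> card (set xs - Xh) + card (Xh - set xs)" using Out by simp
          also have "\<dots> = card ((set xs - Xh) \<union> (Xh - set xs))"
            by (rule card_Un_disjoint[symmetric]) auto
          finally show ?thesis .
        qed
        ultimately show ?thesis by (simp add: e_def prediction_error_def)
      qed
      have split: "paid xs L = paid xs t + ((\<Sum>k\<in>Cov. pay xs k) + (\<Sum>k\<in>R. pay xs k))"
      proof -
        have "{t..<L} = Cov \<union> R" "Cov \<inter> R = {}" "finite Cov" "finite R" by (auto simp: Cov_def R_def)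
        then show ?thesis using paid_eq[OF tL] by (simp add: L_def sum.union_disjoint)
      qed
      have "(\<Sum>k\<in>R. pay xs k) \<le> (\<Sum>k\<in>R. V)" using pay_V by (intro sum_mono) (simp add: R_def)
      also have "\<dots> \<le> int e * V" using cardR V0 by (simp add: mult_right_mono)
      \<comment> \<open>Charging \<open>V\<close> to each exception is wasteful, but it bounds
        \<open>P\<close> in terms of \<open>V\<close> and \<open>e\<close>, which limits the number
        of levels needed.\<close>
      finally have paid_crude: "paid xs L \<le> (int e + 10) * V" using split t7 cov_pay by (simp add: algebra_simps)
      \<comment> \<open>A client and its reference facility satisfy
        \<open>f s + 2 * d x s \<le> 2 * V\<close>, which \<open>Q\<close> covers, and
        \<open>2 * Q\<close> is the amount already paid at time \<open>t\<close>.\<close>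
      define Q where "Q = 3 * V"
      \<comment> \<open>Larger than \<open>card R\<close>, so the error terms of all clusters
        together cost a single \<open>Q\<close> after division by \<open>N\<close>; the summand 1
        keeps \<open>N\<close> positive when \<open>e = 0\<close>.\<close>
      define N where "N = int e + 1"
      have e_n: "e \<le> n"
      proof -
        have "e \<le> card (set xs)" by (simp add: e_def prediction_error_def)
        also have "\<dots> \<le> card {..<n}" using xs by (intro card_mono) auto
        finally show ?thesis by simp
      qed
      have J: "0 < J" "J \<le> n + 12" "e + 11 \<le> level_scale (J - 1)" using depth[of e] e_n by (auto simp: J_def)
      have aaJ: "int e + 10 \<le> int (level_scale J)" using J(3) level_scale_mono[of "J - 1" J] by simp
      have P2: "paid xs (length xs) \<le> int (level_scale J) * Q"
      proof -
        have "(int e + 10) * V \<le> int (level_scale J) * V" using aaJ V0 by (intro mult_right_mono)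
        also have "\<dots> \<le> int (level_scale J) * Q" using V0 by (intro mult_left_mono) (auto simp: Q_def)
        finally show ?thesis using paid_crude by (simp add: L_def)
      qed
      define be where "be = (2 * int (level_ratio (2 * J)) + 1) * int (level_ratio J) + 2"
      have be: "be \<le> 24 * int J + 14"
      proof -
        have "be \<le> (2 * int (level_ratio (2 * J)) + int (level_ratio (2 * J))) * int (level_ratio (2 * J)) + 2"
          unfolding be_def using level_ratio_mono[of J "2 * J"] level_ratio_ge_2[of "2 * J"]
          by (intro add_right_mono mult_mono) auto
        also have "\<dots> = 3 * int (level_ratio (2 * J) * level_ratio (2 * J)) + 2" by simp
        also have "\<dots> \<le> 3 * int (4 * (2 * J) + 4) + 2"
          by (intro add_right_mono mult_left_mono) (simp_all only: of_nat_le_iff level_ratio_square_le zero_le_numeral)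
        finally show ?thesis by simp
      qed
      have be0: "0 \<le> be" by (simp add: be_def)
      have N: "0 < N" "N \<le> int (level_scale (J - 1))" using J(3) by (auto simp: N_def)
      have finR: "finite R" by (simp add: R_def)
      define Cl where "Cl = (\<lambda>s. {k\<in>R. \<phi> (xs ! k) = s})"
      have phiR: "\<phi> (xs ! k) \<in> S" if "k \<in> R" for k using that phi by (auto simp: R_def L_def)
      have group: "(\<Sum>k\<in>R. h k) = (\<Sum>s\<in>S. \<Sum>k\<in>Cl s. h k)" for h :: "nat \<Rightarrow> int"
        unfolding Cl_def using finR finS phiR by (intro sum.group[symmetric]) auto
      have cl: "N * (\<Sum>k\<in>Cl s. pay xs k) \<le> N * ((2 * int J + 1) * f s +
          be * (\<Sum>k\<in>Cl s. d (xs ! k) s)) + int (card (Cl s)) * Q" if s: "s \<in> S" for s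
        unfolding be_def
      proof (rule cluster_cost[OF dist _ t0 _ _ _ J(1,2) _ _ P2 _ N(2)])
        show "Cl s \<subseteq> {t..<length xs}" by (auto simp: Cl_def R_def L_def)
        show "t \<le> length xs" using tL by (simp add: L_def)
        show "s \<in> fac" using s S by auto
        show "0 < Q" using Vpos by (simp add: Q_def)
        show "2 * Q \<le> paid xs t" using tV by (simp add: Q_def)
        show "0 \<le> N" using N by simp
        fix k assume k: "k \<in> Cl s"
        then have "xs ! k \<in> set xs" by (simp add: Cl_def R_def L_def)
        then show "f s + 2 * d (xs ! k) s \<le> Q"
          using fd_le[of "xs ! k"] k f_nonneg[of s] s S V0 d_nonneg[of "xs ! k" s]
          by (auto simp: Cl_def Q_def)
      qed
      have "N * (\<Sum>k\<in>R. pay xs k) = (\<Sum>s\<in>S. N * (\<Sum>k\<in>Cl s. pay xs k))"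
        by (simp add: group sum_distrib_left)
      also have "\<dots> \<le> (\<Sum>s\<in>S. N * ((2 * int J + 1) * f s +
          be * (\<Sum>k\<in>Cl s. d (xs ! k) s)) + int (card (Cl s)) * Q)" using cl by (rule sum_mono)
      also have "\<dots> = N * ((2 * int J + 1) * (\<Sum>s\<in>S. f s) + be * (\<Sum>s\<in>S. \<Sum>k\<in>Cl s. d (xs ! k) s)) +
          (\<Sum>s\<in>S. int (card (Cl s))) * Q"
        by (simp add: sum.distrib sum_distrib_left sum_distrib_right algebra_simps)
      also have "(\<Sum>s\<in>S. int (card (Cl s))) = int (card R)" using group[of "\<lambda>_. 1"] by simp
      also have "(\<Sum>s\<in>S. \<Sum>k\<in>Cl s. d (xs ! k) s) = (\<Sum>k\<in>R. d (xs ! k) (\<phi> (xs ! k)))"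
        unfolding group by (intro sum.cong) (auto simp: Cl_def)
      also have "int (card R) * Q \<le> N * Q"
        using cardR V0 by (intro mult_right_mono) (auto simp: N_def Q_def)
      also have "N * ((2 * int J + 1) * (\<Sum>s\<in>S. f s) + be * (\<Sum>k\<in>R. d (xs ! k) (\<phi> (xs ! k)))) + N * Q =
          N * ((2 * int J + 1) * (\<Sum>s\<in>S. f s) + be * (\<Sum>k\<in>R. d (xs ! k) (\<phi> (xs ! k))) + Q)"
        by (simp add: algebra_simps)
      finally have "(\<Sum>k\<in>R. pay xs k) \<le> (2 * int J + 1) * (\<Sum>s\<in>S. f s) +
          be * (\<Sum>k\<in>R. d (xs ! k) (\<phi> (xs ! k))) + Q" using N(1) by simp
      also have "(\<Sum>k\<in>R. d (xs ! k) (\<phi> (xs ! k))) \<le> V"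
      proof -
        have "(\<Sum>k\<in>R. d (xs ! k) (\<phi> (xs ! k))) = (\<Sum>x\<in>(!) xs ` R. d x (\<phi> x))"
          using inj by (subst sum.reindex) (auto simp: R_def intro: inj_on_subset)
        also have "\<dots> \<le> (\<Sum>x\<in>set xs. d x (\<phi> x))"
          using d_nonneg by (intro sum_mono2) (auto simp: R_def L_def)
        also have "\<dots> \<le> V"
        proof -
          have "0 \<le> (\<Sum>s\<in>S. f s)" using S f_nonneg by (intro sum_nonneg) auto
          then show ?thesis using V by simp
        qed
        finally show ?thesis .
      qed
      also have "(\<Sum>s\<in>S. f s) \<le> V"
        using V sum_nonneg[of "set xs" "\<lambda>x. d x (\<phi> x)", OF d_nonneg] by simp
      finally have "(\<Sum>k\<in>R. pay xs k) \<le> (2 * int J + 1) * V + be * V + 3 * V"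
        using be0 by (simp add: Q_def mult_left_mono)
      also have "be * V \<le> (24 * int J + 14) * V" using be V0 by (rule mult_right_mono)
      \<comment> \<open>The coefficient 26 is \<open>2 + 24\<close>. The constant 28 is
        \<open>1 + 14 + 3\<close> for \<open>R\<close>, 7 for the time up to \<open>t\<close> and 3
        for the covered clients.\<close>
      finally show ?thesis using split t7 cov_pay by (simp add: L_def J_def algebra_simps)
    qed
  qed
qed

end

end

section \<open>Bounded loop programs run in polynomial time\<close>

lemma int_size_le_iff: "int_size k \<le> Suc w \<longleftrightarrow> \<bar>k\<bar> < 2 ^ w"
proof -
  have "int_size k \<le> Suc w \<longleftrightarrow> nat \<bar>k\<bar> < 2 ^ w"
    by (simp add: int_size_def floorlog_le_iff)
  also have "\<dots> \<longleftrightarrow> \<bar>k\<bar> < 2 ^ w"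
    by (metis abs_ge_zero nat_less_iff of_nat_numeral of_nat_power)
  finally show ?thesis .
qed

lemma int_size_pos: "0 < int_size k"
  by (simp add: int_size_def)

lemma int_size_leI: "\<bar>k\<bar> < 2 ^ w \<Longrightarrow> int_size k \<le> Suc w"
  by (simp add: int_size_le_iff)

lemma int_sizeE:
  obtains a where "int_size k = Suc a" "\<bar>k\<bar> < 2 ^ a"
  using int_size_le_iff[of k "int_size k - 1"] int_size_pos[of k] by (metis Suc_pred' le_refl)

lemma int_size_add: "int_size (x + y) \<le> Suc (max (int_size x) (int_size y))"
proof -
  obtain a b where a: "int_size x = Suc a" "\<bar>x\<bar> < 2 ^ a" and b: "int_size y = Suc b" "\<bar>y\<bar> < 2 ^ b"
    by (metis int_sizeE)
  have "(2::int) ^ a \<le> 2 ^ max a b" "(2::int) ^ b \<le> 2 ^ max a b" by (auto intro: power_increasing)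
  then have "\<bar>x + y\<bar> < 2 * 2 ^ max a b" using a(2) b(2) by linarith
  then show ?thesis using int_size_leI[of "x + y" "Suc (max a b)"] a b by simp
qed

lemma int_size_uminus [simp]: "int_size (- x) = int_size x"
  by (simp add: int_size_def)

lemma int_size_diff: "int_size (x - y) \<le> Suc (max (int_size x) (int_size y))"
  using int_size_add[of x "- y"] by simp

lemma int_size_mult: "int_size (x * y) \<le> int_size x + int_size y"
proof -
  obtain a b where a: "int_size x = Suc a" "\<bar>x\<bar> < 2 ^ a" and b: "int_size y = Suc b" "\<bar>y\<bar> < 2 ^ b"
    by (metis int_sizeE)
  have "\<bar>x * y\<bar> < 2 ^ (a + b)" using a(2) b(2) by (simp add: abs_mult power_add mult_strict_mono')
  then show ?thesis using int_size_leI[of "x * y" "a + b"] a b by simp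
qed

lemma int_size_div: "int_size (x div y) \<le> int_size x"
proof -
  obtain a where a: "int_size x = Suc a" "\<bar>x\<bar> < 2 ^ a" by (rule int_sizeE)
  have "\<bar>x div y\<bar> \<le> \<bar>x\<bar>"
  proof (cases "y = 0")
    case False
    consider "0 < y" | "y < 0" using False by linarith
    then show ?thesis
    proof cases
      case 1
      have "x div y \<le> \<bar>x\<bar>" "- \<bar>x\<bar> \<le> x div y"
        using 1 by (smt (verit) div_by_1 pos_imp_zdiv_neg_iff zdiv_mono2 zdiv_mono2_neg pos_imp_zdiv_nonneg_iff)+
      then show ?thesis by simp
    next
      case 2
      have "(- x) div (- y) \<le> \<bar>x\<bar>" "- \<bar>x\<bar> \<le> (- x) div (- y)"
        using 2 by (smt (verit) div_by_1 pos_imp_zdiv_neg_iff zdiv_mono2 zdiv_mono2_neg pos_imp_zdiv_nonneg_iff)+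
      then show ?thesis by simp
    qed
  qed simp
  then show ?thesis using a int_size_leI[of "x div y" a] by simp
qed

section \<open>A loop language and its compilation\<close>

datatype prog = Asg vname aexp aexp | Sq prog prog (infixr ";;" 60) | Ite bexp prog prog | For vname aexp prog

abbreviation Var :: "vname \<Rightarrow> aexp" where "Var x \<equiv> Cell x (Const 0)"

definition set_var :: "store \<Rightarrow> vname \<Rightarrow> int \<Rightarrow> store" where
  "set_var s x k = s(x := (s x)(0 := k))"

primrec compile :: "prog \<Rightarrow> com" where
  "compile (Asg x i e) = Assign x i e"
| "compile (p ;; q) = Seq (compile p) (compile q)"
| "compile (Ite b p q) = Cond b (compile p) (compile q)"
| "compile (For x a p) = Seq (Assign x (Const 0) (Const 0))
     (While (Less (Var x) a) (Seq (compile p) (Assign x (Const 0) (Plus (Var x) (Const 1)))))"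

text \<open>The bound of a \<open>For\<close> is evaluated once here but before every round in the
  compiled code. The two agree for well-formed programs, whose bounds read only the input array,
  which is never written.\<close>

primrec eval :: "prog \<Rightarrow> store \<Rightarrow> store" where
  "eval (Asg x i e) = (\<lambda>s. s(x := (s x)(aval i s := aval e s)))"
| "eval (p ;; q) = (\<lambda>s. eval q (eval p s))"
| "eval (Ite b p q) = (\<lambda>s. if bval b s then eval p s else eval q s)"
| "eval (For x a p) = (\<lambda>s. set_var (fold (\<lambda>i s. eval p (set_var s x (int i))) [0..<nat (aval a s)] s) x
     (int (nat (aval a s))))"

primrec written :: "prog \<Rightarrow> vname set" where
  "written (Asg x i e) = {x}"
| "written (p ;; q) = written p \<union> written q"
| "written (Ite b p q) = written p \<union> written q"
| "written (For x a p) = insert x (written p)"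

fun input_only :: "aexp \<Rightarrow> bool" where
  "input_only (Const k) = True"
| "input_only (Cell x a) = (x = ''in'' \<and> input_only a)"
| "input_only (Plus a b) = (input_only a \<and> input_only b)"
| "input_only (Minus a b) = (input_only a \<and> input_only b)"
| "input_only (Mult a b) = (input_only a \<and> input_only b)"
| "input_only (Quot a b) = (input_only a \<and> input_only b)"

text \<open>Expressions whose value exceeds the largest stored value by only linearly many bits. Products
  are restricted to one factor from the input, since repeated squaring would be exponential.\<close>

fun safe :: "aexp \<Rightarrow> bool" where
  "safe (Const k) = True"
| "safe (Cell x a) = True"
| "safe (Plus a b) = (safe a \<and> safe b)"
| "safe (Minus a b) = (safe a \<and> safe b)"
| "safe (Mult a (Cell x b)) = (safe a \<and> x = ''in'')"
| "safe (Mult a b) = False"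
| "safe (Quot a b) = safe a"

primrec well_formed :: "prog \<Rightarrow> bool" where
  "well_formed (Asg x i e) = (x \<noteq> ''in'' \<and> safe e)"
| "well_formed (p ;; q) = (well_formed p \<and> well_formed q)"
| "well_formed (Ite b p q) = (well_formed p \<and> well_formed q)"
| "well_formed (For x a p) = (x \<noteq> ''in'' \<and> x \<notin> written p \<and> input_only a \<and> well_formed p)"

primrec bounds :: "prog \<Rightarrow> aexp set" where
  "bounds (Asg x i e) = {}"
| "bounds (p ;; q) = bounds p \<union> bounds q"
| "bounds (Ite b p q) = bounds p \<union> bounds q"
| "bounds (For x a p) = insert a (bounds p)"

text \<open>Measures both value size and evaluation cost relative to a bound on all cell sizes; the
  doubling pays for the operands, which the cost model charges in addition to their
  evaluation.\<close>

fun weight :: "aexp \<Rightarrow> nat" where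
  "weight (Const k) = int_size k"
| "weight (Cell x a) = 2 * weight a + 1"
| "weight (Plus a b) = 2 * weight a + 2 * weight b"
| "weight (Minus a b) = 2 * weight a + 2 * weight b"
| "weight (Mult a b) = 2 * weight a + 2 * weight b"
| "weight (Quot a b) = 2 * weight a + 2 * weight b"

fun bweight :: "bexp \<Rightarrow> nat" where
  "bweight (Less a b) = 2 * weight a + 2 * weight b"
| "bweight (Neg b) = Suc (bweight b)"
| "bweight (Conj b c) = Suc (bweight b + bweight c)"

text \<open>Counts by how many multiples of the input size a safe expression may exceed the largest
  stored value. A product adds one, since its second factor is an input cell.\<close>

fun growth :: "aexp \<Rightarrow> nat" where
  "growth (Const k) = int_size k"
| "growth (Cell x a) = 0"
| "growth (Plus a b) = Suc (growth a + growth b)"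
| "growth (Minus a b) = Suc (growth a + growth b)"
| "growth (Mult a b) = Suc (growth a)"
| "growth (Quot a b) = growth a"

lemma eval_unwritten: "x \<notin> written p \<Longrightarrow> eval p s x = s x"
proof (induction p arbitrary: s)
  case (For y a p)
  have "fold (\<lambda>i s. eval p (set_var s y (int i))) is s x = s x" for "is"
    by (induction "is" arbitrary: s) (use For in \<open>auto simp: set_var_def\<close>)
  then show ?case using For by (simp add: set_var_def)
qed auto

lemma in_unwritten: "well_formed p \<Longrightarrow> ''in'' \<notin> written p"
  by (induction p) auto

lemma input_only_cong: "input_only a \<Longrightarrow> s ''in'' = s' ''in'' \<Longrightarrow> aval a s = aval a s'"
  by (induction a) auto

lemma weight_bound:
  assumes "\<And>x i. int_size (s x i) \<le> B" "0 < B"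
  shows "int_size (aval a s) \<le> weight a * B" "acost a s \<le> weight a * B"
proof -
  have "int_size (aval a s) \<le> weight a * B \<and> acost a s \<le> weight a * B"
  proof (induction a)
    case (Const k)
    then show ?case using assms(2) by simp
  next
    case (Cell x a)
    then show ?case using assms(1)[of x "aval a s"] by (simp add: algebra_simps)
  next
    case (Plus a b)
    then show ?case using int_size_add[of "aval a s" "aval b s"] int_size_pos[of "aval a s"] int_size_pos[of "aval b s"]
      by (auto simp: operand_cost_def algebra_simps max_def split: if_splits)
  next
    case (Minus a b)
    then show ?case using int_size_diff[of "aval a s" "aval b s"] int_size_pos[of "aval a s"] int_size_pos[of "aval b s"]
      by (auto simp: operand_cost_def algebra_simps max_def split: if_splits)
  next
    case (Mult a b)
    then show ?case using int_size_mult[of "aval a s" "aval b s"] by (simp add: operand_cost_def algebra_simps)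
  next
    case (Quot a b)
    then show ?case using int_size_div[of "aval a s" "aval b s"] by (simp add: operand_cost_def algebra_simps)
  qed
  then show "int_size (aval a s) \<le> weight a * B" "acost a s \<le> weight a * B" by auto
qed

lemma bweight_bound:
  assumes "\<And>x i. int_size (s x i) \<le> B" "0 < B"
  shows "bcost b s \<le> bweight b * B"
proof (induction b)
  case (Less a b)
  show ?case using weight_bound[where s = s, OF assms, of a] weight_bound[where s = s, OF assms, of b]
    by (simp add: operand_cost_def algebra_simps)
qed (use assms(2) in \<open>auto simp: algebra_simps\<close>)

lemma growth_bound:
  assumes "\<And>x i. int_size (s x i) \<le> B" "\<And>i. int_size (s ''in'' i) \<le> S" "0 < S"
  shows "safe a \<Longrightarrow> int_size (aval a s) \<le> B + growth a * S"
proof (induction a rule: safe.induct)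
  case (1 k)
  then show ?case using assms(3) by (simp add: trans_le_add2)
next
  case (3 a b)
  then show ?case using assms(3) int_size_add[of "aval a s" "aval b s"] by (simp add: algebra_simps max_def split: if_splits)
next
  case (4 a b)
  then show ?case using assms(3) int_size_diff[of "aval a s" "aval b s"] by (simp add: algebra_simps max_def split: if_splits)
next
  case (5 a x b)
  then show ?case using assms(2)[of "aval b s"] int_size_mult[of "aval a s" "s x (aval b s)"] by (simp add: algebra_simps)
next
  case (7 a b)
  then show ?case using int_size_div[of "aval a s" "aval b s"] by simp
qed (use assms(1) in auto)

definition assign_bound :: "aexp \<Rightarrow> aexp \<Rightarrow> nat" where
  "assign_bound i e = 2 * weight i + 2 * weight e + growth e"

primrec step_bound :: "prog \<Rightarrow> nat \<Rightarrow> nat" where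
  "step_bound (Asg x i e) = (\<lambda>W. assign_bound i e)"
| "step_bound (p ;; q) = (\<lambda>W. step_bound p W + step_bound q W)"
| "step_bound (Ite b p q) = (\<lambda>W. bweight b + (step_bound p W + step_bound q W))"
| "step_bound (For x a p) = (\<lambda>W.
     assign_bound (Const 0) (Const 0) + (bweight (Less (Var x) a) +
     W * (bweight (Less (Var x) a) + (step_bound p W + assign_bound (Const 0) (Plus (Var x) (Const 1))))))"

lemma step_bound_poly: "\<exists>q :: nat poly. \<forall>W. step_bound p W = poly q W"
proof (induction p)
  case (Asg x i e)
  show ?case by (intro exI[of _ "[:assign_bound i e:]"]) simp
next
  case (Sq p q)
  then obtain a b :: "nat poly" where "\<forall>W. step_bound p W = poly a W" "\<forall>W. step_bound q W = poly b W" by blast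
  then show ?case by (intro exI[of _ "a + b"]) simp
next
  case (Ite c p q)
  then obtain a b :: "nat poly" where "\<forall>W. step_bound p W = poly a W" "\<forall>W. step_bound q W = poly b W" by blast
  then show ?case by (intro exI[of _ "[:bweight c:] + (a + b)"]) simp
next
  case (For x e p)
  then obtain a :: "nat poly" where "\<forall>W. step_bound p W = poly a W" by blast
  then show ?case
    by (intro exI[of _ "[:assign_bound (Const 0) (Const 0):] + ([:bweight (Less (Var x) e):] +
      [:0, 1:] * ([:bweight (Less (Var x) e):] + (a + [:assign_bound (Const 0) (Plus (Var x) (Const 1)):])))"])
      simp
qed

text \<open>A single \<open>k\<close> controls time and growth. Growth is additive, by
  \<open>k * S\<close> bits, so composition adds the values of \<open>k\<close> and a loop
  multiplies by its number of rounds; growth by a factor of \<open>B\<close> would become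
  exponential under iteration.\<close>

definition runs :: "nat \<Rightarrow> com \<Rightarrow> store \<Rightarrow> store \<Rightarrow> nat \<Rightarrow> nat \<Rightarrow> bool" where
  "runs S c s s' k B \<longleftrightarrow> (\<exists>t. exec c s t s' \<and> t \<le> k * (B + k * S)) \<and> (\<forall>x i. int_size (s' x i) \<le> B + k * S)"

lemma runs_Seq:
  assumes "runs S c s s1 k1 B" "runs S c' s1 s2 k2 (B + k1 * S)"
  shows "runs S (Seq c c') s s2 (k1 + k2) B"
proof -
  obtain t1 t2 where t: "exec c s t1 s1" "t1 \<le> k1 * (B + k1 * S)"
    "exec c' s1 t2 s2" "t2 \<le> k2 * (B + k1 * S + k2 * S)"
    using assms by (auto simp: runs_def)
  have "t1 + t2 \<le> (k1 + k2) * (B + (k1 + k2) * S)" using t(2,4) by (simp add: algebra_simps)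
  then show ?thesis using exec.Seq[OF t(1,3)] assms(2) by (auto simp: runs_def algebra_simps)
qed

lemma runs_weaken: "runs S c s s' k B \<Longrightarrow> k \<le> k' \<Longrightarrow> runs S c s s' k' B"
  unfolding runs_def by (meson add_left_mono mult_le_mono mult_le_mono1 order_trans)

lemma runs_Assign:
  assumes "\<And>x i. int_size (s x i) \<le> B" "0 < B" "\<And>i. int_size (s ''in'' i) \<le> S" "0 < S" "safe e"
  shows "runs S (Assign x i e) s (s(x := (s x)(aval i s := aval e s))) (assign_bound i e) B"
proof -
  let ?k = "2 * weight i + 2 * weight e + growth e"
  have "acost i s + acost e s + operand_cost i e s \<le> (2 * weight i + 2 * weight e) * B"
    using weight_bound[where s = s, OF assms(1,2), of i] weight_bound[where s = s, OF assms(1,2), of e]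
    by (simp add: operand_cost_def algebra_simps)
  also have "\<dots> \<le> ?k * (B + ?k * S)" by (intro mult_le_mono) auto
  finally have t: "acost i s + acost e s + operand_cost i e s \<le> ?k * (B + ?k * S)" .
  have "int_size (aval e s) \<le> B + growth e * S" using growth_bound[where s = s, OF assms(1,3,4,5)] .
  also have "\<dots> \<le> B + ?k * S" by (intro add_left_mono mult_le_mono) auto
  finally have "int_size (aval e s) \<le> B + ?k * S" .
  moreover have "int_size (s y j) \<le> B + ?k * S" for y j using assms(1) by (rule trans_le_add1)
  ultimately show ?thesis unfolding runs_def assign_bound_def using t exec.Assign[of x i e s] by auto
qed

lemma runs_test:
  assumes "\<And>x i. int_size (s x i) \<le> B" "0 < B" "runs S c s s' k B"
    "\<And>t. exec c s t s' \<Longrightarrow> exec c' s (bcost b s + t) s'"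
  shows "runs S c' s s' (bweight b + k) B"
proof -
  obtain t where t: "exec c s t s'" "t \<le> k * (B + k * S)" using assms(3) by (auto simp: runs_def)
  have "bcost b s + t \<le> (bweight b + k) * (B + (bweight b + k) * S)"
    using t(2) bweight_bound[where s = s, OF assms(1,2), of b] by (simp add: algebra_simps)
  moreover have "int_size (s' x i) \<le> B + (bweight b + k) * S" for x i
  proof -
    have "int_size (s' x i) \<le> B + k * S" using assms(3) by (simp add: runs_def)
    then show ?thesis by (simp add: algebra_simps)
  qed
  ultimately show ?thesis unfolding runs_def using assms(4)[OF t(1)] by auto
qed

lemma runs_compile:
  assumes "well_formed p" "s ''in'' = inp" "\<And>i. int_size (inp i) \<le> S" "0 < S"
    "\<And>a s'. a \<in> bounds p \<Longrightarrow> s' ''in'' = inp \<Longrightarrow> aval a s' \<le> int W"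
    "\<And>x i. int_size (s x i) \<le> B" "0 < B"
  shows "runs S (compile p) s (eval p s) (step_bound p W) B"
  using assms(1,2,5-)
proof (induction p arbitrary: s B)
  case (Asg x i e)
  then have "runs S (Assign x i e) s (s(x := (s x)(aval i s := aval e s))) (assign_bound i e) B"
    using assms(3,4) by (intro runs_Assign) auto
  then show ?case by (simp only: eval.simps compile.simps step_bound.simps)
next
  case (Sq p q)
  have inp: "eval p s ''in'' = inp"
    using eval_unwritten in_unwritten Sq.prems by simp
  have 1: "runs S (compile p) s (eval p s) (step_bound p W) B" using Sq.prems by (intro Sq.IH(1)) auto
  have "runs S (compile q) (eval p s) (eval q (eval p s)) (step_bound q W) (B + step_bound p W * S)"
    using Sq.prems 1 inp by (intro Sq.IH(2)) (auto simp: runs_def)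
  then show ?case using runs_Seq[OF 1] by simp
next
  case (Ite b p q)
  show ?case
  proof (cases "bval b s")
    case True
    have "runs S (compile p) s (eval p s) (step_bound p W) B" using Ite.prems by (intro Ite.IH(1)) auto
    then have "runs S (compile p) s (eval p s) (step_bound p W + step_bound q W) B" by (rule runs_weaken) simp
    then show ?thesis using True Ite.prems
      by (auto intro!: runs_test[where c = "compile p"] exec.IfTrue)
  next
    case False
    have "runs S (compile q) s (eval q s) (step_bound q W) B" using Ite.prems by (intro Ite.IH(2)) auto
    then have "runs S (compile q) s (eval q s) (step_bound p W + step_bound q W) B" by (rule runs_weaken) simp
    then show ?thesis using False Ite.prems
      by (auto intro!: runs_test[where c = "compile q"] exec.IfFalse)
  qed
next
  case (For x a p)
  define m where "m = nat (aval a s)"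
  define F where "F = (\<lambda>k. fold (\<lambda>i s. eval p (set_var s x (int i))) [0..<k] s)"
  \<comment> \<open>The store at the loop test before round \<open>k\<close>.\<close>
  define sg where "sg = (\<lambda>k. set_var (F k) x (int k))"
  define wl where "wl = bweight (Less (Var x) a)"
  define inc where "inc = Assign x (Const 0) (Plus (Var x) (Const 1))"
  define ki where "ki = assign_bound (Const 0) (Plus (Var x) (Const 1))"
  have xin: "x \<noteq> ''in''" "x \<notin> written p" "input_only a" "well_formed p" using For.prems by auto
  have F_Suc: "F (Suc k) = eval p (sg k)" for k by (simp add: F_def sg_def)
  have sg_x: "sg k x 0 = int k" for k by (simp add: sg_def set_var_def)
  have sg_in: "sg k ''in'' = inp" for k
  proof (induction k)
    case 0
    then show ?case using For.prems xin by (simp add: sg_def F_def set_var_def)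
  next
    case (Suc k)
    then show ?case using F_Suc[of k] eval_unwritten[OF in_unwritten[OF xin(4)]] xin by (simp add: sg_def set_var_def)
  qed
  have bound: "aval a s' = aval a s" if "s' ''in'' = inp" for s'
    using input_only_cong[OF xin(3), of s' s] that For.prems by simp
  have less: "bval (Less (Var x) a) (sg k) \<longleftrightarrow> k < m" for k
    using bound[where s' = "sg k", OF sg_in[of k]] sg_x[of k] by (auto simp: m_def)
  have m: "m \<le> W" using For.prems(3)[of a s] For.prems(2) by (simp add: m_def)
  \<comment> \<open>Induction on the number of remaining rounds; the size bound \<open>B'\<close>
    has to vary because each round enlarges it.\<close>
  have loop: "runs S (While (Less (Var x) a) (Seq (compile p) inc)) (sg k) (sg m)
      (wl + (m - k) * (wl + (step_bound p W + ki))) B'"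
    if "k \<le> m" "\<And>x i. int_size (sg k x i) \<le> B'" "0 < B'" for k B'
    using that
  proof (induction "m - k" arbitrary: k B')
    case 0
    then have k: "k = m" by simp
    have "exec (While (Less (Var x) a) (Seq (compile p) inc)) (sg k) (bcost (Less (Var x) a) (sg k)) (sg m)"
      using exec.WhileFalse[of "Less (Var x) a" "sg k"] less[of k] k by simp
    moreover have "bcost (Less (Var x) a) (sg k) \<le> wl * (B' + wl * S)"
    proof -
      have "bcost (Less (Var x) a) (sg k) \<le> wl * B'" unfolding wl_def using 0 by (intro bweight_bound) auto
      also have "\<dots> \<le> wl * (B' + wl * S)" by (intro mult_le_mono2) simp
      finally show ?thesis .
    qed
    moreover have "int_size (sg m x i) \<le> B' + wl * S" for x i using 0(3)[of x i] k by simp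
    ultimately show ?case using k by (auto simp: runs_def)
  next
    case (Suc r)
    then have k: "k < m" by simp
    have 1: "runs S (compile p) (sg k) (F (Suc k)) (step_bound p W) B'"
      unfolding F_Suc using Suc.prems sg_in xin For.prems by (intro For.IH) auto
    have Fx: "F (Suc k) x 0 = int k" "F (Suc k) ''in'' = inp"
      using eval_unwritten[OF xin(2)] eval_unwritten[OF in_unwritten[OF xin(4)]] sg_x sg_in by (simp_all add: F_Suc)
    have "runs S inc (F (Suc k)) ((F (Suc k))(x := (F (Suc k) x)(aval (Const 0) (F (Suc k)) := aval (Plus (Var x) (Const 1)) (F (Suc k)))))
        (assign_bound (Const 0) (Plus (Var x) (Const 1))) (B' + step_bound p W * S)"
      unfolding inc_def using 1 Suc.prems Fx assms(3,4) by (intro runs_Assign) (auto simp: runs_def)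
    then have 2: "runs S inc (F (Suc k)) (sg (Suc k)) ki (B' + step_bound p W * S)"
      using Fx by (simp add: ki_def sg_def set_var_def add.commute)
    have 3: "runs S (Seq (compile p) inc) (sg k) (sg (Suc k)) (step_bound p W + ki) B'"
      using runs_Seq[OF 1 2] .
    have 4: "runs S (While (Less (Var x) a) (Seq (compile p) inc)) (sg (Suc k)) (sg m)
      (wl + (m - Suc k) * (wl + (step_bound p W + ki))) (B' + (step_bound p W + ki) * S)"
      using Suc.hyps Suc.prems k 3 by (intro Suc.hyps) (auto simp: runs_def)
    have "runs S (Seq (Seq (compile p) inc) (While (Less (Var x) a) (Seq (compile p) inc))) (sg k) (sg m)
      (step_bound p W + ki + (wl + (m - Suc k) * (wl + (step_bound p W + ki)))) B'"
      using runs_Seq[OF 3 4] .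
    then have "runs S (While (Less (Var x) a) (Seq (compile p) inc)) (sg k) (sg m)
      (wl + (step_bound p W + ki + (wl + (m - Suc k) * (wl + (step_bound p W + ki))))) B'"
      unfolding wl_def
    proof (rule runs_test[rotated 2])
      fix t assume "exec (Seq (Seq (compile p) inc) (While (Less (Var x) a) (Seq (compile p) inc))) (sg k) t (sg m)"
      then obtain t1 t2 s1 where e: "exec (Seq (compile p) inc) (sg k) t1 s1"
        "exec (While (Less (Var x) a) (Seq (compile p) inc)) s1 t2 (sg m)" "t = t1 + t2" by (rule exec_SeqE)
      then show "exec (While (Less (Var x) a) (Seq (compile p) inc)) (sg k) (bcost (Less (Var x) a) (sg k) + t) (sg m)"
        using exec.WhileTrue[OF _ e(1,2)] less[of k] k by (simp add: add.assoc)
    qed (use Suc.prems in auto)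
    moreover have "m - k = Suc (m - Suc k)" using k by simp
    ultimately show ?case by (simp add: algebra_simps)
  qed
  have "runs S (Assign x (Const 0) (Const 0)) s (s(x := (s x)(aval (Const 0) s := aval (Const 0) s)))
      (assign_bound (Const 0) (Const 0)) B"
    using For.prems assms(3,4) by (intro runs_Assign) auto
  then have 1: "runs S (Assign x (Const 0) (Const 0)) s (sg 0) (assign_bound (Const 0) (Const 0)) B"
    by (simp add: sg_def F_def set_var_def)
  have "runs S (While (Less (Var x) a) (Seq (compile p) inc)) (sg 0) (sg m)
      (wl + (m - 0) * (wl + (step_bound p W + ki))) (B + assign_bound (Const 0) (Const 0) * S)"
    using 1 For.prems by (intro loop) (auto simp: runs_def)
  then have 2: "runs S (While (Less (Var x) a) (Seq (compile p) inc)) (sg 0) (sg m)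
      (wl + W * (wl + (step_bound p W + ki))) (B + assign_bound (Const 0) (Const 0) * S)"
    by (rule runs_weaken) (use m in simp)
  have "eval (For x a p) s = sg m" by (simp add: sg_def F_def m_def)
  then show ?case using runs_Seq[OF 1 2] by (simp add: inc_def wl_def ki_def)
qed

text \<open>Initially the input array has sizes at most \<open>L + 1\<close> and all cells,
  including the stored input length, at most \<open>L + 2\<close>. The constant \<open>K\<close>
  admits loop bounds slightly above the input length.\<close>

lemma polytime_on_compile:
  assumes p: "well_formed p"
    and bounds: "\<And>x a s. x \<in> D \<Longrightarrow> a \<in> bounds p \<Longrightarrow> s ''in'' = input_store (enc x) ''in'' \<Longrightarrow>
      aval a s \<le> int (length (enc x) + K)"
    and out: "\<And>x. x \<in> D \<Longrightarrow> output_of (eval p (input_store (enc x))) = enc' (f x)"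
  shows "polytime_on D enc enc' f"
proof -
  obtain q :: "nat poly" where q: "\<And>W. step_bound p W = poly q W" using step_bound_poly by blast
  define q1 where "q1 = pcompose q [:K, 1:]"
  \<comment> \<open>This is \<open>k * (B + k * S)\<close> from \<open>runs\<close>, with
    \<open>k\<close> given by \<open>q1\<close>, \<open>B = L + 2\<close> and
    \<open>S = L + 1\<close>.\<close>
  define q2 where "q2 = q1 * ([:2, 1:] + q1 * [:1, 1:])"
  show ?thesis
    unfolding polytime_on_def
  proof (rule exI[of _ "compile p"], rule exI[of _ q2], rule ballI)
    fix x assume x: "x \<in> D"
    define ks where "ks = enc x"
    define L where "L = list_size ks"
    have len: "length ks \<le> L"
      unfolding L_def list_size_def by (induction ks) (auto simp: int_size_def)
    have elem: "int_size k \<le> L" if "k \<in> set ks" for k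
      using that unfolding L_def list_size_def by (induction ks) auto
    have "int_size (int (length ks)) \<le> Suc (length ks)"
    proof (rule int_size_leI)
      have "int (length ks) < int (2 ^ length ks)" by (simp only: of_nat_less_iff less_exp)
      then show "\<bar>int (length ks)\<bar> < 2 ^ length ks" by simp
    qed
    then have l: "int_size (int (length ks)) \<le> L + 2" using len by simp
    have z: "int_size 0 = 1" by (simp add: int_size_def floorlog_def)
    have cells: "int_size (input_store ks y i) \<le> L + 2" for y i
      using elem[of "ks ! nat i"] l z by (auto simp: input_store_def nth_mem)
    have inp: "int_size (input_store ks ''in'' i) \<le> L + 1" for i
      using elem[of "ks ! nat i"] z by (auto simp: input_store_def nth_mem)
    have "runs (L + 1) (compile p) (input_store ks) (eval p (input_store ks)) (step_bound p (L + K)) (L + 2)"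
    proof (rule runs_compile[where s = "input_store ks", OF p refl inp])
      fix a s' assume "a \<in> bounds p" "s' ''in'' = input_store ks ''in''"
      then have "aval a s' \<le> int (length ks + K)" using bounds[OF x] by (simp add: ks_def)
      then show "aval a s' \<le> int (L + K)" using len by simp
    qed (use cells in auto)
    then obtain t where t: "exec (compile p) (input_store ks) t (eval p (input_store ks))"
      "t \<le> step_bound p (L + K) * (L + 2 + step_bound p (L + K) * (L + 1))"
      by (auto simp: runs_def)
    have "poly q1 L = step_bound p (L + K)" by (simp add: q1_def q poly_pcompose add.commute)
    then have "t \<le> poly q2 L" using t(2) by (simp add: q2_def add.commute mult.commute)
    then show "\<exists>t s. exec (compile p) (input_store (enc x)) t s \<and>
        t \<le> poly q2 (list_size (enc x)) \<and> output_of s = enc' (f x)"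
      using t(1) out[OF x] unfolding ks_def L_def by blast
  qed
qed

section \<open>A program for the algorithm\<close>

definition agree :: "vname set \<Rightarrow> store \<Rightarrow> store \<Rightarrow> bool" where
  "agree W s s' \<longleftrightarrow> (\<forall>y. y \<notin> W \<longrightarrow> s' y = s y)"

lemma agreeD: "agree W s s' \<Longrightarrow> y \<notin> W \<Longrightarrow> s' y = s y"
  by (simp add: agree_def)

lemma agree_eval: "agree (written p) s (eval p s)"
  by (simp add: agree_def eval_unwritten)

lemma set_var_simps [simp]: "set_var s x k x 0 = k" "y \<noteq> x \<Longrightarrow> set_var s x k y = s y"
  "i \<noteq> 0 \<Longrightarrow> set_var s x k x i = s x i"
  by (auto simp: set_var_def)

text \<open>Variables the loop does not write are available to the body through
  \<open>agree\<close>, so \<open>I\<close> need not mention them. The invariant must survive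
  changes of the counter, which is set before each round and once more at the end.\<close>

lemma for_rule:
  assumes a: "aval a s0 = int m" and x: "x \<notin> written p"
    and I0: "I 0 s0"
    and upd: "\<And>k s j. I k s \<Longrightarrow> I k (set_var s x j)"
    and body: "\<And>k s. k < m \<Longrightarrow> agree (insert x (written p)) s0 s \<Longrightarrow> I k s \<Longrightarrow> s x 0 = int k \<Longrightarrow>
      I (Suc k) (eval p s)"
  shows "I m (eval (For x a p) s0)"
proof -
  define F where "F = (\<lambda>k. fold (\<lambda>i s. eval p (set_var s x (int i))) [0..<k] s0)"
  have "k \<le> m \<Longrightarrow> I k (F k) \<and> agree (insert x (written p)) s0 (F k)" for k
  proof (induction k)
    case 0
    show ?case using I0 by (simp add: F_def agree_def)
  next
    case (Suc k)
    let ?s = "set_var (F k) x (int k)"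
    have "agree (insert x (written p)) s0 ?s" using Suc by (auto simp: agree_def set_var_def)
    moreover have "I k ?s" using Suc upd by simp
    ultimately have "I (Suc k) (eval p ?s)" using body[of k ?s] Suc.prems by simp
    moreover have "agree (insert x (written p)) s0 (eval p ?s)"
      using \<open>agree _ s0 ?s\<close> eval_unwritten[of _ p ?s] by (auto simp: agree_def)
    moreover have "F (Suc k) = eval p ?s" by (simp add: F_def)
    ultimately show ?case by simp
  qed
  from this[of m] have "I m (set_var (F m) x (int m))" using upd by simp
  then show ?thesis by (simp add: a F_def)
qed

text \<open>The loop language has no skip, so a dummy variable is written.\<close>

definition Nop :: prog where "Nop = Asg ''nop'' (Const 0) (Const 0)"

definition sum_loop :: "vname \<Rightarrow> vname \<Rightarrow> aexp \<Rightarrow> bexp \<Rightarrow> aexp \<Rightarrow> prog" where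
  "sum_loop acc i a g e = Asg acc (Const 0) (Const 0) ;;
     For i a (Ite g (Asg acc (Const 0) (Plus (Var acc) e)) Nop)"

text \<open>Mirrors \<open>argmin_upto\<close>, with -1 for no candidate and a strict comparison, so
  that the first minimum wins. The nested negations express the disjunction of \<open>b < 0\<close>
  and \<open>e < v\<close>. The minimum itself is kept in \<open>v\<close>.\<close>

definition min_loop :: "vname \<Rightarrow> vname \<Rightarrow> vname \<Rightarrow> aexp \<Rightarrow> bexp \<Rightarrow> aexp \<Rightarrow> prog" where
  "min_loop b v i a g e = Asg b (Const 0) (Const (-1)) ;; Asg v (Const 0) (Const 0) ;;
     For i a (Ite (Conj g (Neg (Conj (Neg (Less (Var b) (Const 0))) (Neg (Less e (Var v))))))
       (Asg b (Const 0) (Var i) ;; Asg v (Const 0) e) Nop)"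

lemma written_loops [simp]:
  "written Nop = {''nop''}"
  "written (sum_loop acc i a g e) = {acc, i, ''nop''}"
  "written (min_loop b v i a g e) = {b, v, i, ''nop''}"
  by (auto simp: Nop_def sum_loop_def min_loop_def)

lemma eval_Nop [simp]: "eval Nop s = set_var s ''nop'' 0"
  by (simp add: Nop_def set_var_def)

lemma eval_sum_loop:
  assumes "distinct [acc, i, ''nop'', ''in'']" "input_only a" "aval a s = int m"
    and body: "\<And>k s'. k < m \<Longrightarrow> agree {acc, i, ''nop''} s s' \<Longrightarrow> s' i 0 = int k \<Longrightarrow>
      bval g s' = G k \<and> (G k \<longrightarrow> aval e s' = E k)"
  shows "eval (sum_loop acc i a g e) s acc 0 = (\<Sum>k | k < m \<and> G k. E k)"
proof -
  let ?s = "s(acc := (s acc)(0 := 0))"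
  let ?p = "Ite g (Asg acc (Const 0) (Plus (Var acc) e)) Nop"
  have a: "aval a ?s = int m" using input_only_cong[OF assms(2), of ?s s] assms(1,3) by auto
  have "eval (For i a ?p) ?s acc 0 = (\<Sum>k | k < m \<and> G k. E k)"
  proof (rule for_rule[where I = "\<lambda>k s. s acc 0 = (\<Sum>j | j < k \<and> G j. E j)", OF a])
    fix k s' assume k: "k < m" "agree (insert i (written ?p)) ?s s'" "s' acc 0 = (\<Sum>j | j < k \<and> G j. E j)" "s' i 0 = int k"
    have "agree {acc, i, ''nop''} s s'" using k(2) by (auto simp: agree_def)
    then have b: "bval g s' = G k" "G k \<Longrightarrow> aval e s' = E k" using body k by auto
    have "{j. j < Suc k \<and> G j} = (if G k then insert k {j. j < k \<and> G j} else {j. j < k \<and> G j})"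
      by (auto simp: less_Suc_eq)
    then show "eval ?p s' acc 0 = (\<Sum>j | j < Suc k \<and> G j. E j)" using b k assms by auto
  qed (use assms in auto)
  then show ?thesis by (simp add: sum_loop_def)
qed

lemma eval_min_loop:
  assumes "distinct [b, v, i, ''nop'', ''in'']" "input_only a" "aval a s = int m"
    and body: "\<And>k s'. k < m \<Longrightarrow> agree {b, v, i, ''nop''} s s' \<Longrightarrow> s' i 0 = int k \<Longrightarrow>
      bval g s' = G k \<and> (G k \<longrightarrow> aval e s' = E k)"
  shows "eval (min_loop b v i a g e) s b 0 = argmin_upto G E m"
    and "0 \<le> argmin_upto G E m \<Longrightarrow> eval (min_loop b v i a g e) s v 0 = E (nat (argmin_upto G E m))"
proof -
  let ?s = "s(b := (s b)(0 := -1), v := (s v)(0 := 0))"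
  let ?p = "Ite (Conj g (Neg (Conj (Neg (Less (Var b) (Const 0))) (Neg (Less e (Var v))))))
       (Asg b (Const 0) (Var i) ;; Asg v (Const 0) e) Nop"
  let ?I = "\<lambda>k s. s b 0 = argmin_upto G E k \<and> (0 \<le> argmin_upto G E k \<longrightarrow> s v 0 = E (nat (argmin_upto G E k)))"
  have a: "aval a ?s = int m" using input_only_cong[OF assms(2), of ?s s] assms(1,3) by auto
  have "?I m (eval (For i a ?p) ?s)"
  proof (rule for_rule[where I = ?I, OF a])
    fix k s' assume k: "k < m" "agree (insert i (written ?p)) ?s s'" "?I k s'" "s' i 0 = int k"
    have ag: "agree {b, v, i, ''nop''} s s'" using k(2) by (auto simp: agree_def)
    have B: "bval g s' = G k" "G k \<Longrightarrow> aval e s' = E k" using body[OF k(1) ag k(4)] by auto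
    \<comment> \<open>The expression \<open>e\<close> is evaluated again after \<open>b\<close> has
      been overwritten, so the hypothesis on the body is needed for this store, too.\<close>
    let ?s' = "s'(b := (s' b)(0 := int k))"
    have "agree {b, v, i, ''nop''} s ?s'" "?s' i 0 = int k" using ag k(4) assms(1) by (auto simp: agree_def)
    then have B': "G k \<Longrightarrow> aval e ?s' = E k" using body[OF k(1), of ?s'] by auto
    show "?I (Suc k) (eval ?p s')"
      using B B' k(3,4) assms(1) by (auto simp: Let_def not_le not_less)
  qed (use assms in auto)
  moreover have "eval (min_loop b v i a g e) s = eval (For i a ?p) ?s"
    using assms(1) by (simp add: min_loop_def del: eval.simps(4))
  ultimately show "eval (min_loop b v i a g e) s b 0 = argmin_upto G E m"
    "0 \<le> argmin_upto G E m \<Longrightarrow> eval (min_loop b v i a g e) s v 0 = E (nat (argmin_upto G E m))"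
    by simp_all
qed

section \<open>Layout of the input array\<close>

abbreviation nE :: aexp where "nE \<equiv> Cell ''in'' (Const 0)"
abbreviation sqE :: aexp where "sqE \<equiv> Mult nE nE"
abbreviation leE :: "aexp \<Rightarrow> aexp \<Rightarrow> bexp" where "leE a b \<equiv> Neg (Less b a)"

text \<open>The offsets follow \<open>encode_input\<close>: one cell for \<open>n\<close>,
  \<open>n * n\<close> edge flags, \<open>2 * n * n\<close> cells for distances, \<open>n\<close>
  facility flags, \<open>2 * n\<close> cells for costs, \<open>n\<close> prediction flags, the
  number of arrivals, the arrivals.\<close>

definition pairE :: "aexp \<Rightarrow> aexp \<Rightarrow> aexp" where "pairE a b = Plus (Mult a nE) b"
definition numE :: "aexp \<Rightarrow> aexp \<Rightarrow> aexp" where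
  "numE a b = Plus (Plus (Const 1) sqE) (Mult (Const 2) (pairE a b))"
definition facE :: "aexp \<Rightarrow> aexp" where
  "facE a = Plus (Plus (Const 1) (Mult (Const 3) sqE)) a"
definition cnumE :: "aexp \<Rightarrow> aexp" where
  "cnumE a = Plus (Plus (Plus (Const 1) (Mult (Const 3) sqE)) nE) (Mult (Const 2) a)"
definition xhE :: "aexp \<Rightarrow> aexp" where
  "xhE a = Plus (Plus (Plus (Const 1) (Mult (Const 3) sqE)) (Mult (Const 3) nE)) a"
definition lenE :: aexp where
  "lenE = Plus (Plus (Const 1) (Mult (Const 3) sqE)) (Mult (Const 4) nE)"
definition clientE :: "aexp \<Rightarrow> aexp" where
  "clientE a = Plus (Plus lenE (Const 1)) a"

definition pair_index :: "int \<Rightarrow> int \<Rightarrow> int \<Rightarrow> int" where "pair_index n a b = a * n + b"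
definition num_index :: "int \<Rightarrow> int \<Rightarrow> int \<Rightarrow> int" where "num_index n a b = 1 + n * n + 2 * pair_index n a b"
definition fac_index :: "int \<Rightarrow> int \<Rightarrow> int" where "fac_index n a = 1 + 3 * (n * n) + a"
definition cnum_index :: "int \<Rightarrow> int \<Rightarrow> int" where "cnum_index n a = 1 + 3 * (n * n) + n + 2 * a"
definition xh_index :: "int \<Rightarrow> int \<Rightarrow> int" where "xh_index n a = 1 + 3 * (n * n) + 3 * n + a"
definition len_index :: "int \<Rightarrow> int" where "len_index n = 1 + 3 * (n * n) + 4 * n"
definition client_index :: "int \<Rightarrow> int \<Rightarrow> int" where "client_index n a = len_index n + 1 + a"

lemma aval_index [simp]:
  "aval (pairE a b) s = pair_index (s ''in'' 0) (aval a s) (aval b s)"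
  "aval (numE a b) s = num_index (s ''in'' 0) (aval a s) (aval b s)"
  "aval (facE a) s = fac_index (s ''in'' 0) (aval a s)"
  "aval (cnumE a) s = cnum_index (s ''in'' 0) (aval a s)"
  "aval (xhE a) s = xh_index (s ''in'' 0) (aval a s)"
  "aval lenE s = len_index (s ''in'' 0)"
  "aval (clientE a) s = client_index (s ''in'' 0) (aval a s)"
  by (simp_all add: pairE_def numE_def facE_def cnumE_def xhE_def lenE_def clientE_def
    pair_index_def num_index_def fac_index_def cnum_index_def xh_index_def len_index_def client_index_def)

lemma pair_index_inject:
  assumes "v < n" "v' < n"
  shows "pair_index (int n) (int u) (int v) = pair_index (int n) (int u') (int v') \<longleftrightarrow> u = u' \<and> v = v'"
proof
  assume "pair_index (int n) (int u) (int v) = pair_index (int n) (int u') (int v')"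
  then have "int (u * n + v) = int (u' * n + v')" by (simp add: pair_index_def)
  then have eq: "u * n + v = u' * n + v'" by (simp only: of_nat_eq_iff)
  have "(u * n + v) div n = u" "(u' * n + v') div n = u'" using assms by simp_all
  then show "u = u' \<and> v = v'" using eq by auto
qed simp

section \<open>The program\<close>

abbreviation "in_at \<equiv> Cell ''in''"
abbreviation "dist_at a b \<equiv> Cell ''dd'' (pairE a b)"
abbreviation "is_fac a \<equiv> Less (Const 0) (in_at (facE a))"
abbreviation "is_xh a \<equiv> Less (Const 0) (in_at (xhE a))"
abbreviation "succE a \<equiv> Plus a (Const 1)"
abbreviation "flag x a \<equiv> Less (Const 0) (Cell x a)"

text \<open>The last loop multiplies by \<open>n!\<close> through repeated addition, because
  \<open>safe\<close> admits products only with an input cell.\<close>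

definition scale_prog :: prog where
  "scale_prog = Asg ''M'' (Const 0) (Const 1) ;;
     For ''u'' nE (For ''v'' nE (Asg ''M'' (Const 0)
       (Mult (Var ''M'') (in_at (succE (numE (Var ''u'') (Var ''v''))))))) ;;
     For ''u'' nE (Asg ''M'' (Const 0) (Mult (Var ''M'') (in_at (succE (cnumE (Var ''u'')))))) ;;
     For ''u'' nE (sum_loop ''acc'' ''v'' nE (Less (Var ''v'') (succE (Var ''u''))) (Var ''M'') ;;
       Asg ''M'' (Const 0) (Var ''acc''))"

definition dist_prog :: prog where
  "dist_prog = For ''u'' nE (For ''v'' nE (Asg ''dd'' (pairE (Var ''u'') (Var ''v''))
       (Quot (Mult (Var ''M'') (in_at (numE (Var ''u'') (Var ''v''))))
         (in_at (succE (numE (Var ''u'') (Var ''v'')))))))"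

definition cost_prog :: prog where
  "cost_prog = For ''u'' nE (
       Asg ''fc'' (Var ''u'') (Quot (Mult (Var ''M'') (in_at (cnumE (Var ''u'')))) (in_at (succE (cnumE (Var ''u''))))) ;;
       Asg ''cst'' (Var ''u'') (Cell ''fc'' (Var ''u'')))"

definition radius_guard :: bexp where
  "radius_guard = Conj (is_xh (Var ''v'')) (leE (dist_at (Var ''v'') (Var ''w'')) (dist_at (Var ''u'') (Var ''w'')))"

definition quotient_prog :: prog where
  "quotient_prog = For ''u'' nE (
       sum_loop ''sm'' ''v'' nE radius_guard (dist_at (Var ''v'') (Var ''w'')) ;;
       sum_loop ''ct'' ''v'' nE radius_guard (Const 1) ;;
       Asg ''qq'' (Var ''u'') (Quot (Plus (Cell ''fc'' (Var ''w'')) (Var ''sm'')) (Var ''ct'')))"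

definition radius_prog :: prog where
  "radius_prog = For ''w'' nE (quotient_prog ;;
     min_loop ''b'' ''bv'' ''u'' nE (is_xh (Var ''u'')) (Cell ''qq'' (Var ''u'')) ;;
     Ite (Less (Var ''b'') (Const 0)) (Asg ''rad'' (Var ''w'') (Const 0)) (Asg ''rad'' (Var ''w'') (Var ''bv'')))"

definition greedy_prog :: prog where
  "greedy_prog = For ''t'' nE (
     min_loop ''b'' ''bv'' ''w'' nE (Conj (is_fac (Var ''w'')) (Neg (flag ''dn'' (Var ''w'')))) (Cell ''rad'' (Var ''w'')) ;;
     Ite (Less (Var ''b'') (Const 0)) Nop (
       Asg ''dn'' (Var ''b'') (Const 1) ;;
       sum_loop ''cf'' ''v'' nE (Conj (flag ''ch'' (Var ''v'')) (leE (dist_at (Var ''v'') (Var ''b''))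
         (Mult (Const 2) (Cell ''rad'' (Var ''b''))))) (Const 1) ;;
       Ite (Less (Var ''cf'') (Const 1)) (Asg ''ch'' (Var ''b'') (Const 1)) Nop))"

definition cumulative_prog :: prog where
  "cumulative_prog = For ''w'' nE (
     sum_loop ''acc'' ''v'' nE (Conj (flag ''ch'' (Var ''v'')) (leE (Cell ''rad'' (Var ''v'')) (Cell ''rad'' (Var ''w''))))
       (Cell ''fc'' (Var ''v'')) ;;
     Asg ''cum'' (Var ''w'') (Var ''acc''))"

text \<open>The arrays \<open>aa\<close> and \<open>bb\<close> tabulate \<open>level_scale\<close>
  and \<open>level_ratio\<close>. Their product is formed by adding \<open>bb\<close> copies of
  \<open>aa\<close>; \<open>n + 14\<close> rounds suffice since
  \<open>level_ratio k \<le> k + 2\<close>. The square in the test is harmless because it is not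
  stored.\<close>

definition table_prog :: prog where
  "table_prog = Asg ''bb'' (Const 0) (Const 2) ;; Asg ''aa'' (Const 0) (Const 1) ;;
     For ''u'' (Plus nE (Const 12)) (
       sum_loop ''acc'' ''v'' (Plus nE (Const 14)) (Less (Var ''v'') (Cell ''bb'' (Var ''u''))) (Cell ''aa'' (Var ''u'')) ;;
       Asg ''aa'' (succE (Var ''u'')) (Var ''acc'') ;;
       Ite (leE (Mult (Cell ''bb'' (Var ''u'')) (Cell ''bb'' (Var ''u''))) (succE (Var ''u'')))
         (Asg ''bb'' (succE (Var ''u'')) (succE (Cell ''bb'' (Var ''u''))))
         (Asg ''bb'' (succE (Var ''u'')) (Cell ''bb'' (Var ''u''))))"

definition near_guard :: bexp where
  "near_guard = leE (Mult (Var ''m'') (dist_at (Var ''v'') (Var ''w''))) (Var ''xv'')"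

definition multiplier_prog :: prog where
  "multiplier_prog = Asg ''m'' (Const 0) (Const 5) ;;
     For ''k'' (Plus nE (Const 12)) (Ite (leE (Mult (Cell ''aa'' (Var ''k'')) (Var ''xv'')) (Var ''P''))
       (Asg ''m'' (Const 0) (succE (Plus (Cell ''bb'' (Var ''k'')) (Cell ''bb'' (Var ''k''))))) Nop)"

definition visit_prog :: prog where
  "visit_prog = Ite (Conj (is_fac (Var ''w'')) (Neg (flag ''F'' (Var ''w'')))) (
     min_loop ''xb'' ''xv'' ''v'' nE (flag ''F'' (Var ''v'')) (dist_at (Var ''v'') (Var ''w'')) ;;
     multiplier_prog ;;
     sum_loop ''sm'' ''v'' nE near_guard (Cell ''pot'' (Var ''v'')) ;;
     Ite (Conj (Neg (Conj (flag ''ch'' (Var ''w'')) (leE (Cell ''cum'' (Var ''w'')) (Var ''P''))))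
         (Less (Var ''sm'') (Cell ''fc'' (Var ''w'')))) Nop (
       Asg ''F'' (Var ''w'') (Const 1) ;; Asg ''cst'' (Var ''w'') (Const 0) ;;
       For ''v'' nE (Ite near_guard (Asg ''pot'' (Var ''v'') (Const 0)) Nop))) Nop"

text \<open>The array \<open>cst\<close> holds the opening cost still to be paid, 0 for open
  facilities, so that a price is a plain sum; \<open>fc\<close> keeps the original cost for the
  scan.\<close>

definition step_prog :: prog where
  "step_prog = Asg ''u'' (Const 0) (in_at (clientE (Var ''t''))) ;;
     min_loop ''b'' ''bv'' ''w'' nE (is_fac (Var ''w'')) (Plus (Cell ''cst'' (Var ''w'')) (dist_at (Var ''w'') (Var ''u''))) ;;
     Asg ''F'' (Var ''b'') (Const 1) ;; Asg ''cst'' (Var ''b'') (Const 0) ;;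
     Asg ''P'' (Const 0) (Plus (Var ''P'') (Var ''bv'')) ;; Asg ''pot'' (Var ''u'') (Var ''bv'') ;;
     For ''w'' nE visit_prog"

definition output_prog :: prog where
  "output_prog = Asg ''out'' (Const 0) (Var ''b'') ;; Asg ''ol'' (Const 0) (Const 1) ;;
     For ''w'' nE (Ite (flag ''F'' (Var ''w'')) (
       Asg ''out'' (Var ''ol'') (Var ''w'') ;; Asg ''ol'' (Const 0) (succE (Var ''ol''))) Nop) ;;
     Asg ''outlen'' (Const 0) (Var ''ol'')"

definition main_prog :: prog where
  "main_prog = scale_prog ;; dist_prog ;; cost_prog ;; radius_prog ;; greedy_prog ;; cumulative_prog ;;
     table_prog ;; For ''t'' (in_at lenE) step_prog ;; output_prog"

lemmas index_defs = pairE_def numE_def facE_def cnumE_def xhE_def lenE_def clientE_def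

lemma main_prog_well_formed: "well_formed main_prog"
  by (simp add: main_prog_def scale_prog_def dist_prog_def cost_prog_def radius_prog_def quotient_prog_def
    greedy_prog_def cumulative_prog_def table_prog_def visit_prog_def multiplier_prog_def step_prog_def
    output_prog_def sum_loop_def min_loop_def Nop_def index_defs)

lemma main_prog_bounds: "bounds main_prog = {nE, Plus nE (Const 12), Plus nE (Const 14), in_at lenE}"
  by (auto simp: main_prog_def scale_prog_def dist_prog_def cost_prog_def radius_prog_def quotient_prog_def
    greedy_prog_def cumulative_prog_def table_prog_def visit_prog_def multiplier_prog_def step_prog_def
    output_prog_def sum_loop_def min_loop_def Nop_def)

lemma written_progs [simp]:
  "written scale_prog = {''M'', ''u'', ''v'', ''acc'', ''nop''}"
  "written dist_prog = {''u'', ''v'', ''dd''}"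
  "written cost_prog = {''u'', ''fc'', ''cst''}"
  "written quotient_prog = {''u'', ''v'', ''sm'', ''ct'', ''qq'', ''nop''}"
  "written radius_prog = {''w'', ''u'', ''v'', ''sm'', ''ct'', ''qq'', ''b'', ''bv'', ''rad'', ''nop''}"
  "written greedy_prog = {''t'', ''b'', ''bv'', ''w'', ''dn'', ''cf'', ''v'', ''ch'', ''nop''}"
  "written cumulative_prog = {''w'', ''acc'', ''v'', ''cum'', ''nop''}"
  "written table_prog = {''bb'', ''aa'', ''u'', ''acc'', ''v'', ''nop''}"
  "written multiplier_prog = {''m'', ''k'', ''nop''}"
  "written visit_prog = {''xb'', ''xv'', ''v'', ''m'', ''k'', ''sm'', ''F'', ''cst'', ''pot'', ''nop''}"
  "written step_prog = {''u'', ''b'', ''bv'', ''w'', ''F'', ''cst'', ''P'', ''pot'', ''xb'', ''xv'', ''v'', ''m'', ''k'', ''sm'', ''nop''}"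
  by (auto simp: scale_prog_def dist_prog_def cost_prog_def radius_prog_def quotient_prog_def
    greedy_prog_def cumulative_prog_def table_prog_def visit_prog_def multiplier_prog_def step_prog_def)

section \<open>Correctness of the preprocessing\<close>

locale program_input = fl +
  fixes inp :: "int \<Rightarrow> int" and xs :: "nat list" and M :: int
    and num den :: "nat \<Rightarrow> nat \<Rightarrow> int" and cnum cden :: "nat \<Rightarrow> int"
  assumes inp_n [simp]: "inp 0 = int n"
    and inp_num [simp]: "u < n \<Longrightarrow> v < n \<Longrightarrow> inp (num_index (int n) (int u) (int v)) = num u v"
    and inp_den [simp]: "u < n \<Longrightarrow> v < n \<Longrightarrow> inp (num_index (int n) (int u) (int v) + 1) = den u v"
    and inp_fac [simp]: "u < n \<Longrightarrow> 0 < inp (fac_index (int n) (int u)) \<longleftrightarrow> u \<in> fac"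
    and inp_cnum [simp]: "u < n \<Longrightarrow> inp (cnum_index (int n) (int u)) = cnum u"
    and inp_cden [simp]: "u < n \<Longrightarrow> inp (cnum_index (int n) (int u) + 1) = cden u"
    and inp_xh [simp]: "u < n \<Longrightarrow> 0 < inp (xh_index (int n) (int u)) \<longleftrightarrow> u \<in> Xh"
    and inp_len [simp]: "inp (len_index (int n)) = int (length xs)"
    and inp_client [simp]: "t < length xs \<Longrightarrow> inp (client_index (int n) (int t)) = int (xs ! t)"
    and xs_less: "set xs \<subseteq> {..<n}" and xs_nonempty: "xs \<noteq> []"
    and M: "M = (\<Prod>u<n. \<Prod>v<n. den u v) * (\<Prod>u<n. cden u) * fact n"
    and d_eq: "u < n \<Longrightarrow> v < n \<Longrightarrow> M * num u v div den u v = d u v"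
    and f_eq: "u < n \<Longrightarrow> M * cnum u div cden u = f u"
begin

lemma eval_scale:
  assumes "s ''in'' = inp"
  shows "eval scale_prog s ''M'' 0 = M"
proof -
  let ?in1 = "Asg ''M'' (Const 0) (Mult (Var ''M'') (in_at (succE (numE (Var ''u'') (Var ''v'')))))"
  let ?p1 = "For ''v'' nE ?in1"
  let ?p2 = "Asg ''M'' (Const 0) (Mult (Var ''M'') (in_at (succE (cnumE (Var ''u'')))))"
  let ?sum = "sum_loop ''acc'' ''v'' nE (Less (Var ''v'') (succE (Var ''u''))) (Var ''M'')"
  let ?p3 = "?sum ;; Asg ''M'' (Const 0) (Var ''acc'')"
  have 0: "eval ?p1 s' ''M'' 0 = s' ''M'' 0 * (\<Prod>v<n. den u v)"
    if "s' ''in'' = inp" "s' ''u'' 0 = int u" "u < n" for s' u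
  proof (rule for_rule[where I = "\<lambda>k t. t ''M'' 0 = s' ''M'' 0 * (\<Prod>v<k. den u v)"])
    fix k t assume k: "k < n" "agree (insert ''v'' (written ?in1)) s' t" "t ''M'' 0 = s' ''M'' 0 * (\<Prod>v<k. den u v)" "t ''v'' 0 = int k"
    note A = agreeD[OF k(2)]
    show "eval ?in1 t ''M'' 0 = s' ''M'' 0 * (\<Prod>v<Suc k. den u v)"
      using k(1,3,4) that by (simp add: A)
  qed (use that in auto)
  let ?init = "set_var s ''M'' 1"
  have 1: "eval (For ''u'' nE ?p1) ?init ''M'' 0 = (\<Prod>u<n. \<Prod>v<n. den u v)"
  proof (rule for_rule[where I = "\<lambda>k t. t ''M'' 0 = (\<Prod>u<k. \<Prod>v<n. den u v)"])
    fix k t assume k: "k < n" "agree (insert ''u'' (written ?p1)) ?init t" "t ''M'' 0 = (\<Prod>u<k. \<Prod>v<n. den u v)" "t ''u'' 0 = int k"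
    note A = agreeD[OF k(2)]
    have "t ''in'' = inp" using assms by (simp add: A)
    from 0[OF this k(4,1)] show "eval ?p1 t ''M'' 0 = (\<Prod>u<Suc k. \<Prod>v<n. den u v)"
      by (simp only: k(3) prod.lessThan_Suc)
  qed (use assms in auto)
  define s1 where "s1 = eval (For ''u'' nE ?p1) ?init"
  have in1: "s1 ''in'' = inp" using assms by (simp add: s1_def eval_unwritten del: eval.simps)
  have 2: "eval (For ''u'' nE ?p2) s1 ''M'' 0 = s1 ''M'' 0 * (\<Prod>u<n. cden u)"
  proof (rule for_rule[where I = "\<lambda>k t. t ''M'' 0 = s1 ''M'' 0 * (\<Prod>u<k. cden u)"])
    fix k t assume k: "k < n" "agree (insert ''u'' (written ?p2)) s1 t" "t ''M'' 0 = s1 ''M'' 0 * (\<Prod>u<k. cden u)" "t ''u'' 0 = int k"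
    note A = agreeD[OF k(2)]
    show "eval ?p2 t ''M'' 0 = s1 ''M'' 0 * (\<Prod>u<Suc k. cden u)"
      using k(1,3,4) in1 by (simp add: A)
  qed (use in1 in auto)
  define s2 where "s2 = eval (For ''u'' nE ?p2) s1"
  have in2: "s2 ''in'' = inp" using in1 by (simp add: s2_def eval_unwritten del: eval.simps)
  have 3: "eval (For ''u'' nE ?p3) s2 ''M'' 0 = s2 ''M'' 0 * fact n"
  proof (rule for_rule[where I = "\<lambda>k t. t ''M'' 0 = s2 ''M'' 0 * fact k"])
    fix k t assume k: "k < n" "agree (insert ''u'' (written ?p3)) s2 t" "t ''M'' 0 = s2 ''M'' 0 * fact k" "t ''u'' 0 = int k"
    note A = agreeD[OF k(2)]
    have "eval ?sum t ''acc'' 0 = (\<Sum>j | j < n \<and> j < Suc k. t ''M'' 0)"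
    proof (rule eval_sum_loop)
      fix j s' assume j: "agree {''acc'', ''v'', ''nop''} t s'" "s' ''v'' 0 = int j"
      note B = agreeD[OF j(1)]
      show "bval (Less (Var ''v'') (succE (Var ''u''))) s' = (j < Suc k) \<and> (j < Suc k \<longrightarrow> aval (Var ''M'') s' = t ''M'' 0)"
        using j(2) k(4) by (auto simp: B)
    qed (use k in2 in \<open>auto simp: A\<close>)
    also have "{j. j < n \<and> j < Suc k} = {..<Suc k}" using k(1) by auto
    finally have "eval ?sum t ''acc'' 0 = int (Suc k) * t ''M'' 0" by simp
    then show "eval ?p3 t ''M'' 0 = s2 ''M'' 0 * fact (Suc k)" using k(3) by (simp add: algebra_simps)
  qed (use in2 in auto)
  show ?thesis using 1 2 3 by (simp add: scale_prog_def s1_def s2_def M set_var_def del: eval.simps(4))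
qed

lemma eval_dist:
  assumes "s ''in'' = inp" "s ''M'' 0 = M" "u < n" "v < n"
  shows "eval dist_prog s ''dd'' (pair_index (int n) (int u) (int v)) = d u v"
proof -
  let ?p = "Asg ''dd'' (pairE (Var ''u'') (Var ''v''))
       (Quot (Mult (Var ''M'') (in_at (numE (Var ''u'') (Var ''v''))))
         (in_at (succE (numE (Var ''u'') (Var ''v'')))))"
  let ?q = "For ''v'' nE ?p"
  let ?I = "\<lambda>k t. \<forall>u<k. \<forall>v<n. t ''dd'' (pair_index (int n) (int u) (int v)) = d u v"
  have 0: "?I (Suc u) (eval ?q s')"
    if s': "s' ''in'' = inp" "s' ''M'' 0 = M" "s' ''u'' 0 = int u" "u < n" "?I u s'" for s' u
  proof -
    let ?J = "\<lambda>k t. ?I u t \<and> (\<forall>v<k. t ''dd'' (pair_index (int n) (int u) (int v)) = d u v)"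
    have "?J n (eval ?q s')"
    proof (rule for_rule[where I = ?J])
      fix k t assume k: "k < n" "agree (insert ''v'' (written ?p)) s' t" "?J k t" "t ''v'' 0 = int k"
      note A = agreeD[OF k(2)]
      show "?J (Suc k) (eval ?p t)"
        using k(1,3,4) s' by (auto simp: A pair_index_inject less_Suc_eq d_eq)
    qed (use s' in auto)
    then show ?thesis by (auto simp: less_Suc_eq)
  qed
  have "?I n (eval (For ''u'' nE ?q) s)"
  proof (rule for_rule[where I = ?I])
    fix k t assume k: "k < n" "agree (insert ''u'' (written ?q)) s t" "?I k t" "t ''u'' 0 = int k"
    note A = agreeD[OF k(2)]
    show "?I (Suc k) (eval ?q t)" using assms k by (intro 0) (simp_all add: A)
  qed (use assms in auto)
  then show ?thesis using assms by (simp add: dist_prog_def)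
qed

lemma eval_cost:
  assumes "s ''in'' = inp" "s ''M'' 0 = M" "u < n"
  shows "eval cost_prog s ''fc'' (int u) = f u" "eval cost_prog s ''cst'' (int u) = f u"
proof -
  let ?p = "Asg ''fc'' (Var ''u'') (Quot (Mult (Var ''M'') (in_at (cnumE (Var ''u'')))) (in_at (succE (cnumE (Var ''u''))))) ;;
       Asg ''cst'' (Var ''u'') (Cell ''fc'' (Var ''u''))"
  let ?I = "\<lambda>k t. \<forall>u<k. t ''fc'' (int u) = f u \<and> t ''cst'' (int u) = f u"
  have "?I n (eval (For ''u'' nE ?p) s)"
  proof (rule for_rule[where I = ?I])
    fix k t assume k: "k < n" "agree (insert ''u'' (written ?p)) s t" "?I k t" "t ''u'' 0 = int k"
    note A = agreeD[OF k(2)]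
    show "?I (Suc k) (eval ?p t)" using assms k(1,3,4) by (auto simp: A f_eq less_Suc_eq)
  qed (use assms in auto)
  then show "eval cost_prog s ''fc'' (int u) = f u" "eval cost_prog s ''cst'' (int u) = f u"
    using assms by (simp_all add: cost_prog_def)
qed

definition loaded :: "store \<Rightarrow> bool" where
  "loaded s \<longleftrightarrow> s ''in'' = inp \<and> (\<forall>u<n. \<forall>v<n. s ''dd'' (pair_index (int n) (int u) (int v)) = d u v) \<and>
     (\<forall>u<n. s ''fc'' (int u) = f u)"

lemma loadedD:
  assumes "loaded s"
  shows "s ''in'' = inp" "u < n \<Longrightarrow> v < n \<Longrightarrow> s ''dd'' (pair_index (int n) (int u) (int v)) = d u v"
    "u < n \<Longrightarrow> s ''fc'' (int u) = f u"
  using assms by (auto simp: loaded_def)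

lemma loaded_agree: "loaded s \<Longrightarrow> agree W s s' \<Longrightarrow> ''in'' \<notin> W \<Longrightarrow> ''dd'' \<notin> W \<Longrightarrow> ''fc'' \<notin> W \<Longrightarrow> loaded s'"
  by (simp add: loaded_def agree_def)

lemma eval_quotient:
  assumes s: "loaded s" and w: "s ''w'' 0 = int w" "w < n" and u: "u < n"
  shows "eval quotient_prog s ''qq'' (int u) = quotient w u"
proof -
  let ?s1 = "sum_loop ''sm'' ''v'' nE radius_guard (dist_at (Var ''v'') (Var ''w''))"
  let ?s2 = "sum_loop ''ct'' ''v'' nE radius_guard (Const 1)"
  let ?a = "Asg ''qq'' (Var ''u'') (Quot (Plus (Cell ''fc'' (Var ''w'')) (Var ''sm'')) (Var ''ct''))"
  let ?p = "?s1 ;; ?s2 ;; ?a"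
  let ?I = "\<lambda>k t. \<forall>u<k. t ''qq'' (int u) = quotient w u"
  have "?I n (eval (For ''u'' nE ?p) s)"
  proof (rule for_rule[where I = ?I])
    fix k t assume k: "k < n" "agree (insert ''u'' (written ?p)) s t" "?I k t" "t ''u'' 0 = int k"
    note A = agreeD[OF k(2)]
    have lt: "loaded t" using s k(2) by (rule loaded_agree) auto
    have wt: "t ''w'' 0 = int w" using w by (simp add: A)
    let ?T = "{v. v < n \<and> (v \<in> Xh \<and> d v w \<le> d k w)}"
    have guard: "bval radius_guard s' = (v \<in> Xh \<and> d v w \<le> d k w)" "aval (dist_at (Var ''v'') (Var ''w'')) s' = d v w"
      if "v < n" "agree W t s'" "W \<subseteq> {''sm'', ''ct'', ''v'', ''nop''}" "s' ''v'' 0 = int v" for v s' W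
    proof -
      have "loaded s'" using lt that(2) by (rule loaded_agree) (use that in auto)
      moreover have "s' ''w'' = t ''w''" "s' ''u'' = t ''u''" using that by (auto simp: agree_def)
      ultimately show "bval radius_guard s' = (v \<in> Xh \<and> d v w \<le> d k w)" "aval (dist_at (Var ''v'') (Var ''w'')) s' = d v w"
        using that(1,4) k w(2) wt by (auto simp: radius_guard_def loadedD)
    qed
    have 1: "eval ?s1 t ''sm'' 0 = (\<Sum>v\<in>?T. d v w)"
    proof (rule eval_sum_loop)
      fix v s' assume "v < n" "agree {''sm'', ''v'', ''nop''} t s'" "s' ''v'' 0 = int v"
      from guard[OF this(1,2) _ this(3)]
      show "bval radius_guard s' = (v \<in> Xh \<and> d v w \<le> d k w) \<and>
          (v \<in> Xh \<and> d v w \<le> d k w \<longrightarrow> aval (dist_at (Var ''v'') (Var ''w'')) s' = d v w)" by simp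
    qed (use lt in \<open>auto simp: loadedD\<close>)
    have 2: "eval ?s2 (eval ?s1 t) ''ct'' 0 = (\<Sum>v\<in>?T. 1)"
    proof (rule eval_sum_loop)
      fix v s' assume v: "v < n" "agree {''ct'', ''v'', ''nop''} (eval ?s1 t) s'" "s' ''v'' 0 = int v"
      have "agree {''sm'', ''ct'', ''v'', ''nop''} t s'" using v(2) eval_unwritten[of _ ?s1 t] by (auto simp: agree_def)
      from guard(1)[OF v(1) this _ v(3)]
      show "bval radius_guard s' = (v \<in> Xh \<and> d v w \<le> d k w) \<and>
          (v \<in> Xh \<and> d v w \<le> d k w \<longrightarrow> aval (Const 1) s' = 1)" by simp
    qed (use lt in \<open>auto simp: loadedD eval_unwritten\<close>)
    have eq: "eval ?s2 (eval ?s1 t) y = t y" if "y \<notin> {''sm'', ''ct'', ''v'', ''nop''}" for y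
      using that by (simp add: eval_unwritten)
    have sm: "eval ?s2 (eval ?s1 t) ''sm'' = eval ?s1 t ''sm''" by (simp add: eval_unwritten)
    show "?I (Suc k) (eval ?p t)"
      using k(3,4) wt w(2) loadedD(3)[OF lt w(2)]
      by (auto simp: eq sm 1 2 less_Suc_eq quotient_def)
  qed (use s in \<open>auto simp: loadedD\<close>)
  then show ?thesis using u by (simp add: quotient_prog_def)
qed

lemma eval_radius:
  assumes s: "loaded s" and w: "w < n"
  shows "eval radius_prog s ''rad'' (int w) = radius w"
proof -
  let ?m = "min_loop ''b'' ''bv'' ''u'' nE (is_xh (Var ''u'')) (Cell ''qq'' (Var ''u''))"
  let ?i = "Ite (Less (Var ''b'') (Const 0)) (Asg ''rad'' (Var ''w'') (Const 0)) (Asg ''rad'' (Var ''w'') (Var ''bv''))"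
  let ?p = "quotient_prog ;; ?m ;; ?i"
  let ?I = "\<lambda>k t. \<forall>w<k. t ''rad'' (int w) = radius w"
  have "?I n (eval (For ''w'' nE ?p) s)"
  proof (rule for_rule[where I = ?I])
    fix k t assume k: "k < n" "agree (insert ''w'' (written ?p)) s t" "?I k t" "t ''w'' 0 = int k"
    have lt: "loaded t" using s k(2) by (rule loaded_agree) auto
    define t1 where "t1 = eval quotient_prog t"
    have qq: "t1 ''qq'' (int u) = quotient k u" if "u < n" for u
      unfolding t1_def using eval_quotient[OF lt k(4,1) that] .
    have l1: "loaded t1" unfolding t1_def using lt agree_eval by (rule loaded_agree) auto
    have e: "bval (is_xh (Var ''u'')) s' = (u \<in> Xh) \<and> (u \<in> Xh \<longrightarrow> aval (Cell ''qq'' (Var ''u'')) s' = quotient k u)"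
      if u: "u < n" "agree {''b'', ''bv'', ''u'', ''nop''} t1 s'" "s' ''u'' 0 = int u" for u s'
      using u loadedD(1)[OF l1] qq by (simp add: agreeD[OF u(2)])
    note m = eval_min_loop[where s = t1 and G = "\<lambda>u. u \<in> Xh" and E = "quotient k" and m = n, OF _ _ _ e]
    have rest: "eval ?m t1 ''w'' = t ''w''" "eval ?m t1 ''rad'' = t ''rad''" by (simp_all add: eval_unwritten t1_def)
    show "?I (Suc k) (eval ?p t)"
      using m loadedD(1)[OF l1] k(3,4)
      by (auto simp: rest t1_def[symmetric] less_Suc_eq radius_def Let_def)
  qed (use s in \<open>auto simp: loadedD\<close>)
  then show ?thesis using w by (simp add: radius_prog_def)
qed

lemma eval_greedy:
  assumes s: "loaded s" and rad: "\<And>w. w < n \<Longrightarrow> s ''rad'' (int w) = radius w"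
    and zero: "\<And>w. s ''dn'' w = 0" "\<And>w. s ''ch'' w = 0" and w: "w < n"
  shows "0 < eval greedy_prog s ''ch'' (int w) \<longleftrightarrow> w \<in> centers"
proof -
  let ?m = "min_loop ''b'' ''bv'' ''w'' nE (Conj (is_fac (Var ''w'')) (Neg (flag ''dn'' (Var ''w'')))) (Cell ''rad'' (Var ''w''))"
  let ?a = "Asg ''dn'' (Var ''b'') (Const 1)"
  let ?g = "Conj (flag ''ch'' (Var ''v'')) (leE (dist_at (Var ''v'') (Var ''b'')) (Mult (Const 2) (Cell ''rad'' (Var ''b''))))"
  let ?s = "sum_loop ''cf'' ''v'' nE ?g (Const 1)"
  let ?i = "Ite (Less (Var ''cf'') (Const 1)) (Asg ''ch'' (Var ''b'') (Const 1)) Nop"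
  let ?p = "?m ;; Ite (Less (Var ''b'') (Const 0)) Nop (?a ;; ?s ;; ?i)"
  let ?I = "\<lambda>k t. \<forall>w<n. (0 < t ''dn'' (int w) \<longleftrightarrow> w \<in> fst (greedy k)) \<and> (0 < t ''ch'' (int w) \<longleftrightarrow> w \<in> snd (greedy k))"
  have "?I n (eval (For ''t'' nE ?p) s)"
  proof (rule for_rule[where I = ?I])
    fix k t assume k: "k < n" "agree (insert ''t'' (written ?p)) s t" "?I k t" "t ''t'' 0 = int k"
    obtain D C where DC: "greedy k = (D, C)" by (cases "greedy k")
    have dn: "0 < t ''dn'' (int w) \<longleftrightarrow> w \<in> D" and ch: "0 < t ''ch'' (int w) \<longleftrightarrow> w \<in> C" if "w < n" for w
      using k(3) that DC by auto
    note A = agreeD[OF k(2)]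
    have lt: "loaded t" using s k(2) by (rule loaded_agree) auto
    have radt: "t ''rad'' (int w) = radius w" if "w < n" for w using rad[OF that] by (simp add: A)
    define b where "b = argmin_upto (\<lambda>w. w \<in> fac \<and> w \<notin> D) radius n"
    have e: "bval (Conj (is_fac (Var ''w'')) (Neg (flag ''dn'' (Var ''w'')))) s' = (w \<in> fac \<and> w \<notin> D) \<and>
        (w \<in> fac \<and> w \<notin> D \<longrightarrow> aval (Cell ''rad'' (Var ''w'')) s' = radius w)"
      if w: "w < n" "agree {''b'', ''bv'', ''w'', ''nop''} t s'" "s' ''w'' 0 = int w" for w s'
      using w loadedD(1)[OF lt] radt dn by (simp add: agreeD[OF w(2)])
    have m: "eval ?m t ''b'' 0 = b"
      unfolding b_def by (rule eval_min_loop(1)[OF _ _ _ e]) (use loadedD(1)[OF lt] in auto)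
    define t1 where "t1 = eval ?m t"
    have t1: "t1 y = t y" if "y \<notin> {''b'', ''bv'', ''w'', ''nop''}" for y
      using that by (simp add: t1_def eval_unwritten)
    have t1b: "t1 ''b'' 0 = b" using m by (simp add: t1_def)
    show "?I (Suc k) (eval ?p t)"
    proof (cases "b < 0")
      case True
      then have "eval ?p t = set_var t1 ''nop'' 0" using t1b by (simp add: t1_def)
      moreover have "greedy (Suc k) = (D, C)" using True DC by (simp add: b_def)
      ultimately show ?thesis using dn ch by (simp add: t1)
    next
      case False
      then have "\<exists>i<n. i \<in> fac \<and> i \<notin> D" using argmin_upto_neg_iff[of "\<lambda>w. w \<in> fac \<and> w \<notin> D" radius n]
        unfolding b_def by blast
      from argmin_upto_spec(2)[OF this] have bn: "nat b < n" by (simp add: b_def)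
      define j where "j = nat b"
      have j: "b = int j" "j < n" using False bn by (auto simp: j_def)
      define t2 where "t2 = eval ?a t1"
      have t2: "t2 = t1(''dn'' := (t1 ''dn'')(int j := 1))" using t1b j by (simp add: t2_def)
      have l2: "loaded t2" using lt by (rule loaded_agree[where W = "{''b'', ''bv'', ''w'', ''nop'', ''dn''}"])
        (auto simp: agree_def t2 t1)
      \<comment> \<open>The existence of a conflicting center is tested by counting such
        centers.\<close>
      have cf: "eval ?s t2 ''cf'' 0 = (\<Sum>v | v < n \<and> (v \<in> C \<and> d v j \<le> 2 * radius j). 1)"
      proof (rule eval_sum_loop)
        fix v s' assume v: "v < n" "agree {''cf'', ''v'', ''nop''} t2 s'" "s' ''v'' 0 = int v"
        have "loaded s'" using l2 v(2) by (rule loaded_agree) auto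
        then have dd: "s' ''in'' = inp" "s' ''dd'' (pair_index (int n) (int v) (int j)) = d v j"
          using v(1) j(2) by (simp_all add: loadedD)
        have vars: "s' ''b'' 0 = int j" "s' ''ch'' (int v) = t ''ch'' (int v)" "s' ''rad'' (int j) = radius j"
          using t1b j radt by (simp_all add: agreeD[OF v(2)] t2 t1)
        show "bval ?g s' = (v \<in> C \<and> d v j \<le> 2 * radius j) \<and> (v \<in> C \<and> d v j \<le> 2 * radius j \<longrightarrow> aval (Const 1) s' = 1)"
          using v(3) dd vars ch[OF v(1)] by (simp add: not_less)
      qed (use loadedD(1)[OF l2] in auto)
      have fin: "finite {v. v < n \<and> (v \<in> C \<and> d v j \<le> 2 * radius j)}" by simp
      define t3 where "t3 = eval ?s t2"
      define conflict where "conflict \<longleftrightarrow> (\<exists>v<n. v \<in> C \<and> d v j \<le> 2 * radius j)"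
      have cf': "t3 ''cf'' 0 < 1 \<longleftrightarrow> \<not> conflict"
        unfolding t3_def cf conflict_def using fin by (auto simp: card_gt_0_iff)
      have G: "greedy (Suc k) = (insert j D, if conflict then C else insert j C)"
        using False DC by (auto simp: b_def[symmetric] j_def conflict_def)
      have t3: "t3 y = t2 y" if "y \<notin> {''cf'', ''v'', ''nop''}" for y using that by (simp add: t3_def eval_unwritten)
      have pt: "eval ?p t = eval ?i t3" using False t1b by (simp add: t1_def t2_def t3_def)
      have t3b: "t3 ''b'' 0 = int j" using t1b j by (simp add: t3 t2)
      have t3s: "t3 ''dn'' = (t1 ''dn'')(int j := 1)" "t3 ''ch'' = t ''ch''" "t1 ''dn'' = t ''dn''"
        by (simp_all add: t3 t2 t1)
      show ?thesis
      proof (cases conflict)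
        case True
        then have "eval ?p t = set_var t3 ''nop'' 0" using pt cf' by simp
        then show ?thesis unfolding G using True dn ch t3s by auto
      next
        case False
        then have "eval ?p t = t3(''ch'' := (t3 ''ch'')(int j := 1))" using pt cf' t3b by simp
        then show ?thesis unfolding G using False dn ch t3s by auto
      qed
    qed
  qed (use s zero in \<open>auto simp: loadedD\<close>)
  then show ?thesis using w by (simp add: greedy_prog_def centers_def)
qed

lemma eval_cumulative:
  assumes s: "loaded s" and rad: "\<And>w. w < n \<Longrightarrow> s ''rad'' (int w) = radius w"
    and ch: "\<And>w. w < n \<Longrightarrow> 0 < s ''ch'' (int w) \<longleftrightarrow> w \<in> centers" and w: "w < n"
  shows "eval cumulative_prog s ''cum'' (int w) = cumulative w"
proof -
  let ?g = "Conj (flag ''ch'' (Var ''v'')) (leE (Cell ''rad'' (Var ''v'')) (Cell ''rad'' (Var ''w'')))"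
  let ?s = "sum_loop ''acc'' ''v'' nE ?g (Cell ''fc'' (Var ''v''))"
  let ?p = "?s ;; Asg ''cum'' (Var ''w'') (Var ''acc'')"
  let ?I = "\<lambda>k t. \<forall>w<k. t ''cum'' (int w) = cumulative w"
  have "?I n (eval (For ''w'' nE ?p) s)"
  proof (rule for_rule[where I = ?I])
    fix k t assume k: "k < n" "agree (insert ''w'' (written ?p)) s t" "?I k t" "t ''w'' 0 = int k"
    note A = agreeD[OF k(2)]
    have lt: "loaded t" using s k(2) by (rule loaded_agree) auto
    have "eval ?s t ''acc'' 0 = (\<Sum>v | v < n \<and> (v \<in> centers \<and> radius v \<le> radius k). f v)"
    proof (rule eval_sum_loop)
      fix v s' assume v: "v < n" "agree {''acc'', ''v'', ''nop''} t s'" "s' ''v'' 0 = int v"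
      show "bval ?g s' = (v \<in> centers \<and> radius v \<le> radius k) \<and>
          (v \<in> centers \<and> radius v \<le> radius k \<longrightarrow> aval (Cell ''fc'' (Var ''v'')) s' = f v)"
        using v(1,3) k(1,4) rad ch loadedD(3)[OF s] by (auto simp: agreeD[OF v(2)] A)
    qed (use loadedD(1)[OF lt] in auto)
    then have "eval ?s t ''acc'' 0 = cumulative k" by (simp add: cumulative_def)
    moreover have "eval ?s t y = t y" if "y \<notin> {''acc'', ''v'', ''nop''}" for y using that by (simp add: eval_unwritten)
    ultimately show "?I (Suc k) (eval ?p t)" using k(3,4) by (auto simp: less_Suc_eq)
  qed (use s in \<open>auto simp: loadedD\<close>)
  then show ?thesis using w by (simp add: cumulative_prog_def)
qed

lemma eval_table:
  assumes "s ''in'' = inp" "k < n + 12"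
  shows "eval table_prog s ''aa'' (int k) = int (level_scale k)" "eval table_prog s ''bb'' (int k) = int (level_ratio k)"
proof -
  let ?s = "sum_loop ''acc'' ''v'' (Plus nE (Const 14)) (Less (Var ''v'') (Cell ''bb'' (Var ''u''))) (Cell ''aa'' (Var ''u''))"
  let ?i = "Ite (leE (Mult (Cell ''bb'' (Var ''u'')) (Cell ''bb'' (Var ''u''))) (succE (Var ''u'')))
         (Asg ''bb'' (succE (Var ''u'')) (succE (Cell ''bb'' (Var ''u''))))
         (Asg ''bb'' (succE (Var ''u'')) (Cell ''bb'' (Var ''u'')))"
  let ?p = "?s ;; Asg ''aa'' (succE (Var ''u'')) (Var ''acc'') ;; ?i"
  let ?I = "\<lambda>k t. \<forall>i\<le>k. t ''aa'' (int i) = int (level_scale i) \<and> t ''bb'' (int i) = int (level_ratio i)"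
  let ?init = "(s(''bb'' := (s ''bb'')(0 := 2), ''aa'' := (s ''aa'')(0 := 1)))"
  have "?I (n + 12) (eval (For ''u'' (Plus nE (Const 12)) ?p) ?init)"
  proof (rule for_rule[where I = ?I])
    fix k t assume k: "k < n + 12" "agree (insert ''u'' (written ?p)) ?init t" "?I k t" "t ''u'' 0 = int k"
    note A = agreeD[OF k(2)]
    have int: "t ''in'' = inp" using assms by (simp add: A)
    have bk: "t ''bb'' (int k) = int (level_ratio k)" "t ''aa'' (int k) = int (level_scale k)" using k(3) by auto
    have "eval ?s t ''acc'' 0 = (\<Sum>v | v < n + 14 \<and> v < level_ratio k. int (level_scale k))"
    proof (rule eval_sum_loop)
      fix v s' assume v: "v < n + 14" "agree {''acc'', ''v'', ''nop''} t s'" "s' ''v'' 0 = int v"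
      show "bval (Less (Var ''v'') (Cell ''bb'' (Var ''u''))) s' = (v < level_ratio k) \<and>
          (v < level_ratio k \<longrightarrow> aval (Cell ''aa'' (Var ''u'')) s' = int (level_scale k))"
        using v(3) k(4) bk by (simp add: agreeD[OF v(2)])
    qed (use int in auto)
    also have "{v. v < n + 14 \<and> v < level_ratio k} = {..<level_ratio k}" using level_ratio_le[of k] k(1) by auto
    finally have acc: "eval ?s t ''acc'' 0 = int (level_scale (Suc k))" by simp
    have eq: "eval ?s t y = t y" if "y \<notin> {''acc'', ''v'', ''nop''}" for y using that by (simp add: eval_unwritten)
    have sq: "int (level_ratio k) * int (level_ratio k) \<le> int k + 1 \<longleftrightarrow> level_ratio k * level_ratio k \<le> Suc k"
      by (metis Suc_eq_plus1 of_nat_1 of_nat_add of_nat_le_iff of_nat_mult)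
    show "?I (Suc k) (eval ?p t)"
      using k(3,4) acc by (auto simp: eq bk le_Suc_eq sq not_less simp del: level_scale.simps)
  qed (use assms in auto)
  then show "eval table_prog s ''aa'' (int k) = int (level_scale k)" "eval table_prog s ''bb'' (int k) = int (level_ratio k)"
    using assms(2) by (simp_all add: table_prog_def)
qed

end

section \<open>Correctness of the online phase\<close>

context program_input
begin

definition ready :: "store \<Rightarrow> bool" where
  "ready s \<longleftrightarrow> loaded s \<and> (\<forall>w<n. 0 < s ''ch'' (int w) \<longleftrightarrow> w \<in> centers) \<and>
     (\<forall>w<n. s ''cum'' (int w) = cumulative w) \<and>
     (\<forall>k<n + 12. s ''aa'' (int k) = int (level_scale k) \<and> s ''bb'' (int k) = int (level_ratio k))"

lemma readyD:
  assumes "ready s"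
  shows "loaded s" "s ''in'' = inp" "w < n \<Longrightarrow> 0 < s ''ch'' (int w) \<longleftrightarrow> w \<in> centers"
    "w < n \<Longrightarrow> s ''cum'' (int w) = cumulative w"
    "k < n + 12 \<Longrightarrow> s ''aa'' (int k) = int (level_scale k)" "k < n + 12 \<Longrightarrow> s ''bb'' (int k) = int (level_ratio k)"
  using assms loadedD(1) by (auto simp: ready_def)

lemma ready_agree:
  "ready s \<Longrightarrow> agree W s s' \<Longrightarrow> W \<inter> {''in'', ''dd'', ''fc'', ''ch'', ''cum'', ''aa'', ''bb''} = {} \<Longrightarrow> ready s'"
  unfolding ready_def using loaded_agree[of s W s'] by (auto simp: agree_def)

text \<open>The part of the store that changes with every arrival; \<open>ready\<close> describes
  the tables that stay fixed.\<close>

definition represents :: "store \<Rightarrow> nat set \<Rightarrow> (nat \<Rightarrow> int) \<Rightarrow> int \<Rightarrow> bool" where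
  "represents s F pot P \<longleftrightarrow> (\<forall>w<n. (0 < s ''F'' (int w) \<longleftrightarrow> w \<in> F) \<and>
     s ''cst'' (int w) = (if w \<in> F then 0 else f w) \<and> s ''pot'' (int w) = pot w) \<and> s ''P'' 0 = P"

lemma representsD:
  assumes "represents s F pot P"
  shows "w < n \<Longrightarrow> 0 < s ''F'' (int w) \<longleftrightarrow> w \<in> F" "w < n \<Longrightarrow> s ''cst'' (int w) = (if w \<in> F then 0 else f w)"
    "w < n \<Longrightarrow> s ''pot'' (int w) = pot w" "s ''P'' 0 = P"
  using assms by (auto simp: represents_def)

lemma represents_agree:
  "represents s F pot P \<Longrightarrow> agree W s s' \<Longrightarrow> W \<inter> {''F'', ''cst'', ''pot'', ''P''} = {} \<Longrightarrow> represents s' F pot P"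
  by (auto simp: represents_def agree_def)

lemma eval_multiplier:
  assumes s: "ready s" and D: "s ''xv'' 0 = D" and P: "s ''P'' 0 = P"
  shows "eval multiplier_prog s ''m'' 0 = multiplier P D (n + 12)"
proof -
  let ?p = "Ite (leE (Mult (Cell ''aa'' (Var ''k'')) (Var ''xv'')) (Var ''P''))
       (Asg ''m'' (Const 0) (succE (Plus (Cell ''bb'' (Var ''k'')) (Cell ''bb'' (Var ''k''))))) Nop"
  let ?init = "s(''m'' := (s ''m'')(0 := 5))"
  let ?I = "\<lambda>k t. t ''m'' 0 = multiplier P D k"
  have "?I (n + 12) (eval (For ''k'' (Plus nE (Const 12)) ?p) ?init)"
  proof (rule for_rule[where I = ?I])
    fix k t assume k: "k < n + 12" "agree (insert ''k'' (written ?p)) ?init t" "?I k t" "t ''k'' 0 = int k"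
    note A = agreeD[OF k(2)]
    show "?I (Suc k) (eval ?p t)"
      using k(3,4) readyD(5,6)[OF s k(1)] D P by (simp add: A not_less)
  qed (use readyD(2)[OF s] in auto)
  then show ?thesis by (simp add: multiplier_prog_def)
qed

lemma eval_near_guard:
  assumes "loaded s" "s ''m'' 0 = multiplier P D (n + 12)" "s ''xv'' 0 = D" "s ''w'' 0 = int w"
    "s ''v'' 0 = int v" "v < n" "w < n" "D = set_dist F w"
  shows "bval near_guard s \<longleftrightarrow> v \<in> near P F w"
  using assms loadedD(1,2)[OF assms(1)] by (simp add: near_guard_def near_def not_less)

lemma eval_visit:
  assumes s: "ready s" and rep: "represents s F pot P" and w: "s ''w'' 0 = int w" "w < n"
    and F: "F \<subseteq> fac" "F \<noteq> {}" and v: "visit P w (F, pot) = (F', pot')"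
  shows "represents (eval visit_prog s) F' pot' P"
proof -
  let ?guard = "Conj (is_fac (Var ''w'')) (Neg (flag ''F'' (Var ''w'')))"
  let ?skip = "Conj (Neg (Conj (flag ''ch'' (Var ''w'')) (leE (Cell ''cum'' (Var ''w'')) (Var ''P''))))
         (Less (Var ''sm'') (Cell ''fc'' (Var ''w'')))"
  have guard: "bval ?guard s \<longleftrightarrow> w \<in> fac \<and> w \<notin> F"
    using w readyD(2)[OF s] representsD(1)[OF rep w(2)] by simp
  show ?thesis
  proof (cases "w \<in> fac \<and> w \<notin> F")
    case False
    then have "eval visit_prog s = set_var s ''nop'' 0"
      by (simp only: visit_prog_def eval.simps(3) guard if_False eval_Nop)
    moreover have "F' = F" "pot' = pot" using v False by (auto simp: visit_def)
    ultimately show ?thesis using rep by (simp add: represents_def)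
  next
    case True
    let ?m = "min_loop ''xb'' ''xv'' ''v'' nE (flag ''F'' (Var ''v'')) (dist_at (Var ''v'') (Var ''w''))"
    let ?s = "sum_loop ''sm'' ''v'' nE near_guard (Cell ''pot'' (Var ''v''))"
    let ?c = "Ite near_guard (Asg ''pot'' (Var ''v'') (Const 0)) Nop"
    define D where "D = set_dist F w"
    define s1 where "s1 = eval ?m s"
    define s2 where "s2 = eval multiplier_prog s1"
    define s3 where "s3 = eval ?s s2"
    have ag1: "agree {''xb'', ''xv'', ''v'', ''nop''} s s1" unfolding s1_def using agree_eval[of ?m s] by simp
    have ag2: "agree {''m'', ''k'', ''nop''} s1 s2" unfolding s2_def using agree_eval[of multiplier_prog s1] by simp
    have ag3: "agree {''sm'', ''v'', ''nop''} s2 s3" unfolding s3_def using agree_eval[of ?s s2] by simp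
    note A = agreeD[OF ag1] agreeD[OF ag2] agreeD[OF ag3]
    have rd: "ready s1" "ready s2" "ready s3"
      using ready_agree[OF s ag1] ready_agree[OF _ ag2] ready_agree[OF _ ag3] by auto
    have rp: "represents s3 F pot P"
      using represents_agree[OF represents_agree[OF represents_agree[OF rep ag1] ag2] ag3] by simp
    have e: "bval (flag ''F'' (Var ''v'')) s' = (v \<in> F) \<and> (v \<in> F \<longrightarrow> aval (dist_at (Var ''v'') (Var ''w'')) s' = d v w)"
      if v: "v < n" "agree {''xb'', ''xv'', ''v'', ''nop''} s s'" "s' ''v'' 0 = int v" for v s'
      using v(1,3) w representsD(1)[OF rep] readyD(2)[OF s] loadedD(2)[OF readyD(1)[OF s]]
      by (simp add: agreeD[OF v(2)])
    have "\<exists>i<n. i \<in> F" using F fac_less by blast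
    then have nn: "0 \<le> argmin_upto (\<lambda>x. x \<in> F) (\<lambda>x. d x w) n" by (rule argmin_upto_spec(1))
    have "s1 ''xv'' 0 = D"
      unfolding s1_def D_def set_dist_def
      by (rule eval_min_loop(2)[OF _ _ _ e nn]) (use readyD(2)[OF s] in auto)
    then have xv: "s1 ''xv'' 0 = D" "s2 ''xv'' 0 = D" "s3 ''xv'' 0 = D" by (simp_all add: A)
    have "s2 ''m'' 0 = multiplier P D (n + 12)"
      unfolding s2_def using representsD(4)[OF rep] xv by (intro eval_multiplier rd) (simp_all add: A)
    then have m: "s2 ''m'' 0 = multiplier P D (n + 12)" "s3 ''m'' 0 = multiplier P D (n + 12)" by (simp_all add: A)
    have ws: "s2 ''w'' 0 = int w" "s3 ''w'' 0 = int w" using w by (simp_all add: A)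
    have nearset: "{v. v < n \<and> v \<in> near P F w} = near P F w" by (auto simp: near_def)
    have "eval ?s s2 ''sm'' 0 = (\<Sum>v | v < n \<and> v \<in> near P F w. pot v)"
    proof (rule eval_sum_loop)
      fix v s' assume v: "v < n" "agree {''sm'', ''v'', ''nop''} s2 s'" "s' ''v'' 0 = int v"
      have l: "loaded s'" using loaded_agree[OF readyD(1)[OF rd(2)] v(2)] by simp
      have "bval near_guard s' \<longleftrightarrow> v \<in> near P F w"
        using m(1) xv(2) ws(1) v(1,3) w(2) by (intro eval_near_guard[OF l]) (simp_all add: agreeD[OF v(2)] D_def)
      then show "bval near_guard s' = (v \<in> near P F w) \<and> (v \<in> near P F w \<longrightarrow> aval (Cell ''pot'' (Var ''v'')) s' = pot v)"
        using v(1,3) representsD(3)[OF rep] by (simp add: agreeD[OF v(2)] A)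
    qed (use readyD(2)[OF rd(2)] in auto)
    then have sm: "s3 ''sm'' 0 = (\<Sum>v\<in>near P F w. pot v)" by (simp add: s3_def nearset)
    define taken where "taken \<longleftrightarrow> (w \<in> centers \<and> cumulative w \<le> P) \<or> f w \<le> (\<Sum>v\<in>near P F w. pot v)"
    let ?init = "s3(''F'' := (s3 ''F'')(int w := 1), ''cst'' := (s3 ''cst'')(int w := 0))"
    have run: "eval visit_prog s = (if taken then eval (For ''v'' nE ?c) ?init else set_var s3 ''nop'' 0)"
    proof -
      have "bval ?skip s3 \<longleftrightarrow> \<not> taken"
        using ws(2) sm readyD(3,4)[OF rd(3) w(2)] loadedD(3)[OF readyD(1)[OF rd(3)] w(2)] representsD(4)[OF rp]
        by (simp add: taken_def not_less not_le)
      moreover have "eval visit_prog s = eval (Ite ?skip Nop (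
         Asg ''F'' (Var ''w'') (Const 1) ;; Asg ''cst'' (Var ''w'') (Const 0) ;; For ''v'' nE ?c)) s3"
        by (simp only: visit_prog_def eval.simps(2,3) guard True if_True s1_def s2_def s3_def simp_thms)
      ultimately show ?thesis using ws(2) by (simp del: eval.simps(4))
    qed
    show ?thesis
    proof (cases taken)
      case False
      then have "F' = F" "pot' = pot" using v by (auto simp: visit_def taken_def)
      then show ?thesis using run False rp by (simp add: represents_def)
    next
      case taken: True
      then have F': "F' = insert w F" and pot': "pot' = (\<lambda>v. if v \<in> near P F w then 0 else pot v)"
        using v True by (auto simp: visit_def taken_def)
      \<comment> \<open>At this point \<open>w\<close> is already marked open, but
        \<open>near_guard\<close> still uses the distance \<open>xv\<close> and the multiplier
        \<open>m\<close> computed before, so the cleared set is the \<open>near\<close> set of the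
        old \<open>F\<close>.\<close>
      let ?J = "\<lambda>k t. \<forall>v<n. t ''pot'' (int v) = (if v < k \<and> v \<in> near P F w then 0 else pot v)"
      have "?J n (eval (For ''v'' nE ?c) ?init)"
      proof (rule for_rule[where I = ?J])
        fix k t assume k: "k < n" "agree (insert ''v'' (written ?c)) ?init t" "?J k t" "t ''v'' 0 = int k"
        note B = agreeD[OF k(2)]
        have ag: "agree {''F'', ''cst'', ''v'', ''pot'', ''nop''} s3 t" using k(2) by (auto simp: agree_def)
        have l: "loaded t" using loaded_agree[OF readyD(1)[OF rd(3)] ag] by simp
        have "bval near_guard t \<longleftrightarrow> k \<in> near P F w"
          using m(2) xv(3) ws(2) k(1,4) w(2) by (intro eval_near_guard[OF l]) (simp_all add: B D_def)
        then show "?J (Suc k) (eval ?c t)" using k(3,4) by (auto simp: less_Suc_eq)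
      qed (use readyD(2)[OF rd(3)] representsD(3)[OF rp] in auto)
      moreover have "eval (For ''v'' nE ?c) ?init y = ?init y" if "y \<notin> {''v'', ''pot'', ''nop''}" for y
        using that by (intro eval_unwritten) simp
      ultimately show ?thesis
        using run taken rp w(2) by (auto simp: represents_def F' pot' near_def simp del: eval.simps(4))
    qed
  qed
qed

lemma eval_step:
  assumes s: "ready s" and rep: "represents s F pot P" and t: "s ''t'' 0 = int t" "t < length xs"
    and g: "good F pot P" and st: "step (F, pot, P) (xs ! t) = (F', pot', P')"
  shows "represents (eval step_prog s) F' pot' P'" "eval step_prog s ''b'' 0 = int (best F (xs ! t))"
proof -
  define u where "u = xs ! t"
  have u: "u < n" using xs_less nth_mem[OF t(2)] by (auto simp: u_def)
  note S = step_good[OF g u st[folded u_def]]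
  let ?m = "min_loop ''b'' ''bv'' ''w'' nE (is_fac (Var ''w'')) (Plus (Cell ''cst'' (Var ''w'')) (dist_at (Var ''w'') (Var ''u'')))"
  define s1 where "s1 = set_var s ''u'' (int u)"
  define s2 where "s2 = eval ?m s1"
  define b where "b = best F u"
  define p where "p = price F u b"
  have ag1: "agree {''u''} s s1" by (auto simp: s1_def agree_def)
  have ag2: "agree {''b'', ''bv'', ''w'', ''nop''} s1 s2" unfolding s2_def using agree_eval[of ?m s1] by simp
  note A = agreeD[OF ag1] agreeD[OF ag2]
  have rd: "ready s1" "ready s2" using ready_agree[OF s ag1] ready_agree[OF _ ag2] by auto
  have rp: "represents s1 F pot P" "represents s2 F pot P"
    using represents_agree[OF rep ag1] represents_agree[OF _ ag2] by auto
  have e: "bval (is_fac (Var ''w'')) s' = (w \<in> fac) \<and>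
      (w \<in> fac \<longrightarrow> aval (Plus (Cell ''cst'' (Var ''w'')) (dist_at (Var ''w'') (Var ''u''))) s' = price F u w)"
    if w: "w < n" "agree {''b'', ''bv'', ''w'', ''nop''} s1 s'" "s' ''w'' 0 = int w" for w s'
    using w(1,3) u representsD(2)[OF rp(1)] readyD(2)[OF rd(1)] loadedD(2)[OF readyD(1)[OF rd(1)]]
    by (simp add: agreeD[OF w(2)] price_def) (simp add: s1_def)
  have ex: "\<exists>i<n. i \<in> fac" using fac fac_less by (metis ex_in_conv)
  have nn: "0 \<le> argmin_upto (\<lambda>w. w \<in> fac) (price F u) n" using ex by (rule argmin_upto_spec(1))
  have "s2 ''b'' 0 = argmin_upto (\<lambda>w. w \<in> fac) (price F u) n"
    unfolding s2_def by (rule eval_min_loop(1)[OF _ _ _ e]) (use readyD(2)[OF rd(1)] in auto)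
  then have b: "s2 ''b'' 0 = int b" using nn by (simp add: b_def best_def)
  have bv: "s2 ''bv'' 0 = p"
    unfolding s2_def p_def b_def best_def by (rule eval_min_loop(2)[OF _ _ _ e nn]) (use readyD(2)[OF rd(1)] in auto)
  have bn: "b < n" "b \<in> fac" using best_fac fac_less by (auto simp: b_def)
  have su: "s2 ''u'' 0 = int u" by (simp add: A(2)) (simp add: s1_def)
  define s3 where "s3 = s2(''F'' := (s2 ''F'')(int b := 1), ''cst'' := (s2 ''cst'')(int b := 0),
    ''P'' := (s2 ''P'')(0 := P + p), ''pot'' := (s2 ''pot'')(int u := p))"
  have rd3: "ready s3" using rd(2) by (rule ready_agree[where W = "{''F'', ''cst'', ''P'', ''pot''}"]) (auto simp: s3_def agree_def)
  have rp3: "represents s3 (insert b F) (pot(u := p)) (P + p)"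
    using rp(2) bn by (auto simp: represents_def s3_def)
  have P': "P' = P + p" using S(4) by (simp add: p_def b_def)
  have scan: "scan P' n (insert b F, pot(u := p)) = (F', pot')" using S(6) by (simp add: p_def b_def)
  have sub: "insert b F \<subseteq> fac" "insert b F \<noteq> {}" using g bn by (auto simp: good_def)
  have nonneg: "0 \<le> (pot(u := p)) v" for v
    using g price_nonneg[OF bn(2)] by (simp add: good_def p_def)
  have s1_eq: "s(''u'' := (s ''u'')(0 := int u)) = s1" by (simp add: s1_def set_var_def)
  have run: "eval step_prog s = eval (For ''w'' nE visit_prog) s3"
    using t readyD(2)[OF s] b bv su representsD(4)[OF rp(2)]
    by (simp add: step_prog_def s1_eq s2_def[symmetric] s3_def u_def[symmetric] del: eval.simps(4))
  let ?I = "\<lambda>k t. case scan P' k (insert b F, pot(u := p)) of (F1, pot1) \<Rightarrow> represents t F1 pot1 P'"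
  have "?I n (eval (For ''w'' nE visit_prog) s3)"
  proof (rule for_rule[where I = ?I])
    fix k s' assume k: "k < n" "agree (insert ''w'' (written visit_prog)) s3 s'" "?I k s'" "s' ''w'' 0 = int k"
    obtain F1 pot1 where 1: "scan P' k (insert b F, pot(u := p)) = (F1, pot1)" by fastforce
    obtain F2 pot2 where 2: "visit P' k (F1, pot1) = (F2, pot2)" by fastforce
    note I1 = scan_invariant[OF sub nonneg 1]
    have "ready s'" using ready_agree[OF rd3 k(2)] by simp
    then have "represents (eval visit_prog s') F2 pot2 P'"
      using k(1,3,4) 1 2 I1(1,2) by (intro eval_visit[of s' F1 pot1 P' k]) auto
    then show "?I (Suc k) (eval visit_prog s')" using 1 2 by simp
  qed (use readyD(2)[OF rd3] rp3 P' in \<open>auto simp: represents_def split: prod.splits\<close>)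
  then show "represents (eval step_prog s) F' pot' P'" using scan run by simp
  have "eval (For ''w'' nE visit_prog) s3 ''b'' = s3 ''b''" by (intro eval_unwritten) simp
  then show "eval step_prog s ''b'' 0 = int (best F (xs ! t))"
    using run b by (simp add: s3_def b_def u_def)
qed

lemma eval_output:
  assumes inp: "s ''in'' = inp" and F: "\<And>w. w < n \<Longrightarrow> 0 < s ''F'' (int w) \<longleftrightarrow> w \<in> F" "F \<subseteq> {..<n}"
    and b: "s ''b'' 0 = int b"
  shows "output_of (eval output_prog s) = encode_decision (F, b)"
proof -
  let ?p = "Ite (flag ''F'' (Var ''w'')) (
       Asg ''out'' (Var ''ol'') (Var ''w'') ;; Asg ''ol'' (Const 0) (succE (Var ''ol''))) Nop"
  let ?init = "s(''out'' := (s ''out'')(0 := int b), ''ol'' := (s ''ol'')(0 := 1))"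
  let ?L = "\<lambda>k. filter (\<lambda>w. w \<in> F) [0..<k]"
  \<comment> \<open>Cell 0 of the output is taken by the facility of the client, hence the shift by
    one.\<close>
  let ?I = "\<lambda>k t. t ''ol'' 0 = int (Suc (length (?L k))) \<and>
    map (\<lambda>i. t ''out'' (int i)) [0..<Suc (length (?L k))] = int b # map int (?L k)"
  have I: "?I n (eval (For ''w'' nE ?p) ?init)"
  proof (rule for_rule[where I = ?I])
    fix k t assume k: "k < n" "agree (insert ''w'' (written ?p)) ?init t" "?I k t" "t ''w'' 0 = int k"
    note A = agreeD[OF k(2)]
    have flag: "0 < t ''F'' (int k) \<longleftrightarrow> k \<in> F" using F(1)[OF k(1)] by (simp add: A)
    show "?I (Suc k) (eval ?p t)"
    proof (cases "k \<in> F")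
      case False
      then show ?thesis using k(3,4) flag by simp
    next
      case True
      define l where "l = Suc (length (?L k))"
      have ol: "t ''ol'' 0 = int l" and out: "map (\<lambda>i. t ''out'' (int i)) [0..<l] = int b # map int (?L k)"
        using k(3) by (simp_all add: l_def)
      have ev: "eval ?p t = t(''out'' := (t ''out'')(int l := int k), ''ol'' := (t ''ol'')(0 := int l + 1))"
        using True flag k(4) ol by simp
      have "map (\<lambda>i. ((t ''out'')(int l := int k)) (int i)) [0..<Suc l] = int b # map int (?L k) @ [int k]"
      proof -
        have "map (\<lambda>i. ((t ''out'')(int l := int k)) (int i)) [0..<l] = map (\<lambda>i. t ''out'' (int i)) [0..<l]"
          by (rule map_cong) auto
        moreover have "[0..<Suc l] = [0..<l] @ [l]" by simp
        ultimately show ?thesis using out by (simp only: map_append) simp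
      qed
      moreover have "?L (Suc k) = ?L k @ [k]" using True by simp
      ultimately show ?thesis unfolding ev by (simp add: l_def del: upt_Suc)
    qed
  qed (use inp in auto)
  have s_list: "sorted_list_of_set F = ?L n"
  proof -
    have "set (?L n) = F" using F(2) by auto
    moreover have "sorted (?L n)" "distinct (?L n)" by (auto intro: sorted_wrt_filter)
    ultimately show ?thesis by (metis sorted_list_of_set.idem_if_sorted_distinct)
  qed
  have "output_of (eval output_prog s) = int b # map int (?L n)"
    using I b by (simp add: output_prog_def output_of_def nat_add_distrib del: eval.simps(4) upt_Suc)
  then show ?thesis by (simp add: encode_decision_def s_list)
qed

text \<open>All arrivals in the input are replayed. After the last round \<open>F\<close> marks the
  open facilities and \<open>b\<close> still holds the connection of the last client.\<close>

lemma eval_main: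
  assumes s: "s ''in'' = inp" "\<And>y i. y \<notin> {''in'', ''inlen''} \<Longrightarrow> s y i = 0"
  shows "output_of (eval main_prog s) = encode_decision (decision xs)"
proof -
  define s1 where "s1 = eval scale_prog s"
  define s2 where "s2 = eval dist_prog s1"
  define s3 where "s3 = eval cost_prog s2"
  define s4 where "s4 = eval radius_prog s3"
  define s5 where "s5 = eval greedy_prog s4"
  define s6 where "s6 = eval cumulative_prog s5"
  define s7 where "s7 = eval table_prog s6"
  define s8 where "s8 = eval (For ''t'' (in_at lenE) step_prog) s7"
  have A: "s1 y = s y" if "y \<notin> written scale_prog" for y using that unfolding s1_def by (rule eval_unwritten)
  have B: "s2 y = s1 y" if "y \<notin> written dist_prog" for y using that unfolding s2_def by (rule eval_unwritten)
  have C: "s3 y = s2 y" if "y \<notin> written cost_prog" for y using that unfolding s3_def by (rule eval_unwritten)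
  have D: "s4 y = s3 y" if "y \<notin> written radius_prog" for y using that unfolding s4_def by (rule eval_unwritten)
  have E: "s5 y = s4 y" if "y \<notin> written greedy_prog" for y using that unfolding s5_def by (rule eval_unwritten)
  have G: "s6 y = s5 y" if "y \<notin> written cumulative_prog" for y using that unfolding s6_def by (rule eval_unwritten)
  have H: "s7 y = s6 y" if "y \<notin> written table_prog" for y using that unfolding s7_def by (rule eval_unwritten)
  have M1: "s1 ''M'' 0 = M" unfolding s1_def using s(1) by (rule eval_scale)
  have in1: "s1 ''in'' = inp" using s by (simp add: A)
  have dd: "s2 ''dd'' (pair_index (int n) (int u) (int v)) = d u v" if "u < n" "v < n" for u v
    unfolding s2_def using in1 M1 that by (rule eval_dist)
  have in2: "s2 ''in'' = inp" "s2 ''M'' 0 = M" using in1 M1 by (simp_all add: B)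
  have fc: "s3 ''fc'' (int u) = f u" "s3 ''cst'' (int u) = f u" if "u < n" for u
    unfolding s3_def using eval_cost[OF in2 that] by auto
  have l3: "loaded s3" using dd fc in2 by (simp add: loaded_def C)
  have rad: "s4 ''rad'' (int w) = radius w" if "w < n" for w unfolding s4_def using l3 that by (rule eval_radius)
  have l4: "loaded s4" using l3 by (simp add: loaded_def D)
  have zero: "s4 ''dn'' w = 0" "s4 ''ch'' w = 0" for w using s(2) by (simp_all add: D C B A)
  have ch: "0 < s5 ''ch'' (int w) \<longleftrightarrow> w \<in> centers" if "w < n" for w
    unfolding s5_def using l4 rad zero that by (rule eval_greedy)
  have l5: "loaded s5" using l4 by (simp add: loaded_def E)
  have rad5: "s5 ''rad'' (int w) = radius w" if "w < n" for w using rad[OF that] by (simp add: E)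
  have cum: "s6 ''cum'' (int w) = cumulative w" if "w < n" for w
    unfolding s6_def using l5 rad5 ch that by (rule eval_cumulative)
  have in6: "s6 ''in'' = inp" using loadedD(1)[OF l5] by (simp add: G)
  have tab: "s7 ''aa'' (int k) = int (level_scale k)" "s7 ''bb'' (int k) = int (level_ratio k)" if "k < n + 12" for k
    unfolding s7_def using eval_table[where s = s6, OF in6 that] by auto
  have rd: "ready s7" using l5 ch cum tab by (simp add: ready_def loaded_def G H)
  have rp: "represents s7 {} (\<lambda>_. 0) 0"
    using s(2) fc(2) by (simp add: represents_def A B C D E G H)
  note gf = good_final[OF xs_less] and fs = final_step[OF xs_less]
  let ?I = "\<lambda>k t. represents t (opens xs k) (pots xs k) (paid xs k) \<and>
    (0 < k \<longrightarrow> t ''b'' 0 = int (best (opens xs (k - 1)) (xs ! (k - 1))))"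
  have I: "?I (length xs) s8"
    unfolding s8_def
  proof (rule for_rule[where I = ?I])
    fix k t assume k: "k < length xs" "agree (insert ''t'' (written step_prog)) s7 t" "?I k t" "t ''t'' 0 = int k"
    have "ready t" using ready_agree[OF rd k(2)] by simp
    then show "?I (Suc k) (eval step_prog t)"
      using eval_step[where s = t and t = k, OF _ _ k(4,1) gf fs[OF k(1)]] k by simp
  next
    show "aval (in_at lenE) s7 = int (length xs)" using readyD(2)[OF rd] by simp
    show "?I 0 s7" using rp by (simp add: opens_def pots_def paid_def final_def)
    show "?I k (set_var t ''t'' j)" if "?I k t" for k t j using that by (simp add: represents_def)
  qed simp
  have in8: "s8 ''in'' = inp" unfolding s8_def using readyD(2)[OF rd] by (subst eval_unwritten) simp_all
  have "output_of (eval output_prog s8) =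
      encode_decision (opens xs (length xs), best (opens xs (length xs - 1)) (xs ! (length xs - 1)))"
  proof (rule eval_output[where s = s8, OF in8])
    show "0 < s8 ''F'' (int w) \<longleftrightarrow> w \<in> opens xs (length xs)" if "w < n" for w
      using I that by (auto dest: representsD(1))
    show "opens xs (length xs) \<subseteq> {..<n}" using opens_fac[OF xs_less order_refl] fac by auto
    show "s8 ''b'' 0 = int (best (opens xs (length xs - 1)) (xs ! (length xs - 1)))"
      using I xs_nonempty by simp
  qed
  moreover have "(opens xs (length xs), best (opens xs (length xs - 1)) (xs ! (length xs - 1))) = decision xs"
    using xs_nonempty by (simp add: decision_def opens_def butlast_conv_take last_conv_nth)
  moreover have "eval main_prog s = eval output_prog s8"
    by (simp add: main_prog_def s1_def s2_def s3_def s4_def s5_def s6_def s7_def s8_def del: eval.simps(4))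
  ultimately show ?thesis by simp
qed

end

section \<open>Scaling and encoding of instances\<close>

definition cost_of :: "fl_instance \<Rightarrow> nat \<Rightarrow> rat" where
  "cost_of I u = (if u \<in> facilities I then opening_cost I u else 0)"

abbreviation numer :: "rat \<Rightarrow> int" where "numer q \<equiv> fst (quotient_of q)"
abbreviation denom :: "rat \<Rightarrow> int" where "denom q \<equiv> snd (quotient_of q)"

text \<open>The factor \<open>n!\<close> makes the radii of the greedy algorithm integral, too.\<close>

definition scale :: "fl_instance \<Rightarrow> int" where
  "scale I = (\<Prod>u<num_vertices I. \<Prod>v<num_vertices I. denom (distance I u v)) *
     (\<Prod>u<num_vertices I. denom (cost_of I u)) * fact (num_vertices I)"

text \<open>The floor makes this an integer for all arguments and agrees with the integer division
  of the program; on vertices it changes nothing.\<close>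

definition scaled_distance :: "fl_instance \<Rightarrow> nat \<Rightarrow> nat \<Rightarrow> int" where
  "scaled_distance I u v = \<lfloor>of_int (scale I) * distance I u v\<rfloor>"

definition scaled_cost :: "fl_instance \<Rightarrow> nat \<Rightarrow> int" where
  "scaled_cost I u = \<lfloor>of_int (scale I) * cost_of I u\<rfloor>"

definition fl_algorithm :: online_alg where
  "fl_algorithm I Xhat xs = fl_data.decision (num_vertices I) (facilities I) (scaled_distance I)
     (scaled_cost I) Xhat xs"

lemma denom_pos: "0 < denom q"
  by (rule quotient_of_denom_pos') 

lemma scale_pos: "0 < scale I"
  unfolding scale_def using denom_pos by (intro mult_pos_pos prod_pos) auto

lemma floor_scaled: "\<lfloor>of_int m * q\<rfloor> = m * numer q div denom q"
proof -
  have "q = of_int (numer q) / of_int (denom q)"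
    using quotient_of_div[of q "numer q" "denom q"] by simp
  then have "of_int m * q = of_int m * (of_int (numer q) / of_int (denom q))" by (rule arg_cong)
  also have "\<dots> = of_int (m * numer q) / of_int (denom q)" by simp
  finally show ?thesis by (simp only: floor_divide_of_int_eq)
qed

text \<open>The factor \<open>m\<close> cancels the denominator and \<open>k\<close> survives as a
  divisor; it is applied with \<open>k = n!\<close>.\<close>

lemma scaled_exact:
  assumes "denom q dvd m"
  shows "of_int \<lfloor>of_int (m * k) * q\<rfloor> = of_int (m * k) * q" "k dvd \<lfloor>of_int (m * k) * q\<rfloor>"
proof -
  obtain c where c: "m = denom q * c" using assms by (auto elim: dvdE)
  have q: "q = of_int (numer q) / of_int (denom q)"
    using quotient_of_div[of q "numer q" "denom q"] by simp
  have "of_int (m * k) * q = of_int (denom q) * of_int c * of_int k * (of_int (numer q) / of_int (denom q))"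
    using q c by simp
  also have "\<dots> = of_int (k * (c * numer q))" using denom_pos[of q] by simp
  finally have "of_int (m * k) * q = of_int (k * (c * numer q))" .
  then show "of_int \<lfloor>of_int (m * k) * q\<rfloor> = of_int (m * k) * q" "k dvd \<lfloor>of_int (m * k) * q\<rfloor>"
    by (simp_all only: floor_of_int dvd_triv_left)
qed

lemma scaled_distance_exact:
  assumes "u < num_vertices I" "v < num_vertices I"
  shows "of_int (scaled_distance I u v) = of_int (scale I) * distance I u v"
    "fact (num_vertices I) dvd scaled_distance I u v"
proof -
  have "denom (distance I u v) dvd (\<Prod>v<num_vertices I. denom (distance I u v))"
    using assms by (intro dvd_prodI) auto
  also have "\<dots> dvd (\<Prod>u<num_vertices I. \<Prod>v<num_vertices I. denom (distance I u v))"
    using assms by (intro dvd_prodI) auto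
  finally have dv: "denom (distance I u v) dvd (\<Prod>u<num_vertices I. \<Prod>v<num_vertices I. denom (distance I u v)) *
     (\<Prod>u<num_vertices I. denom (cost_of I u))" by (rule dvd_mult2)
  from scaled_exact[OF dv, of "fact (num_vertices I)"]
  show "of_int (scaled_distance I u v) = of_int (scale I) * distance I u v"
    "fact (num_vertices I) dvd scaled_distance I u v"
    unfolding scaled_distance_def scale_def by blast+
qed

lemma scaled_cost_exact:
  assumes "u < num_vertices I"
  shows "of_int (scaled_cost I u) = of_int (scale I) * cost_of I u"
    "fact (num_vertices I) dvd scaled_cost I u"
proof -
  have "denom (cost_of I u) dvd (\<Prod>u<num_vertices I. denom (cost_of I u))"
    using assms by (intro dvd_prodI) auto
  then have dv: "denom (cost_of I u) dvd (\<Prod>u<num_vertices I. \<Prod>v<num_vertices I. denom (distance I u v)) *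
     (\<Prod>u<num_vertices I. denom (cost_of I u))" by (rule dvd_mult)
  from scaled_exact[OF dv, of "fact (num_vertices I)"]
  show "of_int (scaled_cost I u) = of_int (scale I) * cost_of I u"
    "fact (num_vertices I) dvd scaled_cost I u"
    unfolding scaled_cost_def scale_def by blast+
qed

lemma fl_scaled:
  assumes wf: "fl_wf I" and Xhat: "Xhat \<subseteq> vertices I"
  shows "fl (num_vertices I) (facilities I) (scaled_distance I) (scaled_cost I) Xhat"
proof -
  let ?n = "num_vertices I"
  have S: "(0::rat) < of_int (scale I)" using scale_pos by simp
  interpret Metric_space "vertices I" "\<lambda>u v. real_of_rat (distance I u v)"
    using wf by (simp add: fl_wf_def)
  have sym: "distance I u v = distance I v u" for u v using commute[of u v] by simp
  have nn: "0 \<le> distance I u v" for u v using nonneg[of u v] by simp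
  have tri: "distance I u w \<le> distance I u v + distance I v w" if "u < ?n" "v < ?n" "w < ?n" for u v w
  proof -
    have "real_of_rat (distance I u w) \<le> real_of_rat (distance I u v + distance I v w)"
      using triangle[of u v w] that by (simp add: vertices_def of_rat_add)
    then show ?thesis by (simp only: of_rat_less_eq)
  qed
  have zero: "distance I u v = 0 \<longleftrightarrow> u = v" if "u < ?n" "v < ?n" for u v
    using zero[of u v] that by (simp add: vertices_def)
  have fact_dvd: "int k dvd fact ?n" if "0 < k" "k \<le> ?n" for k
  proof -
    have "k dvd fact ?n" using that by (intro dvd_fact) auto
    then have "int k dvd int (fact ?n)" by (simp only: of_nat_dvd_iff)
    then show ?thesis by simp
  qed
  note ed = scaled_distance_exact[of _ I] and ec = scaled_cost_exact[of _ I]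
  show ?thesis
  proof
    show "facilities I \<subseteq> {..<?n}" "facilities I \<noteq> {}" using wf by (auto simp: fl_wf_def vertices_def)
    show "Xhat \<subseteq> {..<?n}" using Xhat by (simp add: vertices_def)
    show "0 \<le> scaled_distance I u v" for u v using nn[of u v] S by (simp add: scaled_distance_def)
    show "scaled_distance I u v = scaled_distance I v u" for u v using sym[of u v] by (simp add: scaled_distance_def)
    show "scaled_distance I u v = 0 \<longleftrightarrow> u = v" if "u < ?n" "v < ?n" for u v
    proof -
      have "scaled_distance I u v = 0 \<longleftrightarrow> (of_int (scaled_distance I u v) :: rat) = 0" by simp
      also have "\<dots> \<longleftrightarrow> u = v" using ed(1)[OF that] zero[OF that] S by simp
      finally show ?thesis .
    qed
    show "scaled_distance I u w \<le> scaled_distance I u v + scaled_distance I v w"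
      if "u < ?n" "v < ?n" "w < ?n" for u v w
    proof -
      have "(of_int (scaled_distance I u w) :: rat) \<le> of_int (scaled_distance I u v + scaled_distance I v w)"
        using mult_left_mono[OF tri[OF that] less_imp_le[OF S]] ed(1) that by (simp add: distrib_left)
      then show ?thesis by (simp only: of_int_le_iff)
    qed
    show "0 \<le> scaled_cost I w" if "w \<in> facilities I" for w
      using wf that S by (simp add: scaled_cost_def cost_of_def fl_wf_def)
    show "int k dvd scaled_distance I u v" if "0 < k" "k \<le> ?n" "u < ?n" "v < ?n" for k u v
      using fact_dvd[OF that(1,2)] ed(2)[OF that(3,4)] by (rule dvd_trans)
    show "int k dvd scaled_cost I w" if "0 < k" "k \<le> ?n" "w \<in> facilities I" for k w
    proof -
      have "w < ?n" using wf that by (auto simp: fl_wf_def vertices_def)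
      then show ?thesis using fact_dvd[OF that(1,2)] ec(2) dvd_trans by blast
    qed
  qed
qed

section \<open>Decoding the input array\<close>

lemma length_concat_uniform: "(\<And>x. x \<in> set xss \<Longrightarrow> length x = k) \<Longrightarrow> length (concat xss) = length xss * k"
  by (induction xss) auto

lemma nth_concat_uniform:
  "(\<And>x. x \<in> set xss \<Longrightarrow> length x = k) \<Longrightarrow> i < length xss \<Longrightarrow> j < k \<Longrightarrow> concat xss ! (i * k + j) = xss ! i ! j"
proof (induction xss arbitrary: i)
  case (Cons x xss)
  then show ?case by (cases i) (auto simp: nth_append)
qed simp

lemma nth_middle: "length P = p \<Longrightarrow> j < length Q \<Longrightarrow> (P @ Q @ R) ! (p + j) = Q ! j"
  by (auto simp: nth_append)

lemma grid_nth:
  assumes "u < n" "v < n"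
  shows "concat (map (\<lambda>u. map (g u) [0..<n]) [0..<n]) ! (u * n + v) = g u v"
proof -
  let ?X = "map (\<lambda>u. map (g u) [0..<n]) [0..<n]"
  have "concat ?X ! (u * n + v) = ?X ! u ! v"
    by (rule nth_concat_uniform) (use assms in auto)
  then show ?thesis using assms by simp
qed

lemma program_input_encode:
  assumes legal: "legal_input I Xhat xs" and ne: "xs \<noteq> []"
  shows "program_input (num_vertices I) (facilities I) (scaled_distance I) (scaled_cost I) Xhat
    (input_store (encode_input (I, Xhat, xs)) ''in'') xs (scale I)
    (\<lambda>u v. numer (distance I u v)) (\<lambda>u v. denom (distance I u v))
    (\<lambda>u. numer (cost_of I u)) (\<lambda>u. denom (cost_of I u))"
    and "num_vertices I \<le> length (encode_input (I, Xhat, xs))"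
    and "length xs \<le> length (encode_input (I, Xhat, xs))"
proof -
  define n where "n = num_vertices I"
  define H where "H = [int n]"
  define E where "E = concat (map (\<lambda>u. map (\<lambda>v. of_bool ({u, v} \<in> edges I) :: int) [0..<n]) [0..<n])"
  define G where "G = concat (map (\<lambda>u. map (\<lambda>v. encode_rat (distance I u v)) [0..<n]) [0..<n])"
  define D where "D = concat G"
  define Fa where "Fa = map (\<lambda>u. of_bool (u \<in> facilities I) :: int) [0..<n]"
  define C where "C = concat (map (\<lambda>u. encode_rat (cost_of I u)) [0..<n])"
  define X where "X = map (\<lambda>u. of_bool (u \<in> Xhat) :: int) [0..<n]"
  define Z where "Z = int (length xs) # map int xs"
  define ks where "ks = encode_input (I, Xhat, xs)"
  have ks: "ks = H @ E @ D @ Fa @ C @ X @ Z"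
    by (simp add: ks_def encode_input_def Let_def H_def E_def D_def G_def Fa_def C_def X_def Z_def n_def cost_of_def)
  have lenG: "length G = n * n"
    unfolding G_def by (subst length_concat_uniform[where k = n]) auto
  have setG: "x \<in> set G \<Longrightarrow> length x = 2" for x by (auto simp: G_def encode_rat_def)
  have len: "length H = 1" "length E = n * n" "length D = n * n * 2" "length Fa = n" "length C = n * 2"
    "length X = n" "length Z = 1 + length xs"
    unfolding H_def E_def D_def Fa_def C_def X_def Z_def
    using lenG setG
    by (simp_all add: length_concat_uniform[where k = n] length_concat_uniform[where k = 2] encode_rat_def)
      (subst length_concat_uniform[where k = n] length_concat_uniform[where k = 2]; auto simp: encode_rat_def)+
  have at: "input_store ks ''in'' (int i) = ks ! i" if "i < length ks" for i
    using that by (simp add: input_store_def)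
  have lks: "length ks = 1 + n * n + n * n * 2 + n + n * 2 + n + (1 + length xs)" by (simp add: ks len)
  show "num_vertices I \<le> length (encode_input (I, Xhat, xs))" "length xs \<le> length (encode_input (I, Xhat, xs))"
    using lks by (simp_all add: ks_def[symmetric] n_def[symmetric])
  \<comment> \<open>Every address computation below reduces to reading an offset \<open>j\<close> in
    a block \<open>Q\<close> behind a prefix of known length.\<close>
  have pre: "input_store ks ''in'' (int (p + j)) = Q ! j"
    if "ks = P @ Q @ R" "length P = p" "j < length Q" for P Q R p j
    using that nth_middle[of P p j Q R] by (subst at) auto
  have uv: "u * n + v < n * n" if "u < n" "v < n" for u v
  proof -
    have "u * n + v < Suc u * n" using that by simp
    also have "\<dots> \<le> n * n" using that by (intro mult_le_mono1) simp
    finally show ?thesis .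
  qed
  have dist: "input_store ks ''in'' (int (1 + n * n + ((u * n + v) * 2 + j))) = encode_rat (distance I u v) ! j"
    if "u < n" "v < n" "j < 2" for u v j
  proof -
    have "input_store ks ''in'' (int (1 + n * n + ((u * n + v) * 2 + j))) = D ! ((u * n + v) * 2 + j)"
      using uv[OF that(1,2)] that(3)
      by (intro pre[of "H @ E" D "Fa @ C @ X @ Z"]) (simp_all add: ks len)
    also have "\<dots> = G ! (u * n + v) ! j"
      unfolding D_def using setG lenG uv[OF that(1,2)] that(3) by (intro nth_concat_uniform) auto
    also have "G ! (u * n + v) = encode_rat (distance I u v)" unfolding G_def using that by (simp add: grid_nth)
    finally show ?thesis .
  qed
  have cost: "input_store ks ''in'' (int (1 + n * n + n * n * 2 + n + (u * 2 + j))) = encode_rat (cost_of I u) ! j"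
    if "u < n" "j < 2" for u j
  proof -
    have "input_store ks ''in'' (int (1 + n * n + n * n * 2 + n + (u * 2 + j))) = C ! (u * 2 + j)"
      using that by (intro pre[of "H @ E @ D @ Fa" C "X @ Z"]) (simp_all add: ks len)
    also have "\<dots> = map (\<lambda>u. encode_rat (cost_of I u)) [0..<n] ! u ! j"
      unfolding C_def using that by (intro nth_concat_uniform) (auto simp: encode_rat_def)
    finally show ?thesis using that by simp
  qed
  have legal': "fl_wf I" "Xhat \<subseteq> vertices I" "set xs \<subseteq> {..<n}"
    using legal by (auto simp: legal_input_def vertices_def n_def)
  interpret fl n "facilities I" "scaled_distance I" "scaled_cost I" Xhat
    unfolding n_def using legal' by (intro fl_scaled)
  show "program_input (num_vertices I) (facilities I) (scaled_distance I) (scaled_cost I) Xhat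
    (input_store (encode_input (I, Xhat, xs)) ''in'') xs (scale I)
    (\<lambda>u v. numer (distance I u v)) (\<lambda>u v. denom (distance I u v))
    (\<lambda>u. numer (cost_of I u)) (\<lambda>u. denom (cost_of I u))"
    unfolding ks_def[symmetric] n_def[symmetric]
  proof
    show "input_store ks ''in'' 0 = int n" using at[of 0] lks by (simp add: ks H_def)
    show "input_store ks ''in'' (num_index (int n) (int u) (int v)) = numer (distance I u v)"
      if "u < n" "v < n" for u v
      using dist[OF that, of 0] by (simp add: num_index_def pair_index_def encode_rat_def algebra_simps)
    show "input_store ks ''in'' (num_index (int n) (int u) (int v) + 1) = denom (distance I u v)"
      if "u < n" "v < n" for u v
      using dist[OF that, of 1] by (simp add: num_index_def pair_index_def encode_rat_def algebra_simps)
    show "0 < input_store ks ''in'' (fac_index (int n) (int u)) \<longleftrightarrow> u \<in> facilities I" if "u < n" for u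
    proof -
      have "input_store ks ''in'' (int (1 + n * n + n * n * 2 + u)) = Fa ! u"
        using that by (intro pre[of "H @ E @ D" Fa "C @ X @ Z"]) (simp_all add: ks len)
      moreover have "fac_index (int n) (int u) = int (1 + n * n + n * n * 2 + u)" by (simp add: fac_index_def)
      ultimately show ?thesis using that by (simp add: Fa_def)
    qed
    show "input_store ks ''in'' (cnum_index (int n) (int u)) = numer (cost_of I u)" if "u < n" for u
      using cost[OF that, of 0] by (simp add: cnum_index_def encode_rat_def algebra_simps)
    show "input_store ks ''in'' (cnum_index (int n) (int u) + 1) = denom (cost_of I u)" if "u < n" for u
      using cost[OF that, of 1] by (simp add: cnum_index_def encode_rat_def algebra_simps)
    show "0 < input_store ks ''in'' (xh_index (int n) (int u)) \<longleftrightarrow> u \<in> Xhat" if "u < n" for u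
    proof -
      have "input_store ks ''in'' (int (1 + n * n + n * n * 2 + n + n * 2 + u)) = X ! u"
        using that by (intro pre[of "H @ E @ D @ Fa @ C" X Z]) (simp_all add: ks len)
      moreover have "xh_index (int n) (int u) = int (1 + n * n + n * n * 2 + n + n * 2 + u)" by (simp add: xh_index_def)
      ultimately show ?thesis using that by (simp add: X_def)
    qed
    show "input_store ks ''in'' (len_index (int n)) = int (length xs)"
    proof -
      have "input_store ks ''in'' (int (1 + n * n + n * n * 2 + n + n * 2 + n + 0)) = Z ! 0"
        by (intro pre[of "H @ E @ D @ Fa @ C @ X" Z "[]"]) (simp_all add: ks len)
      moreover have "len_index (int n) = int (1 + n * n + n * n * 2 + n + n * 2 + n + 0)" by (simp add: len_index_def)
      ultimately show ?thesis by (simp add: Z_def)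
    qed
    show "input_store ks ''in'' (client_index (int n) (int t)) = int (xs ! t)" if "t < length xs" for t
    proof -
      have "input_store ks ''in'' (int (1 + n * n + n * n * 2 + n + n * 2 + n + Suc t)) = Z ! Suc t"
        using that by (intro pre[of "H @ E @ D @ Fa @ C @ X" Z "[]"]) (simp_all add: ks len)
      moreover have "client_index (int n) (int t) = int (1 + n * n + n * n * 2 + n + n * 2 + n + Suc t)"
        by (simp add: client_index_def len_index_def)
      ultimately show ?thesis using that by (simp add: Z_def)
    qed
    show "scale I = (\<Prod>u<n. \<Prod>v<n. denom (distance I u v)) * (\<Prod>u<n. denom (cost_of I u)) * fact n"
      by (simp add: scale_def n_def)
    show "scale I * numer (distance I u v) div denom (distance I u v) = scaled_distance I u v" for u v
      by (simp add: scaled_distance_def floor_scaled)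
    show "scale I * numer (cost_of I u) div denom (cost_of I u) = scaled_cost I u" for u
      by (simp add: scaled_cost_def floor_scaled)
  qed (use legal' ne in auto)
qed

text \<open>Every loop bound is at most \<open>n + 14\<close> or the number of arrivals, and both
  \<open>n\<close> and that number are at most the input length; hence
  \<open>K = 14\<close>.\<close>

lemma polynomial_time_fl_algorithm: "polynomial_time fl_algorithm"
  unfolding polynomial_time_def
proof (rule polytime_on_compile[OF main_prog_well_formed, where K = 14])
  fix x :: "fl_instance \<times> nat set \<times> nat list" and a s
  assume x: "x \<in> {(I, Xhat, xs). legal_input I Xhat xs \<and> xs \<noteq> []}"
    and a: "a \<in> bounds main_prog" and s: "s ''in'' = input_store (encode_input x) ''in''"
  obtain I Xhat xs where x': "x = (I, Xhat, xs)" "legal_input I Xhat xs" "xs \<noteq> []" using x by auto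
  note P = program_input_encode[OF x'(2,3)]
  have in0: "input_store (encode_input x) ''in'' 0 = int (num_vertices I)"
    and inl: "input_store (encode_input x) ''in'' (len_index (int (num_vertices I))) = int (length xs)"
    using program_input.inp_n[OF P(1)] program_input.inp_len[OF P(1)] by (simp_all add: x')
  have "aval a s \<le> int (num_vertices I) + 14 \<or> aval a s = int (length xs)"
    using a in0 inl unfolding main_prog_bounds by (auto simp: s)
  then show "aval a s \<le> int (length (encode_input x) + 14)" using P(2,3) by (auto simp: x')
next
  fix x :: "fl_instance \<times> nat set \<times> nat list"
  assume x: "x \<in> {(I, Xhat, xs). legal_input I Xhat xs \<and> xs \<noteq> []}"
  obtain I Xhat xs where x': "x = (I, Xhat, xs)" "legal_input I Xhat xs" "xs \<noteq> []" using x by auto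
  interpret program_input "num_vertices I" "facilities I" "scaled_distance I" "scaled_cost I" Xhat
    "input_store (encode_input (I, Xhat, xs)) ''in''" xs "scale I"
    "\<lambda>u v. numer (distance I u v)" "\<lambda>u v. denom (distance I u v)"
    "\<lambda>u. numer (cost_of I u)" "\<lambda>u. denom (cost_of I u)"
    using program_input_encode(1)[OF x'(2,3)] .
  have "output_of (eval main_prog (input_store (encode_input (I, Xhat, xs)))) = encode_decision (decision xs)"
    by (rule eval_main) (auto simp: input_store_def)
  then show "output_of (eval main_prog (input_store (encode_input x))) =
      encode_decision (case x of (I, Xhat, xs) \<Rightarrow> fl_algorithm I Xhat xs)"
    by (simp add: x' fl_algorithm_def)
qed

section \<open>Feasibility and competitive ratio\<close>

context fl
begin

lemma decision_take:
  assumes "i < length xs"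
  shows "decision (take (Suc i) xs) = (opens xs (Suc i), best (opens xs i) (xs ! i))"
  using assms by (simp add: decision_def opens_def take_Suc_conv_app_nth butlast_append)

end

lemma feasible_fl_algorithm: "feasible fl_algorithm"
  unfolding feasible_def
proof (intro allI impI)
  fix I Xhat xs assume legal: "legal_input I Xhat xs \<and> xs \<noteq> []"
  then have wf: "fl_wf I" "Xhat \<subseteq> vertices I" and xs: "set xs \<subseteq> {..<num_vertices I}" "xs \<noteq> []"
    by (auto simp: legal_input_def vertices_def)
  interpret fl "num_vertices I" "facilities I" "scaled_distance I" "scaled_cost I" Xhat
    using wf by (rule fl_scaled)
  define l where "l = length xs - 1"
  have l: "l < length xs" "Suc l = length xs" using xs by (auto simp: l_def)
  have A: "fl_algorithm I Xhat xs = (opens xs (Suc l), best (opens xs l) (xs ! l))"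
    using decision_take[OF l(1)] l(2) by (simp add: fl_algorithm_def)
  have "best (opens xs l) (xs ! l) \<in> opens xs (Suc l)"
    using step_good(5)[OF good_final[OF xs(1)] nth_less[OF xs(1)] final_step[OF xs(1)], of l] l(1) by simp
  moreover have "opens xs (Suc l) \<subseteq> opened fl_algorithm I Xhat xs"
    unfolding opened_def using decision_take[OF l(1)] l(1) by (auto simp: fl_algorithm_def intro!: bexI[of _ l])
  moreover have "opens xs (Suc l) \<subseteq> facilities I" using opens_fac[OF xs(1)] l by simp
  ultimately show "fst (fl_algorithm I Xhat xs) \<subseteq> facilities I \<and>
      snd (fl_algorithm I Xhat xs) \<in> opened fl_algorithm I Xhat xs"
    using A by auto
qed

text \<open>After multiplication by the scale, openings cost at most \<open>3 * paid\<close> and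
  connections at most \<open>paid\<close>, whence the factor 4. An optimal solution serves as the
  reference in \<open>paid_le\<close>.\<close>

lemma competitive_fl_algorithm:
  "competitive fl_algorithm (\<lambda>e. 4 * (26 * real (depth e) + 28))"
  unfolding competitive_def
proof (intro allI impI)
  fix I Xhat xs assume legal: "legal_input I Xhat xs"
  then have wf: "fl_wf I" "Xhat \<subseteq> vertices I" "set xs \<subseteq> vertices I" and xs: "set xs \<subseteq> {..<num_vertices I}"
    and dist: "distinct xs"
    by (auto simp: legal_input_def vertices_def)
  interpret fl "num_vertices I" "facilities I" "scaled_distance I" "scaled_cost I" Xhat
    using wf(1,2) by (rule fl_scaled)
  let ?n = "num_vertices I"
  let ?M = "of_int (scale I) :: rat"
  define L where "L = length xs"
  define e where "e = prediction_error (set xs) Xhat"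
  have dec: "fl_algorithm I Xhat (take (Suc i) xs) = (opens xs (Suc i), best (opens xs i) (xs ! i))" if "i < L" for i
    using decision_take[of i xs] that by (simp add: fl_algorithm_def L_def)
  have opened: "opened fl_algorithm I Xhat xs = opens xs L"
  proof
    show "opened fl_algorithm I Xhat xs \<subseteq> opens xs L"
      unfolding opened_def L_def[symmetric]
    proof (rule UN_least)
      fix i assume "i \<in> {..<L}"
      then show "fst (fl_algorithm I Xhat (take (Suc i) xs)) \<subseteq> opens xs L"
        using dec[of i] opens_mono[OF xs, of "Suc i" L] by (simp add: L_def)
    qed
    show "opens xs L \<subseteq> opened fl_algorithm I Xhat xs"
    proof (cases L)
      case 0
      then show ?thesis by (simp add: opens_def final_def)
    next
      case (Suc l)
      then show ?thesis unfolding opened_def L_def[symmetric] using dec[of l] by (auto intro!: bexI[of _ l])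
    qed
  qed
  have best_n: "best F u < ?n" for F u using best_fac fac_less by blast
  have "?M * online_cost fl_algorithm I Xhat xs =
      (\<Sum>w\<in>opens xs L. ?M * opening_cost I w) + (\<Sum>i<L. ?M * distance I (xs ! i) (best (opens xs i) (xs ! i)))"
    unfolding online_cost_def opened L_def[symmetric] using dec by (simp add: distrib_left sum_distrib_left)
  also have "(\<Sum>w\<in>opens xs L. ?M * opening_cost I w) = (\<Sum>w\<in>opens xs L. of_int (scaled_cost I w))"
    using opens_fac[OF xs, of L] fac_less scaled_cost_exact(1)[of _ I]
    by (intro sum.cong) (auto simp: cost_of_def L_def)
  also have "(\<Sum>i<L. ?M * distance I (xs ! i) (best (opens xs i) (xs ! i))) =
      (\<Sum>i<L. of_int (scaled_distance I (xs ! i) (best (opens xs i) (xs ! i))))"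
    using scaled_distance_exact(1)[of _ I] nth_less[OF xs] best_n by (intro sum.cong) (auto simp: L_def)
  also have "(\<Sum>w\<in>opens xs L. of_int (scaled_cost I w)) + (\<Sum>i<L. of_int (scaled_distance I (xs ! i) (best (opens xs i) (xs ! i)))) =
      (of_int ((\<Sum>w\<in>opens xs L. scaled_cost I w) + (\<Sum>i<L. scaled_distance I (xs ! i) (best (opens xs i) (xs ! i)))) :: rat)"
    by simp
  also have "\<dots> \<le> of_int (4 * paid xs L)"
    unfolding of_int_le_iff
  proof -
    have "(\<Sum>i<L. scaled_distance I (xs ! i) (best (opens xs i) (xs ! i))) \<le> (\<Sum>i<L. pay xs i)"
      using f_nonneg best_fac d_sym by (intro sum_mono) (auto simp: pay_def price_def)
    also have "\<dots> = paid xs L"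
      using paid_eq[OF xs, of 0 L] by (simp add: L_def paid_def final_def atLeast0LessThan)
    finally show "(\<Sum>w\<in>opens xs L. scaled_cost I w) + (\<Sum>i<L. scaled_distance I (xs ! i) (best (opens xs i) (xs ! i)))
        \<le> 4 * paid xs L"
      using opens_cost[OF xs, of L] by (simp add: L_def)
  qed
  finally have cost: "?M * online_cost fl_algorithm I Xhat xs \<le> of_int (4 * paid xs L)" .
  have "opt I (set xs) \<in> solution_cost I (set xs) ` solutions I (set xs)"
    unfolding opt_def using solutions_finite_nonempty[OF wf(1,3)] by (intro Min_in) auto
  then obtain S \<phi> where sol: "(S, \<phi>) \<in> solutions I (set xs)" "opt I (set xs) = solution_cost I (set xs) (S, \<phi>)"
    by auto
  have S: "S \<subseteq> facilities I" and phi: "\<And>x. x \<in> set xs \<Longrightarrow> \<phi> x \<in> S"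
    using sol(1) by (auto simp: solutions_def)
  define V where "V = (\<Sum>s\<in>S. scaled_cost I s) + (\<Sum>x\<in>set xs. scaled_distance I x (\<phi> x))"
  have V: "of_int V = ?M * opt I (set xs)"
  proof -
    have "(\<Sum>s\<in>S. of_int (scaled_cost I s)) = (\<Sum>s\<in>S. ?M * opening_cost I s)"
      using S fac_less scaled_cost_exact(1)[of _ I] by (intro sum.cong) (auto simp: cost_of_def)
    moreover have "(\<Sum>x\<in>set xs. of_int (scaled_distance I x (\<phi> x))) = (\<Sum>x\<in>set xs. ?M * distance I x (\<phi> x))"
      using phi S fac_less xs scaled_distance_exact(1)[of _ I] by (intro sum.cong) (auto simp: subset_iff)
    ultimately show ?thesis by (simp add: V_def sol(2) solution_cost_def distrib_left sum_distrib_left)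
  qed
  have "paid xs L \<le> (26 * int (depth e) + 28) * V"
    unfolding L_def e_def using paid_le[OF xs dist S phi V_def[symmetric]] .
  then have "of_int (4 * paid xs L) \<le> (of_int (4 * ((26 * int (depth e) + 28) * V)) :: rat)"
    by (simp only: of_int_le_iff)
  also have "\<dots> = ?M * (of_int (4 * (26 * int (depth e) + 28)) * opt I (set xs))"
    using V by (simp add: algebra_simps)
  finally have "?M * online_cost fl_algorithm I Xhat xs \<le> ?M * (of_int (4 * (26 * int (depth e) + 28)) * opt I (set xs))"
    using cost by simp
  then have "online_cost fl_algorithm I Xhat xs \<le> of_int (4 * (26 * int (depth e) + 28)) * opt I (set xs)"
    using scale_pos by simp
  then have "real_of_rat (online_cost fl_algorithm I Xhat xs) \<le>
      real_of_rat (of_int (4 * (26 * int (depth e) + 28)) * opt I (set xs))"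
    by (simp only: of_rat_less_eq)
  then show "real_of_rat (online_cost fl_algorithm I Xhat xs) \<le>
      4 * (26 * real (depth (prediction_error (set xs) Xhat)) + 28) * real_of_rat (opt I (set xs))"
    unfolding e_def[symmetric] of_rat_mult of_rat_of_int_eq by simp
qed

theorem theorem3p10:
  "\<exists>(A :: online_alg) (\<rho> :: nat \<Rightarrow> real).
     feasible A \<and> polynomial_time A \<and> competitive A \<rho> \<and>
     \<rho> \<in> O(\<lambda>\<eta>. ln (real \<eta>) / ln (ln (real \<eta>)))"
proof (intro exI conjI)
  show "feasible fl_algorithm" by (rule feasible_fl_algorithm)
  show "polynomial_time fl_algorithm" by (rule polynomial_time_fl_algorithm)
  show "competitive fl_algorithm (\<lambda>e. 4 * (26 * real (depth e) + 28))" by (rule competitive_fl_algorithm)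
  have "(\<lambda>e. 4 * (26 * real (depth e) + 28)) \<in> O(\<lambda>e. real (depth e))"
  \<comment> \<open>As \<open>depth e\<close> is at least 1, the constant
    \<open>4 * (26 + 28) = 216\<close> suffices.\<close>
  proof (rule bigoI[where c = 216])
    show "\<forall>\<^sub>F e in at_top. norm (4 * (26 * real (depth e) + 28)) \<le> 216 * norm (real (depth e))"
    proof (rule always_eventually, rule allI)
      fix e show "norm (4 * (26 * real (depth e) + 28)) \<le> 216 * norm (real (depth e))"
        using depth(2)[of e] by simp
    qed
  qed
  also note depth_asymp
  finally show "(\<lambda>e. 4 * (26 * real (depth e) + 28)) \<in> O(\<lambda>\<eta>. ln (real \<eta>) / ln (ln (real \<eta>)))" .
qed

end
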